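(* Let $p$ be a prime, let $\Gamma$ be a finite simplicial graph, and let $\mathbf{A}_\Gamma$ be the pro-$p$ completion of the right-angled Artin group $A_\Gamma$. The Torelli subgroup $\mathcal{T}(\mathbf{A}_\Gamma)$ of $\mathrm{Out}(\mathbf{A}_\Gamma)$ is residually torsion-free nilpotent.
   Context: The right-angled Artin group $A_\Gamma$ has generators $s_v$, one for each vertex $v$ of $\Gamma$, and relations $[s_u,s_v]=1$ exactly for the edges $\{u,v\}$ of $\Gamma$. For a finitely generated pro-$p$ group $\mathbf{G}$, $\mathrm{Aut}(\mathbf{G})$ denotes the group of continuous automorphisms and $\mathrm{Out}(\mathbf{G})=\mathrm{Aut}(\mathbf{G})/\mathrm{Inn}(\mathbf{G})$. The Torelli subgroup is $\mathcal{T}(\mathbf{G})=\ker\big(\mathrm{Out}(\mathbf{G})\to\mathrm{Out}(\mathbf{G}/\gamma_2(\mathbf{G}))\big)$, where $\gamma_2(\mathbf{G})=[\mathbf{G},\mathbf{G}]$. A group is residually torsion-free nilpotent if every non-trivial element has non-trivial image in some torsion-free nilpotent quotient. *)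

theory Defs
  imports "HOL-Analysis.Analysis" "HOL-Algebra.Bij" "HOL-Algebra.Generated_Groups"
    "HOL-Algebra.Product_Groups" "HOL-Computational_Algebra.Primes"
begin

section \<open>Groups given by generators and relators\<close>

text \<open>A letter \<open>(s, True)\<close> stands for the generator \<open>s\<close>, and \<open>(s, False)\<close> for its formal inverse.\<close>

type_synonym 'a word = "('a \<times> bool) list"

inductive pres_eq :: "'a set \<Rightarrow> 'a word set \<Rightarrow> 'a word \<Rightarrow> 'a word \<Rightarrow> bool"
  for S :: "'a set" and R :: "'a word set"
where
  refl: "w \<in> lists (S \<times> UNIV) \<Longrightarrow> pres_eq S R w w"
| sym: "pres_eq S R v w \<Longrightarrow> pres_eq S R w v"
| trans: "pres_eq S R u v \<Longrightarrow> pres_eq S R v w \<Longrightarrow> pres_eq S R u w"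
| cancel: "u \<in> lists (S \<times> UNIV) \<Longrightarrow> v \<in> lists (S \<times> UNIV) \<Longrightarrow> s \<in> S
    \<Longrightarrow> pres_eq S R (u @ [(s, b), (s, \<not> b)] @ v) (u @ v)"
| relator: "u \<in> lists (S \<times> UNIV) \<Longrightarrow> v \<in> lists (S \<times> UNIV) \<Longrightarrow> r \<in> R \<inter> lists (S \<times> UNIV)
    \<Longrightarrow> pres_eq S R (u @ r @ v) (u @ v)"

definition pres_rel :: "'a set \<Rightarrow> 'a word set \<Rightarrow> ('a word \<times> 'a word) set" where
  "pres_rel S R = {(v, w). pres_eq S R v w}"

definition presented_group :: "'a set \<Rightarrow> 'a word set \<Rightarrow> 'a word set monoid" where
  "presented_group S R =
    \<lparr>carrier = lists (S \<times> UNIV) // pres_rel S R,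
     mult = (\<lambda>C D. \<Union>x\<in>C. \<Union>y\<in>D. pres_rel S R `` {x @ y}),
     one = pres_rel S R `` {[]}\<rparr>"

text \<open>The right-angled Artin group of the graph with vertex set \<open>V\<close> and edge set \<open>E\<close>;
  edges are two-element subsets of \<open>V\<close>.\<close>

definition raag :: "'a set \<Rightarrow> 'a set set \<Rightarrow> 'a word set monoid" where
  "raag V E = presented_group V
    {[(u, True), (v, True), (u, False), (v, False)] | u v. {u, v} \<in> E}"

section \<open>Pro-\<open>p\<close> completion\<close>

definition p_power_index_normal :: "nat \<Rightarrow> ('g, 'm) monoid_scheme \<Rightarrow> 'g set set" where
  "p_power_index_normal p G = {N. N \<lhd> G \<and> (\<exists>k. order (G Mod N) = p ^ k)}"

text \<open>The inverse limit of the finite \<open>p\<close>-group quotients \<open>G / N\<close>.  For \<open>N \<subseteq> M\<close> the transition map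
  \<open>G / N \<rightarrow> G / M\<close> sends a coset \<open>C\<close> of \<open>N\<close> to the coset \<open>M C\<close> of \<open>M\<close>.\<close>

definition pro_p_completion :: "nat \<Rightarrow> ('g, 'm) monoid_scheme \<Rightarrow> ('g set \<Rightarrow> 'g set) monoid" where
  "pro_p_completion p G =
    (product_group (p_power_index_normal p G) (\<lambda>N. G Mod N))
      \<lparr>carrier := {f \<in> (\<Pi>\<^sub>E N \<in> p_power_index_normal p G. carrier (G Mod N)).
          \<forall>N \<in> p_power_index_normal p G. \<forall>M \<in> p_power_index_normal p G.
            N \<subseteq> M \<longrightarrow> f M = M <#>\<^bsub>G\<^esub> f N}\<rparr>"

definition pro_p_topology :: "nat \<Rightarrow> ('g, 'm) monoid_scheme \<Rightarrow> ('g set \<Rightarrow> 'g set) topology" where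
  "pro_p_topology p G =
    subtopology
      (product_topology (\<lambda>N. discrete_topology (carrier (G Mod N))) (p_power_index_normal p G))
      (carrier (pro_p_completion p G))"

section \<open>Outer automorphisms of a topological group\<close>

text \<open>A topological group is given by a group \<open>G\<close> and a topology \<open>T\<close> on its carrier.
  If \<open>T\<close> is compact Hausdorff, the inverse of a continuous automorphism is continuous, so
  \<open>cont_Aut\<close> is a group.\<close>

definition cont_Aut :: "('g, 'm) monoid_scheme \<Rightarrow> 'g topology \<Rightarrow> ('g \<Rightarrow> 'g) monoid" where
  "cont_Aut G T = (AutoGroup G)\<lparr>carrier := {\<phi> \<in> auto G. continuous_map T T \<phi>}\<rparr>"

definition Inn :: "('g, 'm) monoid_scheme \<Rightarrow> ('g \<Rightarrow> 'g) set" where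
  "Inn G = {\<lambda>x\<in>carrier G. g \<otimes>\<^bsub>G\<^esub> x \<otimes>\<^bsub>G\<^esub> inv\<^bsub>G\<^esub> g | g. g \<in> carrier G}"

definition Out :: "('g, 'm) monoid_scheme \<Rightarrow> 'g topology \<Rightarrow> ('g \<Rightarrow> 'g) set monoid" where
  "Out G T = cont_Aut G T Mod Inn G"

definition quotient_topology ::
    "('g, 'm) monoid_scheme \<Rightarrow> 'g topology \<Rightarrow> 'g set \<Rightarrow> 'g set topology" where
  "quotient_topology G T N =
    topology (\<lambda>U. U \<subseteq> carrier (G Mod N) \<and> openin T {x \<in> carrier G. N #>\<^bsub>G\<^esub> x \<in> U})"

text \<open>The homomorphism \<open>Out(G) \<rightarrow> Out(G / N)\<close> for a characteristic subgroup \<open>N\<close>.  An automorphism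
  \<open>\<phi>\<close> of \<open>G\<close> acts on \<open>G / N\<close> by sending a coset \<open>D\<close> to its image \<open>\<phi> ` D\<close>.  The classes of the
  automorphisms so induced by the representatives \<open>\<phi>\<close> of \<open>C\<close> all coincide, and the union
  below is this common class.\<close>

definition Out_quotient_map ::
    "('g, 'm) monoid_scheme \<Rightarrow> 'g topology \<Rightarrow> 'g set \<Rightarrow> ('g \<Rightarrow> 'g) set \<Rightarrow> ('g set \<Rightarrow> 'g set) set" where
  "Out_quotient_map G T N C =
    (\<Union>\<phi>\<in>C. Inn (G Mod N) #>\<^bsub>cont_Aut (G Mod N) (quotient_topology G T N)\<^esub>
              (\<lambda>D\<in>carrier (G Mod N). \<phi> ` D))"

text \<open>Here \<open>\<gamma>\<^sub>2(G)\<close> is the abstract commutator subgroup; in a finitely generated pro-\<open>p\<close> group it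
  is closed (Serre), so it is also the closed subgroup generated by the commutators.\<close>

definition Torelli :: "('g, 'm) monoid_scheme \<Rightarrow> 'g topology \<Rightarrow> ('g \<Rightarrow> 'g) set monoid" where
  "Torelli G T =
    (let N = derived G (carrier G)
     in (Out G T)
          \<lparr>carrier := kernel (Out G T) (Out (G Mod N) (quotient_topology G T N))
                        (Out_quotient_map G T N)\<rparr>)"

section \<open>Residual torsion-free nilpotence\<close>

text \<open>The numbering starts at 0: \<open>lower_central G n\<close> is \<open>\<gamma>\<^sub>n\<^sub>+\<^sub>1(G)\<close>.\<close>

primrec lower_central :: "('g, 'm) monoid_scheme \<Rightarrow> nat \<Rightarrow> 'g set" where
  "lower_central G 0 = carrier G"
| "lower_central G (Suc n) =
    generate G {x \<otimes>\<^bsub>G\<^esub> y \<otimes>\<^bsub>G\<^esub> inv\<^bsub>G\<^esub> x \<otimes>\<^bsub>G\<^esub> inv\<^bsub>G\<^esub> y | x y. x \<in> lower_central G n \<and> y \<in> carrier G}"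

definition nilpotent_group :: "('g, 'm) monoid_scheme \<Rightarrow> bool" where
  "nilpotent_group G \<longleftrightarrow> group G \<and> (\<exists>n. lower_central G n = {\<one>\<^bsub>G\<^esub>})"

definition torsion_free_group :: "('g, 'm) monoid_scheme \<Rightarrow> bool" where
  "torsion_free_group G \<longleftrightarrow>
    group G \<and> (\<forall>x\<in>carrier G. \<forall>n::nat. n > 0 \<longrightarrow> x [^]\<^bsub>G\<^esub> n = \<one>\<^bsub>G\<^esub> \<longrightarrow> x = \<one>\<^bsub>G\<^esub>)"

definition residually_torsion_free_nilpotent :: "('g, 'm) monoid_scheme \<Rightarrow> bool" where
  "residually_torsion_free_nilpotent G \<longleftrightarrow>
    group G \<and>
    (\<forall>x\<in>carrier G. x \<noteq> \<one>\<^bsub>G\<^esub> \<longrightarrow>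
      (\<exists>N. N \<lhd> G \<and> torsion_free_group (G Mod N) \<and> nilpotent_group (G Mod N) \<and>
           N #>\<^bsub>G\<^esub> x \<noteq> \<one>\<^bsub>G Mod N\<^esub>))"

end

theory Submission
  imports Defs "HOL-Library.Poly_Mapping" "HOL-Algebra.Free_Abelian_Groups" "HOL-Algebra.Group_Action"
    "HOL-Algebra.Sylow" "HOL-Algebra.Multiplicative_Group"
begin

text \<open>
  Let \<open>G\<close> be the pro-\<open>p\<close> completion.  The Magnus map sends the generator \<open>s\<^sub>v\<close> to \<open>1 + v\<close> in the
  completed algebra over the \<open>p\<close>-adic integers whose generators \<open>v\<close> commute exactly along the edges
  of the graph.  An automorphism \<open>\<phi>\<close> that is trivial on the abelianization moves every \<open>v\<close> only by
  terms of degree at least two.  Let \<open>N\<^sub>k\<close> be the group of those \<open>\<phi>\<close> that act, modulo terms of degree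
  at least \<open>k\<close>, as conjugation by some unit \<open>1 + \<dots>\<close> of the algebra; the unit need not come from the
  group.  Three facts prove the theorem.

  Commuting an element of \<open>N\<^sub>k\<close> with any \<open>\<psi>\<close> lands in \<open>N\<^sub>k\<^sub>+\<^sub>1\<close> (\<open>inner_mod_commutator\<close>): after a
  correction by a conjugation the first map changes \<open>v\<close> only in degree \<open>k\<close>, where \<open>\<psi>\<close> acts trivially.

  A root of an element of \<open>N\<^sub>k\<^sub>+\<^sub>1\<close> that lies in \<open>N\<^sub>k\<close> lies in \<open>N\<^sub>k\<^sub>+\<^sub>1\<close> (\<open>inner_mod_torsion\<close>).  If the
  corrected map is \<open>v \<mapsto> v + \<delta>\<^sub>v\<close> and its \<open>q\<close>-th power is inner, then \<open>q \<delta>\<^sub>v = [w, v]\<close> for all \<open>v\<close>.  If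
  \<open>q \<noteq> p\<close>, divide by \<open>q\<close>.  If \<open>q = p\<close>, then \<open>w\<close> commutes with all generators modulo \<open>p\<close>, hence is modulo
  \<open>p\<close> a polynomial in the vertices adjacent to all others (\<open>centralizer_mod\<close>); these do not
  contribute to \<open>[w, v]\<close>, so \<open>w\<close> may be taken divisible by \<open>p\<close>.  With the first fact this makes the
  quotients by the \<open>N\<^sub>k\<close> torsion-free nilpotent.

  An automorphism in all \<open>N\<^sub>k\<close> is inner (\<open>inner_mod_all_imp_Inn\<close>).  This is an argument of Coleman about
  units of group rings.  For a finite \<open>p\<close>-group quotient \<open>Q\<close> of \<open>G\<close> the augmentation ideal of the group
  ring of \<open>Q\<close> over the field with \<open>p\<close> elements is nilpotent, so a conjugating unit modulo a large
  degree has an image in this group ring.  Its coefficients are constant along the orbits of \<open>G\<close> acting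
  on \<open>Q\<close> by \<open>q \<mapsto> \<phi>(g) q g\<^sup>-\<^sup>1\<close>, and they add up to \<open>1\<close>; orbits have \<open>p\<close>-power length, so there is a
  fixed point \<open>q\<close>, and \<open>\<phi>\<close> is conjugation by \<open>q\<close> in \<open>Q\<close>.  Compactness of \<open>G\<close> produces one conjugating
  element for all \<open>Q\<close>.

  The \<open>p\<close>-adic algebra is replaced by congruences in the free associative ring over the integers,
  modulo the ideals \<open>J (p\<^sup>n) k\<close> for all \<open>n\<close> and \<open>k\<close>.  The conjugating units may then depend on \<open>n\<close>.
\<close>

section \<open>The free associative ring\<close>

text \<open>The free monoid, written additively, so that convolution of finitely supported functions on it is
  multiplication in the free associative ring.\<close>

datatype 'a free_word = Word (letters: "'a list")

instantiation free_word :: (type) monoid_add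
begin
definition "0 = Word []"
definition "x + y = Word (letters x @ letters y)"
instance by standard (auto simp: zero_free_word_def plus_free_word_def)
end

type_synonym 'a free_alg = "'a free_word \<Rightarrow>\<^sub>0 int"

definition mon :: "'a list \<Rightarrow> 'a free_alg" where "mon w = frag_of (Word w)"
definition var :: "'a \<Rightarrow> 'a free_alg" where "var a = mon [a]"

lemma mon_append: "mon (v @ w) = mon v * mon w"
  by (simp add: mon_def mult_single plus_free_word_def)

lemma mon_Nil: "mon [] = 1"
  by (simp add: mon_def zero_free_word_def[symmetric])

lemma mon_Cons: "mon (a # w) = var a * mon w"
  using mon_append[of "[a]" w] by (simp add: var_def)

lemma free_alg_induct [case_names mon diff]:
  assumes "\<And>w. P (mon w)" "\<And>x y. P x \<Longrightarrow> P y \<Longrightarrow> P (x - y)"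
  shows "P (x :: 'a free_alg)"
proof (rule frag_induction[where S = UNIV])
  show "P 0" using assms(2)[OF assms(1) assms(1), of "[]" "[]"] by simp
  fix w :: "'a free_word" show "P (frag_of w)" using assms(1)[of "letters w"] by (simp add: mon_def)
qed (use assms in auto)

text \<open>Functions on words are the linear functionals on the free ring.\<close>

definition pair :: "'a free_alg \<Rightarrow> ('a list \<Rightarrow> int) \<Rightarrow> int" where
  "pair x f = (\<Sum>w\<in>Poly_Mapping.keys x. Poly_Mapping.lookup x w * f (letters w))"

lemma pair_superset:
  assumes "finite S" "Poly_Mapping.keys x \<subseteq> S"
  shows "pair x f = (\<Sum>w\<in>S. Poly_Mapping.lookup x w * f (letters w))"
  unfolding pair_def by (rule sum.mono_neutral_left) (use assms in \<open>auto simp: in_keys_iff\<close>)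

lemma pair_diff: "pair (x - y) f = pair x f - pair y f"
proof -
  let ?S = "Poly_Mapping.keys x \<union> Poly_Mapping.keys y"
  have "Poly_Mapping.keys (x - y) \<subseteq> ?S" by (rule keys_diff)
  then show ?thesis
    by (simp add: pair_superset[of ?S] lookup_minus left_diff_distrib sum_subtractf)
qed

lemma pair_0: "pair 0 f = 0" by (simp add: pair_def)
lemma pair_minus: "pair (- x) f = - pair x f" using pair_diff[of 0 x f] by (simp add: pair_0)
lemma pair_add: "pair (x + y) f = pair x f + pair y f"
  using pair_diff[of x "- y" f] by (simp add: pair_minus)
lemma pair_mon: "pair (mon w) f = f w" by (simp add: pair_def mon_def)
lemma pair_var: "pair (var a) f = f [a]" by (simp add: var_def pair_mon)
lemma pair_1: "pair 1 f = f []" using pair_mon[of "[]" f] by (simp add: mon_Nil)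
lemma pair_fun_diff: "pair x (\<lambda>w. f w - g w) = pair x f - pair x g"
  by (simp add: pair_def right_diff_distrib sum_subtractf)
lemma pair_fun_sum: "pair x (\<lambda>w. \<Sum>i\<in>S. f i w) = (\<Sum>i\<in>S. pair x (f i))"
  unfolding pair_def sum_distrib_left by (rule sum.swap)

lemma pair_dvd: "(\<And>w. M dvd f w) \<Longrightarrow> M dvd pair x f"
  unfolding pair_def by (rule dvd_sum) auto

lemma pair_dvd_diff: "(\<And>w. M dvd f w - g w) \<Longrightarrow> M dvd pair x f - pair x g"
  using pair_dvd[of M "\<lambda>w. f w - g w" x] by (simp add: pair_fun_diff)

text \<open>Multiplication is dual to splitting words; this turns ideal properties into translation
  properties of functions.\<close>

lemma pair_mult: "pair (x * y) f = pair x (\<lambda>a. pair y (\<lambda>b. f (a @ b)))"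
proof (induction x rule: free_alg_induct)
  case (mon v)
  show ?case
  proof (induction y rule: free_alg_induct)
    case (mon w)
    then show ?case by (simp add: mon_append[symmetric] pair_mon)
  qed (simp add: right_diff_distrib pair_diff pair_mon)
qed (simp add: left_diff_distrib pair_diff)

lemma lookup_eq_pair: "Poly_Mapping.lookup x (Word w) = pair x (\<lambda>v. if v = w then 1 else 0)"
proof (induction x rule: free_alg_induct)
  case (mon v)
  show ?case by (auto simp: pair_mon) (auto simp: mon_def lookup_single)
qed (simp add: lookup_minus pair_diff)

lemma pair_of_int: "pair (of_int c * x) f = c * pair x f"
proof -
  have n: "pair (of_nat n * x) f = of_nat n * pair x f" for n
    by (induction n) (auto simp: pair_0 pair_add algebra_simps)
  show ?thesis
    by (cases c rule: int_cases2) (auto simp: n pair_minus)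
qed

lemma free_alg_divisible:
  assumes "\<And>w. c dvd Poly_Mapping.lookup x (Word w)"
  obtains y :: "'a free_alg" where "x = of_int c * y"
proof
  show "x = of_int c * Poly_Mapping.map (\<lambda>i. i div c) x"
  proof (rule poly_mapping_eqI)
    fix w :: "'a free_word"
    obtain u where w: "w = Word u" by (cases w)
    have "Poly_Mapping.lookup (of_int c * Poly_Mapping.map (\<lambda>i. i div c) x) w
      = c * (Poly_Mapping.lookup x w div c)"
      by (simp add: w lookup_eq_pair[of "_ * _"] pair_of_int)
        (simp add: lookup_eq_pair[symmetric] map.rep_eq when_def)
    then show "Poly_Mapping.lookup x w = Poly_Mapping.lookup (of_int c * Poly_Mapping.map (\<lambda>i. i div c) x) w"
      using assms[of u] w by simp
  qed
qed

definition lin_ext :: "('a list \<Rightarrow> 'b free_alg) \<Rightarrow> 'a free_alg \<Rightarrow> 'b free_alg" where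
  "lin_ext F = frag_extend (\<lambda>w. F (letters w))"

lemma lin_ext_mon: "lin_ext F (mon w) = F w" by (simp add: lin_ext_def mon_def)
lemma lin_ext_diff: "lin_ext F (x - y) = lin_ext F x - lin_ext F y" by (simp add: lin_ext_def frag_extend_diff)
lemma pair_lin_ext: "pair (lin_ext F x) f = pair x (\<lambda>w. pair (F w) f)"
  by (induction x rule: free_alg_induct) (auto simp: lin_ext_mon lin_ext_diff pair_mon pair_diff)

definition subst :: "('a \<Rightarrow> 'b free_alg) \<Rightarrow> 'a free_alg \<Rightarrow> 'b free_alg" where
  "subst X = lin_ext (\<lambda>w. prod_list (map X w))"

definition ring_endo :: "('a free_alg \<Rightarrow> 'a free_alg) \<Rightarrow> bool" where
  "ring_endo \<Phi> \<longleftrightarrow> (\<forall>x y. \<Phi> (x - y) = \<Phi> x - \<Phi> y) \<and> (\<forall>x y. \<Phi> (x * y) = \<Phi> x * \<Phi> y) \<and> \<Phi> 1 = 1"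

lemma subst_mon: "subst X (mon w) = prod_list (map X w)" by (simp add: subst_def lin_ext_mon)
lemma subst_var: "subst X (var a) = X a" by (simp add: var_def subst_mon)

lemma ring_endo_subst: "ring_endo (subst X)"
proof -
  have "subst X (x * y) = subst X x * subst X y" for x y
  proof (induction x rule: free_alg_induct)
    case (mon v)
    show ?case
    proof (induction y rule: free_alg_induct)
      case (mon w)
      then show ?case by (simp add: mon_append[symmetric] subst_mon)
    qed (simp add: right_diff_distrib subst_def lin_ext_diff)
  qed (simp add: left_diff_distrib subst_def lin_ext_diff)
  moreover have "subst X 1 = 1" using subst_mon[of X "[]"] by (simp add: mon_Nil)
  ultimately show ?thesis by (simp add: ring_endo_def) (simp add: subst_def lin_ext_diff)
qed

section \<open>The truncated Magnus algebra\<close>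

locale commutation_graph =
  fixes V :: "'a set" and E :: "'a set set"
  assumes finV: "finite V" and E2: "\<And>e. e \<in> E \<Longrightarrow> e \<subseteq> V \<and> card e = 2"
begin

text \<open>The linear functionals on the algebra over \<open>\<int>/M\<close> of the trace monoid (words over \<open>V\<close> up to the
  commutations given by \<open>E\<close>), truncated at degree \<open>k\<close>.\<close>

definition trace_fun :: "int \<Rightarrow> nat \<Rightarrow> ('a list \<Rightarrow> int) \<Rightarrow> bool" where
  "trace_fun M k f \<longleftrightarrow>
    (\<forall>x a b y. {a, b} \<in> E \<longrightarrow> M dvd f (x @ [a, b] @ y) - f (x @ [b, a] @ y)) \<and>
    (\<forall>w. k \<le> length w \<or> \<not> set w \<subseteq> V \<longrightarrow> M dvd f w)"

text \<open>The common kernel of these functionals.  The quotient by \<open>J M k\<close> is the Magnus algebra with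
  coefficients \<open>\<int>/M\<close>, truncated at degree \<open>k\<close>, and \<open>J M j\<close> with \<open>j \<le> k\<close> induces its filtration by
  degree.  Letters outside \<open>V\<close> are zero.\<close>

definition J :: "int \<Rightarrow> nat \<Rightarrow> 'a free_alg set" where
  "J M k = {x. \<forall>f. trace_fun M k f \<longrightarrow> M dvd pair x f}"

lemma J_I: "(\<And>f. trace_fun M k f \<Longrightarrow> M dvd pair x f) \<Longrightarrow> x \<in> J M k" by (simp add: J_def)
lemma J_D: "x \<in> J M k \<Longrightarrow> trace_fun M k f \<Longrightarrow> M dvd pair x f" by (simp add: J_def)

lemma trace_fun_swap: "trace_fun M k f \<Longrightarrow> {a, b} \<in> E \<Longrightarrow> M dvd f (x @ [a, b] @ y) - f (x @ [b, a] @ y)"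
  unfolding trace_fun_def by blast
lemma trace_fun_zero: "trace_fun M k f \<Longrightarrow> k \<le> length w \<or> \<not> set w \<subseteq> V \<Longrightarrow> M dvd f w"
  unfolding trace_fun_def by blast

lemma trace_fun_mono: "trace_fun M k' f \<Longrightarrow> k' \<le> k \<Longrightarrow> trace_fun M k f"
  unfolding trace_fun_def by auto

lemma trace_fun_pre: "trace_fun M k f \<Longrightarrow> trace_fun M (k - length v) (\<lambda>w. f (v @ w))"
  unfolding trace_fun_def
proof (elim conjE, intro conjI allI impI)
  fix x a b y assume "\<forall>x a b y. {a, b} \<in> E \<longrightarrow> M dvd f (x @ [a, b] @ y) - f (x @ [b, a] @ y)" "{a, b} \<in> E"
  then have "M dvd f ((v @ x) @ [a, b] @ y) - f ((v @ x) @ [b, a] @ y)" by blast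
  then show "M dvd f (v @ x @ [a, b] @ y) - f (v @ x @ [b, a] @ y)" by simp
next
  fix w assume "\<forall>w. k \<le> length w \<or> \<not> set w \<subseteq> V \<longrightarrow> M dvd f w" "k - length v \<le> length w \<or> \<not> set w \<subseteq> V"
  then show "M dvd f (v @ w)" by (metis add.commute le_diff_conv length_append set_append sup.bounded_iff)
qed

lemma trace_fun_post: "trace_fun M k f \<Longrightarrow> trace_fun M (k - length v) (\<lambda>w. f (w @ v))"
  unfolding trace_fun_def
proof (elim conjE, intro conjI allI impI)
  fix w assume "\<forall>w. k \<le> length w \<or> \<not> set w \<subseteq> V \<longrightarrow> M dvd f w" "k - length v \<le> length w \<or> \<not> set w \<subseteq> V"
  then show "M dvd f (w @ v)" by (metis le_diff_conv length_append set_append sup.bounded_iff)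
qed simp

lemma J_zero [simp]: "0 \<in> J M k" by (simp add: J_def pair_0)
lemma J_diff: "x \<in> J M k \<Longrightarrow> y \<in> J M k \<Longrightarrow> x - y \<in> J M k" by (simp add: J_def pair_diff)
lemma J_add: "x \<in> J M k \<Longrightarrow> y \<in> J M k \<Longrightarrow> x + y \<in> J M k" by (simp add: J_def pair_add)
lemma J_minus: "x \<in> J M k \<Longrightarrow> - x \<in> J M k" by (simp add: J_def pair_minus)
lemma J_sym: "x - y \<in> J M k \<Longrightarrow> y - x \<in> J M k" using J_minus[of "x - y"] by simp
lemma J_trans: "x - y \<in> J M k \<Longrightarrow> y - z \<in> J M k \<Longrightarrow> x - z \<in> J M k"
  using J_add[of "x - y" M k "y - z"] by simp
lemma J_mult_left: "y \<in> J M k \<Longrightarrow> x * y \<in> J M k"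
proof (rule J_I)
  fix f assume y: "y \<in> J M k" and f: "trace_fun M k f"
  have "M dvd pair y (\<lambda>b. f (a @ b))" for a
    using trace_fun_mono[OF trace_fun_pre[OF f, of a], of k] J_D[OF y] by simp
  then show "M dvd pair (x * y) f" unfolding pair_mult by (rule pair_dvd)
qed

lemma pair_mult': "pair (x * y) f = pair y (\<lambda>b. pair x (\<lambda>a. f (a @ b)))"
  unfolding pair_mult by (simp add: pair_def sum_distrib_left mult.left_commute) (rule sum.swap)

lemma J_mult_right: "y \<in> J M k \<Longrightarrow> y * x \<in> J M k"
proof (rule J_I)
  fix f assume y: "y \<in> J M k" and f: "trace_fun M k f"
  have "M dvd pair y (\<lambda>b. f (b @ a))" for a
    using trace_fun_mono[OF trace_fun_post[OF f, of a], of k] J_D[OF y] by simp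
  then show "M dvd pair (y * x) f" unfolding pair_mult' by (rule pair_dvd)
qed

lemma J_mult_cong: "x - x' \<in> J M k \<Longrightarrow> y - y' \<in> J M k \<Longrightarrow> x * y - x' * y' \<in> J M k"
proof -
  assume "x - x' \<in> J M k" "y - y' \<in> J M k"
  then have "(x - x') * y + x' * (y - y') \<in> J M k" by (intro J_add J_mult_left J_mult_right)
  then show ?thesis by (simp add: algebra_simps)
qed

lemma J_diff_cong: "x - x' \<in> J M k \<Longrightarrow> y - y' \<in> J M k \<Longrightarrow> (x - y) - (x' - y') \<in> J M k"
  using J_diff[of "x - x'" M k "y - y'"] by (simp add: algebra_simps)
lemma J_refl: "x - x \<in> J M k" by simp
lemma J_transfer: "x - y \<in> J M k \<Longrightarrow> y \<in> J M k \<Longrightarrow> x \<in> J M k"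
  using J_add[of "x - y" M k y] by simp

text \<open>A functional that is invariant only modulo \<open>M\<close> becomes invariant on the nose when its values are
  reduced modulo \<open>M\<close>, so it lifts to every other modulus.  This is where freeness of the algebra over
  its coefficients enters.\<close>

lemma trace_fun_mod: assumes "trace_fun M k f" shows "trace_fun N k (\<lambda>w. f w mod M)"
  unfolding trace_fun_def
proof (intro conjI allI impI)
  fix x a b y assume "{a, b} \<in> E"
  then have "f (x @ [a, b] @ y) mod M = f (x @ [b, a] @ y) mod M"
    using trace_fun_swap[OF assms] by (simp add: mod_eq_dvd_iff)
  then show "N dvd f (x @ [a, b] @ y) mod M - f (x @ [b, a] @ y) mod M" by simp
next
  fix w assume "k \<le> length w \<or> \<not> set w \<subseteq> V"
  then have "f w mod M = 0" using trace_fun_zero[OF assms] by simp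
  then show "N dvd f w mod M" by simp
qed

lemma J_mono: assumes "x \<in> J M k" "M' dvd M" "k' \<le> k" shows "x \<in> J M' k'"
proof (rule J_I)
  fix f assume f: "trace_fun M' k' f"
  let ?g = "\<lambda>w. f w mod M'"
  have "trace_fun M k ?g" using trace_fun_mod[OF trace_fun_mono[OF f assms(3)]] .
  then have "M' dvd pair x ?g" using J_D[OF assms(1)] assms(2) dvd_trans by blast
  moreover have "M' dvd pair x f - pair x ?g"
    by (rule pair_dvd_diff) (simp add: minus_mod_eq_mult_div)
  ultimately show "M' dvd pair x f" by (metis dvd_add_left_iff diff_add_cancel)
qed

lemma J_scale_cancel: assumes "of_int c * x \<in> J (c * M) k" "c \<noteq> 0" shows "x \<in> J M k"
proof (rule J_I)
  fix f assume f: "trace_fun M k f"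
  let ?g = "\<lambda>w. f w mod M"
  have "trace_fun (c * M) k ?g" using trace_fun_mod[OF f] .
  then have "c * M dvd pair (of_int c * x) ?g" using J_D[OF assms(1)] by blast
  then have "M dvd pair x ?g" using assms(2) by (simp add: pair_of_int)
  moreover have "M dvd pair x f - pair x ?g"
    by (rule pair_dvd_diff) (simp add: minus_mod_eq_mult_div)
  ultimately show "M dvd pair x f" by (metis dvd_add_left_iff diff_add_cancel)
qed

lemma J_modulus: "of_int M * x \<in> J M k" by (rule J_I) (simp add: pair_of_int)

lemma J_0: "x \<in> J M 0" by (rule J_I, rule pair_dvd) (simp add: trace_fun_def)

text \<open>The product of terms of degree at least \<open>i\<close> and \<open>j\<close> has degree at least \<open>i + j\<close>: as a function of
  \<open>a\<close>, the pairing of \<open>y\<close> with \<open>f (a @ \<dots>)\<close> vanishes as soon as \<open>a\<close> has length \<open>i\<close>.\<close>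

lemma J_times: assumes x: "x \<in> J M i" and y: "y \<in> J M j" shows "x * y \<in> J M (i + j)"
proof (rule J_I)
  fix f assume f: "trace_fun M (i + j) f"
  let ?h = "\<lambda>a. pair y (\<lambda>b. f (a @ b))"
  have "trace_fun M i ?h" unfolding trace_fun_def
  proof (intro conjI allI impI)
    fix u a b v assume "{a, b} \<in> E"
    then have "M dvd f (u @ [a, b] @ (v @ w)) - f (u @ [b, a] @ (v @ w))" for w
      using trace_fun_swap[OF f] by blast
    then show "M dvd ?h (u @ [a, b] @ v) - ?h (u @ [b, a] @ v)" by (intro pair_dvd_diff) simp
  next
    fix w assume w: "i \<le> length w \<or> \<not> set w \<subseteq> V"
    show "M dvd ?h w"
    proof (cases "set w \<subseteq> V")
      case False
      then show ?thesis by (intro pair_dvd trace_fun_zero[OF f]) auto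
    next
      case True
      then have "i + j - length w \<le> j" using w by auto
      then show ?thesis using J_D[OF y] trace_fun_mono[OF trace_fun_pre[OF f, of w]] by blast
    qed
  qed
  then show "M dvd pair (x * y) f" unfolding pair_mult using J_D[OF x] by blast
qed

lemma mon_in_J: "k \<le> length w \<or> \<not> set w \<subseteq> V \<Longrightarrow> mon w \<in> J M k"
  by (rule J_I) (simp add: pair_mon trace_fun_zero)

lemma var_in_J1: "var a \<in> J M 1" unfolding var_def by (rule mon_in_J) simp

lemma var_notin: "a \<notin> V \<Longrightarrow> var a \<in> J M k" unfolding var_def by (rule mon_in_J) simp

lemma var_comm: "{a, b} \<in> E \<Longrightarrow> var a * var b - var b * var a \<in> J M k"
proof (rule J_I)
  fix f assume "{a, b} \<in> E" "trace_fun M k f"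
  then show "M dvd pair (var a * var b - var b * var a) f"
    using trace_fun_swap[of M k f a b "[]" "[]"]
    by (simp add: pair_diff mon_append[symmetric] var_def pair_mon)
qed

lemma J1_const: "x - of_int (pair x (\<lambda>w. if w = [] then 1 else 0)) \<in> J M 1"
proof (rule J_I)
  fix f assume f: "trace_fun M 1 f"
  have "M dvd pair x f - pair x (\<lambda>w. if w = [] then f [] else 0)"
    by (rule pair_dvd_diff) (use trace_fun_zero[OF f] in \<open>auto simp: Suc_le_eq\<close>)
  moreover have "pair x (\<lambda>w. if w = [] then f [] else 0) = pair x (\<lambda>w. if w = [] then 1 else 0) * f []"
    unfolding pair_def sum_distrib_right by (rule sum.cong) auto
  ultimately show "M dvd pair (x - of_int (pair x (\<lambda>w. if w = [] then 1 else 0))) f"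
    using pair_of_int[of _ 1 f] by (simp add: pair_diff pair_1)
qed

section \<open>Units\<close>

lemma power_J1: "y \<in> J M 1 \<Longrightarrow> y ^ k \<in> J M k"
proof (induction k)
  case 0 then show ?case by (simp add: J_0)
next
  case (Suc k)
  then show ?case using J_times[of y M 1 "y ^ k" k] by simp
qed

text \<open>The geometric series, cut off where its terms vanish.\<close>

definition trunc_inv :: "nat \<Rightarrow> 'a free_alg \<Rightarrow> 'a free_alg" where
  "trunc_inv k u = (\<Sum>i<k. (1 - u) ^ i)"

lemma trunc_inv:
  assumes "u - 1 \<in> J M 1"
  shows "u * trunc_inv k u - 1 \<in> J M k" "trunc_inv k u * u - 1 \<in> J M k" "k \<ge> 1 \<Longrightarrow> trunc_inv k u - 1 \<in> J M 1"
proof -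
  let ?y = "1 - u"
  have y: "?y \<in> J M 1" using J_sym[OF assms] .
  have e: "(1 - x) * (\<Sum>i<k. x ^ i) = 1 - x ^ k" for x :: "'a free_alg"
    by (induction k) (simp_all add: distrib_left left_diff_distrib)
  have c: "(\<Sum>i<k. ?y ^ i) * ?y = ?y * (\<Sum>i<k. ?y ^ i)"
    by (simp add: sum_distrib_left sum_distrib_right power_commutes)
  have "u * trunc_inv k u - 1 = - (?y ^ k)" using e[of ?y] by (simp add: trunc_inv_def)
  then show 1: "u * trunc_inv k u - 1 \<in> J M k" using power_J1[OF y, of k] by (simp add: J_minus)
  have "trunc_inv k u * u = u * trunc_inv k u" using c unfolding trunc_inv_def by (simp add: algebra_simps)
  then show "trunc_inv k u * u - 1 \<in> J M k" using 1 by simp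
  assume k: "k \<ge> 1"
  have "u * trunc_inv k u - 1 \<in> J M 1" using J_mono[OF 1 dvd_refl k] .
  moreover have "(u - 1) * trunc_inv k u \<in> J M 1" using J_mult_right[OF assms] .
  ultimately have "(u * trunc_inv k u - 1) - (u - 1) * trunc_inv k u \<in> J M 1" by (rule J_diff)
  then show "trunc_inv k u - 1 \<in> J M 1" by (simp add: algebra_simps)
qed

lemma unit_mult: "u - 1 \<in> J M k \<Longrightarrow> v - 1 \<in> J M k \<Longrightarrow> u * v - 1 \<in> J M k"
  using J_mult_cong[of u 1 M k v 1] by simp

text \<open>In \<open>(1 + y)\<^sup>M = 1 + M y + y\<^sup>2 (\<dots>)\<close> the second term vanishes modulo \<open>M\<close> and the third has larger degree
  than \<open>y\<close>.  Iterating, units of constant term one have order a power of \<open>M\<close>.\<close>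

lemma power_modulus_step:
  assumes "z - 1 \<in> J (int M) i" "i \<ge> 1"
  shows "z ^ M - 1 \<in> J (int M) (Suc i)"
proof -
  let ?y = "z - 1"
  have yy: "?y * x * ?y \<in> J (int M) (Suc i)" for x
    by (rule J_mono[OF J_times[OF J_mult_right[OF assms(1)] assms(1)]]) (use assms(2) in auto)
  have "z ^ n - 1 - of_nat n * ?y \<in> J (int M) (Suc i)" for n
  proof (induction n)
    case (Suc n)
    have "z * (z ^ n - 1 - of_nat n * ?y) + ?y * of_nat n * ?y \<in> J (int M) (Suc i)"
      using J_mult_left[OF Suc] yy by (intro J_add)
    then show ?case by (simp add: algebra_simps)
  qed simp
  then have "(z ^ M - 1 - of_nat M * ?y) + of_int (int M) * ?y \<in> J (int M) (Suc i)"
    using J_modulus by (intro J_add) blast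
  then show ?thesis by simp
qed

lemma power_modulus: assumes "z - 1 \<in> J (int M) 1" shows "z ^ (M ^ k) - 1 \<in> J (int M) (Suc k)"
proof (induction k)
  case 0 show ?case using assms by simp
next
  case (Suc k)
  then show ?case using power_modulus_step[of "z ^ (M ^ k)" M "Suc k"] by (simp add: power_mult[symmetric] mult.commute)
qed

lemma J_coeffI:
  assumes "\<And>w. set w \<subseteq> V \<Longrightarrow> length w < k \<Longrightarrow> M dvd Poly_Mapping.lookup x (Word w)"
  shows "x \<in> J M k"
proof (rule J_I)
  fix f assume f: "trace_fun M k f"
  show "M dvd pair x f" unfolding pair_def
  proof (rule dvd_sum)
    fix w :: "'a free_word"
    show "M dvd Poly_Mapping.lookup x w * f (letters w)"
      using assms[of "letters w"] trace_fun_zero[OF f, of "letters w"]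
      by (metis dvd_mult dvd_mult2 free_word.collapse not_le)
  qed
qed

section \<open>Endomorphisms of the Magnus algebra\<close>

lemma endo_simps:
  assumes "ring_endo \<Phi>"
  shows "\<Phi> (x - y) = \<Phi> x - \<Phi> y" "\<Phi> (x * y) = \<Phi> x * \<Phi> y" "\<Phi> 1 = 1" "\<Phi> 0 = 0" "\<Phi> (- x) = - \<Phi> x" "\<Phi> (x + y) = \<Phi> x + \<Phi> y"
proof -
  have d: "\<Phi> (x - y) = \<Phi> x - \<Phi> y" for x y using assms unfolding ring_endo_def by blast
  then show "\<Phi> (x - y) = \<Phi> x - \<Phi> y" .
  show "\<Phi> (x * y) = \<Phi> x * \<Phi> y" "\<Phi> 1 = 1" using assms unfolding ring_endo_def by blast+
  show 0: "\<Phi> 0 = 0" using d[of 0 0] by simp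
  have m: "\<Phi> (- x) = - \<Phi> x" for x using d[of 0 x] 0 by simp
  then show "\<Phi> (- x) = - \<Phi> x" .
  show "\<Phi> (x + y) = \<Phi> x + \<Phi> y" using d[of x "- y"] by (simp add: m)
qed

lemma endo_cong_generators:
  assumes "ring_endo \<Phi>" "ring_endo \<Psi>" "\<And>a. \<Phi> (var a) - \<Psi> (var a) \<in> J M k"
  shows "\<Phi> x - \<Psi> x \<in> J M k"
proof (induction x rule: free_alg_induct)
  case (mon w)
  show ?case
  proof (induction w)
    case Nil then show ?case by (simp add: mon_Nil endo_simps[OF assms(1)] endo_simps[OF assms(2)])
  next
    case (Cons a w)
    then show ?case using J_mult_cong[OF assms(3)] by (simp add: mon_Cons endo_simps[OF assms(1)] endo_simps[OF assms(2)])
  qed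
next
  case (diff x y)
  then show ?case using J_diff_cong by (simp add: endo_simps[OF assms(1)] endo_simps[OF assms(2)])
qed

lemma prod_list_J: "(\<And>a. X a \<in> J M 1) \<Longrightarrow> prod_list (map X w) \<in> J M (length w)"
proof (induction w)
  case (Cons a w) then show ?case using J_times[of "X a" M 1 "prod_list (map X w)"] by simp
qed (simp add: J_0)

text \<open>A substitution that respects the commutations and has no constant terms pulls functionals of
  degree \<open>j\<close> back to functionals of degree \<open>j\<close>.\<close>

lemma subst_J:
  assumes X1: "\<And>a. X a \<in> J M 1" and Xc: "\<And>a b. {a, b} \<in> E \<Longrightarrow> X a * X b - X b * X a \<in> J M k"
    and Xv: "\<And>a. a \<notin> V \<Longrightarrow> X a \<in> J M k" and "j \<le> k" and f: "trace_fun M j f"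
  shows "trace_fun M j (\<lambda>w. pair (prod_list (map X w)) f)"
  unfolding trace_fun_def
proof (intro conjI allI impI)
  fix x a b y assume "{a, b} \<in> E"
  then have "prod_list (map X x) * (X a * X b - X b * X a) * prod_list (map X y) \<in> J M j"
    by (intro J_mult_left J_mult_right J_mono[OF Xc dvd_refl \<open>j \<le> k\<close>])
  from J_D[OF this f] have "M dvd pair (prod_list (map X x) * (X a * X b - X b * X a) * prod_list (map X y)) f" .
  then show "M dvd pair (prod_list (map X (x @ [a, b] @ y))) f - pair (prod_list (map X (x @ [b, a] @ y))) f"
    unfolding pair_diff[symmetric] by (simp add: left_diff_distrib right_diff_distrib mult.assoc)
next
  fix w assume w: "j \<le> length w \<or> \<not> set w \<subseteq> V"
  have "prod_list (map X w) \<in> J M j"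
  proof (cases "set w \<subseteq> V")
    case True
    then have "j \<le> length w" using w by simp
    then show ?thesis by (rule J_mono[OF prod_list_J[of X, OF X1] dvd_refl])
  next
    case False
    then obtain a where a: "a \<in> set w" "a \<notin> V" by blast
    then obtain x y where "w = x @ a # y" by (meson split_list)
    then have "prod_list (map X w) = prod_list (map X x) * (X a * prod_list (map X y))" by simp
    moreover have "\<dots> \<in> J M j"
      by (intro J_mult_left J_mult_right J_mono[OF Xv[OF a(2)] dvd_refl \<open>j \<le> k\<close>])
    ultimately show ?thesis by simp
  qed
  from J_D[OF this f] show "M dvd pair (prod_list (map X w)) f" .
qed

lemma subst_preserves_J:
  assumes "\<And>a. X a \<in> J M 1" "\<And>a b. {a, b} \<in> E \<Longrightarrow> X a * X b - X b * X a \<in> J M k"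
    "\<And>a. a \<notin> V \<Longrightarrow> X a \<in> J M k" "j \<le> k" "x \<in> J M j"
  shows "subst X x \<in> J M j"
  by (rule J_I) (use J_D[OF assms(5)] subst_J[OF assms(1-4)] in \<open>simp add: subst_def pair_lin_ext\<close>)

definition J_endo :: "int \<Rightarrow> nat \<Rightarrow> ('a free_alg \<Rightarrow> 'a free_alg) \<Rightarrow> bool" where
  "J_endo M k \<Phi> \<longleftrightarrow> ring_endo \<Phi> \<and> (\<forall>j\<le>k. \<forall>x\<in>J M j. \<Phi> x \<in> J M j)"

lemma J_endoD: "J_endo M k \<Phi> \<Longrightarrow> ring_endo \<Phi>" "J_endo M k \<Phi> \<Longrightarrow> j \<le> k \<Longrightarrow> x \<in> J M j \<Longrightarrow> \<Phi> x \<in> J M j"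
  by (auto simp: J_endo_def)

lemma J_endo_cong: "J_endo M k \<Phi> \<Longrightarrow> j \<le> k \<Longrightarrow> x - y \<in> J M j \<Longrightarrow> \<Phi> x - \<Phi> y \<in> J M j"
  using J_endoD(2)[of M k \<Phi> j "x - y"] by (simp add: endo_simps[OF J_endoD(1)])

lemma J_endo_subst:
  assumes "\<And>a. X a \<in> J M 1" "\<And>a b. {a, b} \<in> E \<Longrightarrow> X a * X b - X b * X a \<in> J M k"
    "\<And>a. a \<notin> V \<Longrightarrow> X a \<in> J M k"
  shows "J_endo M k (subst X)"
  using subst_preserves_J[OF assms] ring_endo_subst by (auto simp: J_endo_def)

lemma diff_interchange: "(a :: 'b :: ab_group_add) - b - (c - d) = a - c - (b - d)"
  by (simp add: algebra_simps)

text \<open>If the generators move by terms of degree \<open>d\<close>, then a word of length \<open>i\<close> moves by terms of degree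
  \<open>i + d - 1\<close>, since each of its letters does.  The claim is for all elements of the filtration because
  \<open>w \<mapsto> \<Phi> w - w\<close> composed with a functional is again a functional.\<close>

lemma J_endo_shift:
  assumes \<Phi>: "J_endo M k \<Phi>" and d: "\<And>a. \<Phi> (var a) - var a \<in> J M d" "d \<ge> 1"
    and x: "x \<in> J M i" and k: "i + d - 1 \<le> k" and i: "i \<ge> 1"
  shows "\<Phi> x - x \<in> J M (i + d - 1)"
proof -
  note re = endo_simps[OF J_endoD(1)[OF \<Phi>]]
  have shift_mon: "\<Phi> (mon w) - mon w \<in> J M (length w + d - 1)" if "w \<noteq> []" for w
    using that
  proof (induction w)
    case (Cons a w)
    show ?case
    proof (cases "w = []")
      case True then show ?thesis using d by (simp add: var_def)
    next
      case False
      have "(\<Phi> (var a) - var a) * \<Phi> (mon w) \<in> J M (length (a # w) + d - 1)"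
      proof (cases "length w \<le> k")
        case True
        have "\<Phi> (mon w) \<in> J M (length w)" using J_endoD(2)[OF \<Phi> True] mon_in_J by blast
        then show ?thesis using J_mono[OF J_times[OF d(1)] dvd_refl] by simp
      next
        case False
        have pl: "\<Phi> (mon v) \<in> J M (length v)" for v
        proof (induction v)
          case (Cons b v)
          have "1 \<le> k" using k i d(2) by linarith
          then have "\<Phi> (var b) \<in> J M 1" by (rule J_endoD(2)[OF \<Phi> _ var_in_J1])
          then show ?case using J_times[OF _ Cons, of _ 1] by (simp add: mon_Cons re)
        qed (simp add: J_0)
        then show ?thesis using J_mono[OF J_times[OF d(1) pl] dvd_refl] by simp
      qed
      moreover have "var a * (\<Phi> (mon w) - mon w) \<in> J M (length (a # w) + d - 1)"
        using J_mono[OF J_times[OF var_in_J1 Cons(1)[OF False]] dvd_refl] d(2) by simp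
      moreover have "\<Phi> (mon (a # w)) - mon (a # w)
          = (\<Phi> (var a) - var a) * \<Phi> (mon w) + var a * (\<Phi> (mon w) - mon w)"
        unfolding mon_Cons re(2) by (simp add: left_diff_distrib right_diff_distrib)
      ultimately show ?thesis by (simp only: J_add)
    qed
  qed simp
  have eq: "pair (\<Phi> x - x) f = pair x (\<lambda>w. pair (\<Phi> (mon w) - mon w) f)" for f x
    by (induction x rule: free_alg_induct) (auto simp: pair_mon re pair_diff)
  show ?thesis
  proof (rule J_I)
    fix f assume f: "trace_fun M (i + d - 1) f"
    have "trace_fun M i (\<lambda>w. pair (\<Phi> (mon w) - mon w) f)" unfolding trace_fun_def
    proof (intro conjI allI impI)
      fix x a b y assume ab: "{a, b} \<in> E"
      let ?c = "mon x * (var a * var b - var b * var a) * mon y"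
      have c: "?c \<in> J M (i + d - 1)" by (rule J_mult_right[OF J_mult_left[OF var_comm[OF ab]]])
      then have "M dvd pair (\<Phi> ?c - ?c) f"
        using J_D[OF J_diff[OF J_endoD(2)[OF \<Phi> k c] c] f] by simp
      moreover have "?c = mon (x @ [a, b] @ y) - mon (x @ [b, a] @ y)"
        by (simp add: mon_append mon_Cons mon_Nil left_diff_distrib right_diff_distrib mult.assoc)
      ultimately have "M dvd pair (\<Phi> (mon (x @ [a, b] @ y)) - \<Phi> (mon (x @ [b, a] @ y)) - (mon (x @ [a, b] @ y) - mon (x @ [b, a] @ y))) f"
        by (simp only: re(1))
      then show "M dvd pair (\<Phi> (mon (x @ [a, b] @ y)) - mon (x @ [a, b] @ y)) f
          - pair (\<Phi> (mon (x @ [b, a] @ y)) - mon (x @ [b, a] @ y)) f"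
        unfolding pair_diff[symmetric] by (subst diff_interchange)
    next
      fix w assume w: "i \<le> length w \<or> \<not> set w \<subseteq> V"
      have "\<Phi> (mon w) - mon w \<in> J M (i + d - 1)"
      proof (cases "set w \<subseteq> V")
        case True
        then have "i \<le> length w" using w by simp
        then show ?thesis using J_mono[OF shift_mon[of w] dvd_refl, of "i + d - 1"] i by force
      next
        case False
        then have "mon w \<in> J M (i + d - 1)" by (intro mon_in_J) simp
        then show ?thesis using J_diff J_endoD(2)[OF \<Phi> k] by blast
      qed
      then show "M dvd pair (\<Phi> (mon w) - mon w) f" using J_D f by blast
    qed
    then show "M dvd pair (\<Phi> x - x) f" unfolding eq[where x = x and f = f] using J_D[OF x] by blast
  qed
qed

section \<open>Commutation classes and the centralizer of the generators\<close>

text \<open>Equality of traces, tested on the projections to pairs of non-commuting letters (and to single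
  letters, the case \<open>a = b\<close>).  In this form the trace monoid is visibly cancellative.\<close>

definition trace_eq :: "'a list \<Rightarrow> 'a list \<Rightarrow> bool" where
  "trace_eq v w \<longleftrightarrow> (\<forall>a b. {a, b} \<notin> E \<longrightarrow> filter (\<lambda>c. c = a \<or> c = b) v = filter (\<lambda>c. c = a \<or> c = b) w)"

lemma trace_eqD: "trace_eq v w \<Longrightarrow> {a, b} \<notin> E \<Longrightarrow> filter (\<lambda>c. c = a \<or> c = b) v = filter (\<lambda>c. c = a \<or> c = b) w"
  by (simp add: trace_eq_def)

lemma no_loop: "{a, b} \<in> E \<Longrightarrow> a \<noteq> b" using E2[of "{a, b}"] by auto

lemma trace_eq_refl: "trace_eq w w" by (simp add: trace_eq_def)
lemma trace_eq_sym: "trace_eq v w \<Longrightarrow> trace_eq w v" by (simp add: trace_eq_def)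
lemma trace_eq_trans: "trace_eq u v \<Longrightarrow> trace_eq v w \<Longrightarrow> trace_eq u w" by (simp add: trace_eq_def)
lemma trace_eq_append: "trace_eq v v' \<Longrightarrow> trace_eq w w' \<Longrightarrow> trace_eq (v @ w) (v' @ w')" by (simp add: trace_eq_def)
lemma trace_eq_cancel_left: "trace_eq (u @ v) (u @ w) \<longleftrightarrow> trace_eq v w" by (simp add: trace_eq_def)
lemma trace_eq_cancel_right: "trace_eq (v @ u) (w @ u) \<longleftrightarrow> trace_eq v w" by (simp add: trace_eq_def)

lemma trace_eq_swap: "{a, b} \<in> E \<Longrightarrow> trace_eq [a, b] [b, a]"
  unfolding trace_eq_def
proof (intro allI impI)
  fix c d assume ab: "{a, b} \<in> E" and cd: "{c, d} \<notin> E"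
  have "{a, b} \<noteq> {c, d}" by (rule notI) (use ab cd in simp)
  then have "\<not> (a \<in> {c, d} \<and> b \<in> {c, d})" using no_loop[OF ab] by (auto simp only: insert_iff empty_iff)
  then show "filter (\<lambda>e. e = c \<or> e = d) [a, b] = filter (\<lambda>e. e = c \<or> e = d) [b, a]"
    by simp blast
qed

lemma trace_eq_count: "trace_eq v w \<Longrightarrow> count_list v a = count_list w a"
proof -
  assume "trace_eq v w"
  moreover have "{a, a} \<notin> E" using no_loop[of a a] by blast
  ultimately have "filter (\<lambda>c. c = a \<or> c = a) v = filter (\<lambda>c. c = a \<or> c = a) w" by (rule trace_eqD)
  moreover have "(=) a = (\<lambda>c. c = a)" by auto
  ultimately show ?thesis by (simp add: count_list_eq_length_filter)
qed

lemma trace_eq_set: assumes "trace_eq v w" shows "set v = set w"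
proof (rule Set.set_eqI)
  fix x
  from assms have "count_list v x = count_list w x" by (rule trace_eq_count)
  then show "x \<in> set v \<longleftrightarrow> x \<in> set w" using count_list_0_iff[of v x] count_list_0_iff[of w x] by simp
qed

lemma trace_eq_length: "trace_eq v w \<Longrightarrow> length v = length w"
proof -
  assume h: "trace_eq v w"
  have "length v = sum (count_list v) (set w)"
    by (rule sum_count_set[symmetric]) (simp_all add: trace_eq_set[OF h])
  also have "\<dots> = sum (count_list w) (set w)" by (rule sum.cong) (simp_all add: trace_eq_count[OF h])
  also have "\<dots> = length w" by (rule sum_count_set) simp_all
  finally show ?thesis .
qed

lemma trace_eq_move:
  assumes "\<And>b. b \<in> set x \<Longrightarrow> {a, b} \<in> E" shows "trace_eq (x @ [a]) (a # x)"
  unfolding trace_eq_def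
proof (intro allI impI)
  fix c d assume cd: "{c, d} \<notin> E"
  let ?P = "\<lambda>e. e = c \<or> e = d"
  show "filter ?P (x @ [a]) = filter ?P (a # x)"
  proof (cases "a = c \<or> a = d")
    case True
    have "\<not> ?P b" if b: "b \<in> set x" for b
    proof
      assume "?P b"
      then have "{a, b} = {c, d}" using True no_loop[OF assms[OF b]] by auto
      then show False using cd assms[OF b] by simp
    qed
    then have "filter ?P x = []" by (simp add: filter_empty_conv)
    then show ?thesis by simp
  next
    case False
    then show ?thesis by simp
  qed
qed

text \<open>Words with equal projections are connected by commutations: the first letter \<open>a\<close> of one word
  occurs in the other, and the projections force it to commute with everything before its first
  occurrence there.\<close>

lemma trace_fun_trace_eq:
  assumes f: "trace_fun M k f" shows "trace_eq v w \<Longrightarrow> M dvd f (u @ v) - f (u @ w)"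
proof (induction v arbitrary: u w)
  case Nil
  then show ?case using trace_eq_length[of "[]" w] by simp
next
  case (Cons a v)
  have "a \<in> set w" using trace_eq_set[OF Cons.prems] by auto
  then obtain x y where w: "w = x @ a # y" and ax: "a \<notin> set x" by (meson split_list_first)
  have comm: "{a, b} \<in> E" if b: "b \<in> set x" for b
  proof (rule ccontr)
    assume "{a, b} \<notin> E"
    then have e: "filter (\<lambda>c. c = a \<or> c = b) (a # v) = filter (\<lambda>c. c = a \<or> c = b) (x @ a # y)"
      using trace_eqD[OF Cons.prems] w by blast
    have "filter (\<lambda>c. c = a \<or> c = b) x \<noteq> []" using b by (auto simp: filter_empty_conv)
    then obtain d r where d: "filter (\<lambda>c. c = a \<or> c = b) x = d # r" by (meson neq_Nil_conv)
    then have "d = a" using e by simp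
    moreover have "d \<in> set (filter (\<lambda>c. c = a \<or> c = b) x)" unfolding d by simp
    ultimately show False using ax by simp
  qed
  have move: "(\<forall>b\<in>set x'. {a, b} \<in> E) \<Longrightarrow> M dvd f (u' @ x' @ a # y) - f (u' @ a # x' @ y)" for x' u'
  proof (induction x' arbitrary: u')
    case (Cons b x')
    have 1: "M dvd f ((u' @ [b]) @ x' @ a # y) - f ((u' @ [b]) @ a # x' @ y)"
      using Cons.prems by (intro Cons.IH) simp
    have "{b, a} \<in> E" using Cons.prems by (simp add: insert_commute[of b a])
    then have 2: "M dvd f (u' @ [b, a] @ (x' @ y)) - f (u' @ [a, b] @ (x' @ y))"
      by (rule trace_fun_swap[OF f])
    show ?case using dvd_add[OF 1 2] by simp
  qed simp
  have "trace_eq w (a # x @ y)"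
    using trace_eq_append[OF trace_eq_move[of x a, OF comm] trace_eq_refl[of y]] w by simp
  then have "trace_eq (a # v) (a # x @ y)" using trace_eq_trans Cons.prems by blast
  then have "trace_eq v (x @ y)" using trace_eq_cancel_left[of "[a]" v "x @ y"] by simp
  then have 1: "M dvd f ((u @ [a]) @ v) - f ((u @ [a]) @ (x @ y))" by (rule Cons.IH)
  have 2: "M dvd f (u @ x @ a # y) - f (u @ a # x @ y)" by (rule move) (use comm in blast)
  show ?case using dvd_diff[OF 1 2] unfolding w by simp
qed

definition trace_ind :: "'a list \<Rightarrow> 'a list \<Rightarrow> int" where
  "trace_ind t w = (if trace_eq w t then 1 else 0)"

lemma trace_fun_trace_ind: "set t \<subseteq> V \<Longrightarrow> length t < k \<Longrightarrow> trace_fun M k (trace_ind t)"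
  unfolding trace_fun_def
proof (intro conjI allI impI)
  fix x a b y assume ab: "{a, b} \<in> E"
  have "trace_eq (x @ [a, b] @ y) (x @ [b, a] @ y)"
    by (intro trace_eq_append trace_eq_refl trace_eq_swap[OF ab])
  then have "trace_ind t (x @ [a, b] @ y) = trace_ind t (x @ [b, a] @ y)"
    unfolding trace_ind_def using trace_eq_trans trace_eq_sym by metis
  then show "M dvd trace_ind t (x @ [a, b] @ y) - trace_ind t (x @ [b, a] @ y)" by simp
next
  fix w assume "set t \<subseteq> V" "length t < k" "k \<le> length w \<or> \<not> set w \<subseteq> V"
  then show "M dvd trace_ind t w" using trace_eq_length[of w t] trace_eq_set[of w t] by (auto simp: trace_ind_def)
qed

definition central :: "'a set" where
  "central = {z \<in> V. \<forall>v\<in>V. v \<noteq> z \<longrightarrow> {z, v} \<in> E}"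

text \<open>Compare the coefficients of the trace \<open>t v\<close> in \<open>y v\<close> and \<open>v y\<close>.  The first is the coefficient of \<open>t\<close> in
  \<open>y\<close>; the second is zero, unless \<open>t v = v s\<close> for some \<open>s\<close>, and then it is the coefficient of \<open>s\<close>.
  In the latter case \<open>s\<close> arises from \<open>t\<close> by moving a leading \<open>v\<close> to the end.
  As \<open>t\<close> contains a letter \<open>c\<close> that does not commute with \<open>v\<close>, this can be repeated only finitely often.\<close>

lemma centralizer_coeff:
  assumes y: "\<And>v. v \<in> V \<Longrightarrow> y * var v - var v * y \<in> J p (Suc j)"
    and c: "c \<noteq> v" "{c, v} \<notin> E" "v \<in> V"
  shows "set t \<subseteq> V \<Longrightarrow> Suc (length t) \<le> j \<Longrightarrow> c \<in> set t \<Longrightarrow> p dvd pair y (trace_ind t)"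
proof (induction "length (takeWhile (\<lambda>d. d = v) (filter (\<lambda>d. d = c \<or> d = v) t))" arbitrary: t rule: less_induct)
  case less
  let ?P = "\<lambda>d. d = c \<or> d = v"
  have inv: "trace_fun p (Suc j) (trace_ind (t @ [v]))"
    by (rule trace_fun_trace_ind) (use less.prems c in auto)
  have eq: "p dvd pair y (trace_ind t) - pair y (\<lambda>w. trace_ind (t @ [v]) (v # w))"
    using J_D[OF y[OF c(3)] inv]
    by (simp add: pair_diff pair_mult pair_mult' var_def pair_mon trace_ind_def[abs_def] trace_eq_cancel_right)
  show ?case
  proof (cases "\<exists>s. trace_eq (v # s) (t @ [v])")
    case False
    then have "(\<lambda>w. trace_ind (t @ [v]) (v # w)) = (\<lambda>w. 0)" by (auto simp: trace_ind_def)
    then show ?thesis using eq by (simp add: pair_def)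
  next
    case True
    then obtain s where s: "trace_eq (v # s) (t @ [v])" by blast
    have "trace_ind (t @ [v]) (v # w) = trace_ind s w" for w
      using trace_eq_cancel_left[of "[v]" w s] s trace_eq_trans trace_eq_sym unfolding trace_ind_def by (metis append_Cons append_Nil)
    then have eq': "p dvd pair y (trace_ind t) - pair y (trace_ind s)" using eq by simp
    have f: "v # filter ?P s = filter ?P t @ [v]" using trace_eqD[OF s c(2)] by simp
    have ct: "c \<in> set (filter ?P t)" using less.prems by simp
    then obtain r where r: "filter ?P t = v # r" using f by (cases "filter ?P t") auto
    have cr: "c \<in> set r" using ct r c(1) by auto
    have "filter ?P s = r @ [v]" using f r by simp
    then have "length (takeWhile (\<lambda>d. d = v) (filter ?P s)) < length (takeWhile (\<lambda>d. d = v) (filter ?P t))"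
      using cr c(1) r by (simp add: takeWhile_append1)
    moreover have "set s \<subseteq> V" "Suc (length s) \<le> j"
      using trace_eq_set[OF s] trace_eq_length[OF s] less.prems c by auto
    moreover have "c \<in> set s" using \<open>filter ?P s = r @ [v]\<close> cr by (metis Un_iff filter_is_subset set_append subsetD)
    ultimately have "p dvd pair y (trace_ind s)" using less.hyps by blast
    then show ?thesis using eq' by (metis dvd_add_left_iff diff_add_cancel)
  qed
qed

text \<open>Replacing every word by a representative of its class does not change an element modulo \<open>J\<close>, and
  afterwards its coefficients are the coefficients of traces.\<close>

lemma J_divisible:
  assumes x: "\<And>t. set t \<subseteq> V \<Longrightarrow> length t < k \<Longrightarrow> p dvd pair x (trace_ind t)"
  obtains x' where "\<And>M. x - of_int p * x' \<in> J M k"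
proof -
  \<comment> \<open>a representative of each class\<close>
  define c where "c w = (SOME w'. trace_eq w' w)" for w
  have c: "trace_eq (c w) w" for w unfolding c_def by (rule someI[of _ w]) (rule trace_eq_refl)
  have c_eq: "trace_eq w w' \<Longrightarrow> c w = c w'" for w w'
    unfolding c_def using trace_eq_trans trace_eq_sym by metis
  let ?ok = "\<lambda>w. set w \<subseteq> V \<and> length w < k"
  define xc where "xc = lin_ext (\<lambda>w. if ?ok w then mon (c w) else 0) x"
  have "p dvd Poly_Mapping.lookup xc (Word t)" for t
  proof -
    have eq: "Poly_Mapping.lookup xc (Word t) = pair x (\<lambda>w. if ?ok w \<and> c w = t then 1 else 0)"
      unfolding lookup_eq_pair xc_def pair_lin_ext by (auto simp: pair_mon pair_0 intro!: arg_cong[where f = "pair x"])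
    show ?thesis
    proof (cases "\<exists>w0. ?ok w0 \<and> c w0 = t")
      case False
      then have "(\<lambda>w. if ?ok w \<and> c w = t then 1 else 0) = (\<lambda>w. 0 :: int)" by auto
      then show ?thesis unfolding eq by (simp add: pair_def)
    next
      case True
      then obtain w0 where w0: "?ok w0" "c w0 = t" by blast
      have "(?ok w \<and> c w = t) = trace_eq w w0" for w
        using w0 c_eq[of w w0] c[of w] c[of w0] trace_eq_set[of w w0] trace_eq_length[of w w0] trace_eq_trans trace_eq_sym by metis
      then have "(\<lambda>w. if ?ok w \<and> c w = t then 1 else 0) = trace_ind w0" by (auto simp: trace_ind_def)
      then show ?thesis unfolding eq using x w0 by simp
    qed
  qed
  then obtain x' where x': "xc = of_int p * x'" using free_alg_divisible by blast
  have xxc: "x - xc \<in> J M k" for M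
  proof (rule J_I)
    fix f assume f: "trace_fun M k f"
    have "M dvd f w - pair (if ?ok w then mon (c w) else 0) f" for w
      using trace_fun_trace_eq[OF f trace_eq_sym[OF c[of w]], of "[]"] trace_fun_zero[OF f, of w]
      by (auto simp: pair_mon pair_0)
    then show "M dvd pair (x - xc) f"
      unfolding pair_diff xc_def pair_lin_ext by (rule pair_dvd_diff)
  qed
  show ?thesis by (rule that[of x']) (use xxc x' in simp)
qed

text \<open>What commutes with all generators modulo \<open>p\<close> is, modulo \<open>p\<close>, a polynomial \<open>z\<close> in the central letters; such a \<open>z\<close>
  commutes with all generators for every modulus.  One degree is lost, because the hypothesis
  sees \<open>y\<close> only through products with a letter.\<close>

lemma centralizer_mod:
  assumes y: "\<And>v. v \<in> V \<Longrightarrow> y * var v - var v * y \<in> J p (Suc j)"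
  obtains z y' where "\<And>M. y - (z + of_int p * y') \<in> J M j"
    "\<And>v M k. v \<in> V \<Longrightarrow> z * var v - var v * z \<in> J M k"
proof -
  define z where "z = lin_ext (\<lambda>w. if set w \<subseteq> central then mon w else 0) y"
  have pz: "pair z f = pair y (\<lambda>w. if set w \<subseteq> central then f w else 0)" for f
    unfolding z_def pair_lin_ext by (auto simp: pair_mon pair_0 intro!: arg_cong[where f = "pair y"])
  have zc: "z * var v - var v * z \<in> J M k" if v: "v \<in> V" for v M k
  proof (rule J_I)
    fix f assume f: "trace_fun M k f"
    have h: "M dvd f (w @ [v]) - f (v # w)" if True: "set w \<subseteq> central" for w
    proof -
      have "trace_eq (w @ [v]) (v # w)" unfolding trace_eq_def
      proof (intro allI impI)
        fix a b assume ab: "{a, b} \<notin> E"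
        show "filter (\<lambda>c. c = a \<or> c = b) (w @ [v]) = filter (\<lambda>c. c = a \<or> c = b) (v # w)"
        proof (cases "v = a \<or> v = b")
          case True
          have "d = v" if d: "d \<in> set w" "d = a \<or> d = b" for d
          proof (rule ccontr)
            assume "d \<noteq> v"
            have "d \<in> central" using \<open>set w \<subseteq> central\<close> d(1) by blast
            then have "{d, v} \<in> E" using \<open>d \<noteq> v\<close> v unfolding central_def by auto
            moreover have "{d, v} = {a, b}" using d(2) True \<open>d \<noteq> v\<close> by auto
            ultimately show False using ab by simp
          qed
          then have "\<forall>d\<in>set (filter (\<lambda>c. c = a \<or> c = b) w). d = v" by simp
          then have "filter (\<lambda>c. c = a \<or> c = b) w = replicate (length (filter (\<lambda>c. c = a \<or> c = b) w)) v"
            by (simp add: replicate_length_same)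
          then show ?thesis using True by simp (metis replicate_append_same)
        qed simp
      qed
      then show ?thesis using trace_fun_trace_eq[OF f, of "w @ [v]" "v # w" "[]"] by simp
    qed
    show "M dvd pair (z * var v - var v * z) f"
      unfolding pair_diff pair_mult[of z] pair_mult'[of _ z] pz
      by (intro pair_dvd_diff) (auto simp: var_def pair_mon intro: h)
  qed
  have "p dvd pair (y - z) (trace_ind t)" if t: "set t \<subseteq> V" "length t < j" for t
  proof (cases "set t \<subseteq> central")
    case True
    have "(if set w \<subseteq> central then trace_ind t w else 0) = trace_ind t w" for w
      using True trace_eq_set[of w t] by (auto simp: trace_ind_def)
    then show ?thesis unfolding pair_diff pz by simp
  next
    case False
    then obtain c where c: "c \<in> set t" "c \<notin> central" by blast
    then obtain v where v: "v \<in> V" "v \<noteq> c" "{c, v} \<notin> E" using t unfolding central_def by blast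
    have "(if set w \<subseteq> central then trace_ind t w else 0) = 0" for w
      using False trace_eq_set[of w t] by (auto simp: trace_ind_def)
    then have "pair z (trace_ind t) = 0" unfolding pz by (simp add: pair_def)
    moreover have "p dvd pair y (trace_ind t)"
      using centralizer_coeff[OF y, where c = c and v = v and t = t] v c t by auto
    ultimately show ?thesis by (simp add: pair_diff)
  qed
  then obtain y' where y': "\<And>M. (y - z) - of_int p * y' \<in> J M j" using J_divisible[of j p "y - z"] by blast
  show ?thesis using that[of z y'] y' zc by (simp add: diff_diff_eq)
qed

section \<open>Conjugation by units\<close>

lemma J_scale: "x \<in> J M k \<Longrightarrow> of_int c * x \<in> J (c * M) k"
proof (rule J_I)
  fix f assume x: "x \<in> J M k" and f: "trace_fun (c * M) k f"
  have "trace_fun M k f" using f unfolding trace_fun_def by (meson dvd_mult_right)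
  then show "c * M dvd pair (of_int c * x) f" using J_D[OF x] by (simp add: pair_of_int)
qed

lemma endo_of_int: assumes "ring_endo \<Phi>" shows "\<Phi> (of_int c) = of_int c"
proof -
  note re = endo_simps[OF assms]
  have "\<Phi> (of_nat n) = of_nat n" for n by (induction n) (auto simp: re)
  then show ?thesis by (cases c rule: int_cases2) (auto simp: re)
qed

text \<open>Multiplication by \<open>c\<close> embeds the algebra modulo \<open>M\<close> into the algebra modulo \<open>c M\<close>.\<close>

lemma J_endo_mono:
  assumes \<Phi>: "J_endo (c * M) k \<Phi>" and c: "c \<noteq> 0" and k: "k' \<le> k"
  shows "J_endo M k' \<Phi>"
proof -
  note re = endo_simps[OF J_endoD(1)[OF \<Phi>]] endo_of_int[OF J_endoD(1)[OF \<Phi>]]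
  have "\<Phi> x \<in> J M j" if "j \<le> k'" "x \<in> J M j" for x j
  proof -
    have "\<Phi> (of_int c * x) \<in> J (c * M) j"
      by (rule J_endoD(2)[OF \<Phi> _ J_scale[OF that(2)]]) (use that k in simp)
    then show ?thesis using J_scale_cancel[of c "\<Phi> x" M j] c by (simp add: re)
  qed
  then show ?thesis using J_endoD(1)[OF \<Phi>] by (simp add: J_endo_def)
qed

lemma J_endo_comp: "J_endo M k \<Phi> \<Longrightarrow> J_endo M k \<Psi> \<Longrightarrow> J_endo M k (\<lambda>x. \<Phi> (\<Psi> x))"
  unfolding J_endo_def ring_endo_def by auto

lemma J_endo_id: "J_endo M k (\<lambda>x. x)"
  unfolding J_endo_def ring_endo_def by auto

lemma unit_cancel_right: assumes "y - 1 \<in> J M 1" "x * y \<in> J M k" shows "x \<in> J M k"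
proof -
  have "x * (y * trunc_inv k y - 1) \<in> J M k" by (rule J_mult_left[OF trunc_inv(1)[OF assms(1)]])
  moreover have "(x * y) * trunc_inv k y \<in> J M k" by (rule J_mult_right[OF assms(2)])
  ultimately have "(x * y) * trunc_inv k y - x * (y * trunc_inv k y - 1) \<in> J M k" by (rule J_diff[rotated])
  then show ?thesis by (simp add: algebra_simps)
qed

lemma conj_generators:
  assumes \<Phi>: "ring_endo \<Phi>" and g: "\<And>a. \<Phi> (var a) * u - u * var a \<in> J M k"
  shows "\<Phi> x * u - u * x \<in> J M k"
proof (induction x rule: free_alg_induct)
  case (mon w)
  show ?case
  proof (induction w)
    case Nil then show ?case by (simp add: mon_Nil endo_simps[OF \<Phi>])
  next
    case (Cons a w)
    have "\<Phi> (var a) * (\<Phi> (mon w) * u - u * mon w) + (\<Phi> (var a) * u - u * var a) * mon w \<in> J M k"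
      by (rule J_add[OF J_mult_left[OF Cons] J_mult_right[OF g]])
    moreover have "\<Phi> (mon (a # w)) * u - u * mon (a # w)
      = \<Phi> (var a) * (\<Phi> (mon w) * u - u * mon w) + (\<Phi> (var a) * u - u * var a) * mon w"
      by (simp add: mon_Cons endo_simps[OF \<Phi>] right_diff_distrib left_diff_distrib mult.assoc)
    ultimately show ?case by simp
  qed
next
  case (diff x y)
  have "\<Phi> (x - y) * u - u * (x - y) = (\<Phi> x * u - u * x) - (\<Phi> y * u - u * y)"
    by (simp add: endo_simps[OF \<Phi>] right_diff_distrib left_diff_distrib)
  then show ?case using J_diff[OF diff] by simp
qed

text \<open>Conjugating an endomorphism by a unit is multiplicative only modulo \<open>J\<close>; substituting the
  conjugated images of the letters gives a genuine ring endomorphism.\<close>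

lemma conj_endo:
  assumes \<Phi>: "J_endo M k \<Phi>" and k: "k \<ge> 1" and u: "u - 1 \<in> J M 1"
  obtains \<Delta> where "J_endo M k \<Delta>" "\<And>x. \<Delta> x - trunc_inv k u * \<Phi> x * u \<in> J M k"
proof -
  note re = endo_simps[OF J_endoD(1)[OF \<Phi>]]
  let ?c = "\<lambda>x. trunc_inv k u * \<Phi> x * u"
  define X where "X a = (if a \<in> V then ?c (var a) else 0)" for a
  have cm: "?c x * ?c y - ?c (x * y) \<in> J M k" for x y
  proof -
    have "(trunc_inv k u * \<Phi> x) * (u * trunc_inv k u - 1) * (\<Phi> y * u) \<in> J M k"
      by (rule J_mult_right[OF J_mult_left[OF trunc_inv(1)[OF u]]])
    then show ?thesis by (simp add: re algebra_simps)
  qed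
  have X: "X a - ?c (var a) \<in> J M k" for a
  proof (cases "a \<in> V")
    case False
    have "?c (var a) \<in> J M k"
      by (rule J_mult_right[OF J_mult_left[OF J_endoD(2)[OF \<Phi> order_refl var_notin[OF False]]]])
    then show ?thesis using False J_minus by (simp add: X_def)
  qed (simp add: X_def)
  have "J_endo M k (subst X)"
  proof (rule J_endo_subst)
    show "X a \<in> J M 1" for a
      using J_mult_right[OF J_mult_left[OF J_endoD(2)[OF \<Phi> k var_in_J1]]] by (simp add: X_def)
    show "X a \<in> J M k" if "a \<notin> V" for a using that by (simp add: X_def)
    fix a b assume ab: "{a, b} \<in> E"
    have 1: "X a * X b - ?c (var a * var b) \<in> J M k" for a b
      using J_trans[OF J_mult_cong[OF X X] cm] .
    have "?c (var a * var b) - ?c (var b * var a) = trunc_inv k u * \<Phi> (var a * var b - var b * var a) * u"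
      by (simp add: re algebra_simps)
    also have "\<dots> \<in> J M k"
      by (rule J_mult_right[OF J_mult_left[OF J_endoD(2)[OF \<Phi> order_refl var_comm[OF ab]]]])
    finally show "X a * X b - X b * X a \<in> J M k"
      using J_trans[OF J_trans[OF 1 _] J_sym[OF 1]] by blast
  qed
  moreover have "subst X x - ?c x \<in> J M k" for x
  proof (induction x rule: free_alg_induct)
    case (mon w)
    show ?case
    proof (induction w)
      case Nil
      show ?case using J_sym[OF trunc_inv(2)[OF u, of k]]
        by (simp add: mon_Nil re endo_simps[OF ring_endo_subst])
    next
      case (Cons a w)
      have "subst X (var a) * subst X (mon w) - ?c (var a) * ?c (mon w) \<in> J M k"
        unfolding subst_var by (rule J_mult_cong[OF X Cons])
      from J_trans[OF this cm] show ?case by (simp only: mon_Cons endo_simps[OF ring_endo_subst])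
    qed
  next
    case (diff x y)
    have "subst X (x - y) - ?c (x - y) = (subst X x - ?c x) - (subst X y - ?c y)"
      by (simp add: re endo_simps[OF ring_endo_subst] right_diff_distrib left_diff_distrib)
    then show ?case using J_diff[OF diff] by simp
  qed
  ultimately show ?thesis using that by blast
qed

end

section \<open>Automorphisms acting on the Magnus algebra\<close>

text \<open>A group with a Magnus representation: \<open>m n k g\<close> represents the image of \<open>g\<close> in the algebra with
  coefficients \<open>\<int>/p\<^sup>n\<close>, truncated at degree \<open>k\<close>.\<close>

locale magnus_group = commutation_graph V E + group G
  for V :: "'a set" and E :: "'a set set" and G :: "('g, 'm) monoid_scheme" (structure) +
  fixes p :: nat and m :: "nat \<Rightarrow> nat \<Rightarrow> 'g \<Rightarrow> 'a free_alg" and s :: "'a \<Rightarrow> 'g"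
  assumes p: "prime p"
    and s_closed: "a \<in> V \<Longrightarrow> s a \<in> carrier G"
    and s_comm: "{a, b} \<in> E \<Longrightarrow> s a \<otimes> s b = s b \<otimes> s a"
    and m_mult: "g \<in> carrier G \<Longrightarrow> h \<in> carrier G \<Longrightarrow>
        m n k (g \<otimes> h) - m n k g * m n k h \<in> J (int p ^ n) k"
    and m_unip: "g \<in> carrier G \<Longrightarrow> k \<ge> 1 \<Longrightarrow> m n k g - 1 \<in> J (int p ^ n) 1"
    and m_s: "a \<in> V \<Longrightarrow> m n k (s a) - (1 + var a) \<in> J (int p ^ n) k"
    and m_mono: "g \<in> carrier G \<Longrightarrow> n' \<le> n \<Longrightarrow> k' \<le> k \<Longrightarrow>
        m n k g - m n' k' g \<in> J (int p ^ n') k'"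
begin

abbreviation Jp :: "nat \<Rightarrow> nat \<Rightarrow> 'a free_alg set" where "Jp n k \<equiv> J (int p ^ n) k"

lemma Jp_mono: "x \<in> Jp n k \<Longrightarrow> n' \<le> n \<Longrightarrow> k' \<le> k \<Longrightarrow> x \<in> Jp n' k'"
  by (erule J_mono) (auto intro: le_imp_power_dvd)

lemma m_one: assumes "k \<ge> 1" shows "m n k \<one> - 1 \<in> Jp n k"
proof -
  have "(m n k \<one> - 1) * m n k \<one> \<in> Jp n k"
    using J_sym[OF m_mult[of \<one> \<one>]] by (simp add: left_diff_distrib)
  then show ?thesis by (rule unit_cancel_right[OF m_unip[OF one_closed assms]])
qed

lemma m_inv: assumes "k \<ge> 1" "g \<in> carrier G" shows "m n k (inv g) * m n k g - 1 \<in> Jp n k"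
proof -
  have "m n k (inv g) * m n k g - m n k (inv g \<otimes> g) \<in> Jp n k"
    by (rule J_sym[OF m_mult]) (use assms in auto)
  moreover have "inv g \<otimes> g = \<one>" using assms by simp
  ultimately show ?thesis using J_trans[OF _ m_one[OF assms(1)]] by metis
qed

text \<open>What continuity means at a finite level: for the representation, \<open>\<phi>\<close> is determined by its
  restriction to the abstract subgroup generated by the \<open>s a\<close>.\<close>

definition approximable :: "('g \<Rightarrow> 'g) \<Rightarrow> bool" where
  "approximable \<phi> \<longleftrightarrow> \<phi> \<in> hom G G \<and>
    (\<forall>n k. \<forall>g\<in>carrier G. \<exists>h\<in>generate G (s ` V). m n k g = m n k h \<and> m n k (\<phi> g) = m n k (\<phi> h))"

lemma approximable_hom: "approximable \<phi> \<Longrightarrow> \<phi> \<in> hom G G" by (simp add: approximable_def)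
lemma approximable_closed: "approximable \<phi> \<Longrightarrow> g \<in> carrier G \<Longrightarrow> \<phi> g \<in> carrier G" by (auto simp: approximable_def hom_def)
lemma approximable_mult: "approximable \<phi> \<Longrightarrow> g \<in> carrier G \<Longrightarrow> h \<in> carrier G \<Longrightarrow> \<phi> (g \<otimes> h) = \<phi> g \<otimes> \<phi> h"
  by (auto simp: approximable_def hom_def)

text \<open>\<open>\<Phi>\<close> lifts to the free ring the action of \<open>\<phi>\<close> on the truncated algebra.\<close>

definition induces :: "nat \<Rightarrow> nat \<Rightarrow> ('g \<Rightarrow> 'g) \<Rightarrow> ('a free_alg \<Rightarrow> 'a free_alg) \<Rightarrow> bool" where
  "induces n k \<phi> \<Phi> \<longleftrightarrow> J_endo (int p ^ n) k \<Phi> \<and> (\<forall>g\<in>carrier G. \<Phi> (m n k g) - m n k (\<phi> g) \<in> Jp n k)"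

lemma inducesD: "induces n k \<phi> \<Phi> \<Longrightarrow> J_endo (int p ^ n) k \<Phi>"
  "induces n k \<phi> \<Phi> \<Longrightarrow> g \<in> carrier G \<Longrightarrow> \<Phi> (m n k g) - m n k (\<phi> g) \<in> Jp n k"
  by (auto simp: induces_def)

text \<open>The substitution \<open>a \<mapsto> m (\<phi> (s a)) - 1\<close> is compatible with the relations, as \<open>\<phi>\<close> is a homomorphism.\<close>

lemma induces_exists:
  assumes \<phi>: "approximable \<phi>" and k: "k \<ge> 1"
  shows "\<exists>\<Phi>. induces n k \<phi> \<Phi>"
proof -
  define X where "X a = (if a \<in> V then m n k (\<phi> (s a)) - 1 else 0)" for a
  have XV: "a \<in> V \<Longrightarrow> X a = m n k (\<phi> (s a)) - 1" for a by (simp add: X_def)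
  have \<phi>s: "a \<in> V \<Longrightarrow> \<phi> (s a) \<in> carrier G" for a using approximable_closed[OF \<phi> s_closed] .
  have endo: "J_endo (int p ^ n) k (subst X)"
  proof (rule J_endo_subst)
    show "X a \<in> Jp n 1" for a using m_unip[OF \<phi>s k] by (simp add: X_def)
    show "X a \<in> Jp n k" if "a \<notin> V" for a using that by (simp add: X_def)
    fix a b assume ab: "{a, b} \<in> E"
    then have V: "a \<in> V" "b \<in> V" using E2[OF ab] by auto
    have "\<phi> (s a) \<otimes> \<phi> (s b) = \<phi> (s b) \<otimes> \<phi> (s a)"
      using approximable_mult[OF \<phi>] s_comm[OF ab] s_closed V by metis
    then have "m n k (\<phi> (s a)) * m n k (\<phi> (s b)) - m n k (\<phi> (s b)) * m n k (\<phi> (s a)) \<in> Jp n k"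
      using J_trans[OF J_sym[OF m_mult[OF \<phi>s[OF V(1)] \<phi>s[OF V(2)]]]] m_mult[OF \<phi>s[OF V(2)] \<phi>s[OF V(1)]] by metis
    then show "X a * X b - X b * X a \<in> Jp n k"
      using V by (simp add: X_def algebra_simps)
  qed
  note re = endo_simps[OF J_endoD(1)[OF endo]]
  have gen: "subst X (m n k h) - m n k (\<phi> h) \<in> Jp n k" if "h \<in> generate G (s ` V)" for h
    using that
  proof (induction h rule: generate.induct)
    case one
    have "subst X (m n k \<one>) - subst X 1 \<in> Jp n k"
      by (rule J_endo_cong[OF endo order_refl m_one[OF k]])
    moreover have "\<phi> \<one> = \<one>" using hom_one[OF approximable_hom[OF \<phi>] is_group is_group] .
    ultimately show ?case using J_trans[OF _ J_sym[OF m_one[OF k]]] by (simp add: re)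
  next
    case (incl h)
    then obtain a where a: "a \<in> V" "h = s a" by blast
    have "subst X (m n k h) - subst X (1 + var a) \<in> Jp n k"
      unfolding a(2) by (rule J_endo_cong[OF endo order_refl m_s[OF a(1)]])
    then show ?case using a by (simp add: re subst_var XV)
  next
    case (inv h)
    then obtain a where a: "a \<in> V" "h = s a" by blast
    then have h: "h \<in> carrier G" using s_closed by blast
    have sh: "subst X (m n k h) - m n k (\<phi> h) \<in> Jp n k"
    proof -
      have "subst X (m n k h) - subst X (1 + var a) \<in> Jp n k"
        unfolding a(2) by (rule J_endo_cong[OF endo order_refl m_s[OF a(1)]])
      then show ?thesis using a by (simp add: re subst_var XV)
    qed
    have "subst X (m n k (inv h)) * m n k (\<phi> h) - subst X (m n k (inv h)) * subst X (m n k h) \<in> Jp n k"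
      by (intro J_mult_cong J_refl J_sym[OF sh])
    also have "subst X (m n k (inv h)) * subst X (m n k h) - 1 \<in> Jp n k"
      using J_endo_cong[OF endo order_refl m_inv[OF k h]] by (simp add: re)
    finally (J_trans) have 1: "subst X (m n k (inv h)) * m n k (\<phi> h) - 1 \<in> Jp n k" .
    have "\<phi> (inv h) = inv (\<phi> h)"
      using group_hom.hom_inv[of G G \<phi> h] approximable_hom[OF \<phi>] h is_group
      by (simp add: group_hom_def group_hom_axioms_def)
    then have 2: "m n k (\<phi> (inv h)) * m n k (\<phi> h) - 1 \<in> Jp n k"
      using m_inv[OF k approximable_closed[OF \<phi> h]] by simp
    have "(subst X (m n k (inv h)) - m n k (\<phi> (inv h))) * m n k (\<phi> h) \<in> Jp n k"
      using J_diff[OF 1 2] by (simp add: left_diff_distrib)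
    then show ?case by (rule unit_cancel_right[OF m_unip[OF approximable_closed[OF \<phi> h] k]])
  next
    case (eng h1 h2)
    have sV: "s ` V \<subseteq> carrier G" using s_closed by blast
    have h: "h1 \<in> carrier G" "h2 \<in> carrier G" using eng(1,2) generate_in_carrier[OF sV] by auto
    have "subst X (m n k (h1 \<otimes> h2)) - subst X (m n k h1 * m n k h2) \<in> Jp n k"
      by (rule J_endo_cong[OF endo order_refl m_mult[OF h]])
    moreover have "subst X (m n k h1) * subst X (m n k h2) - m n k (\<phi> h1) * m n k (\<phi> h2) \<in> Jp n k"
      by (rule J_mult_cong[OF eng.IH])
    moreover have "m n k (\<phi> h1) * m n k (\<phi> h2) - m n k (\<phi> (h1 \<otimes> h2)) \<in> Jp n k"
      using J_sym[OF m_mult[OF approximable_closed[OF \<phi> h(1)] approximable_closed[OF \<phi> h(2)]]]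
      by (simp add: approximable_mult[OF \<phi> h])
    ultimately show ?case unfolding re(2) by (blast intro: J_trans)
  qed
  have "induces n k \<phi> (subst X)" unfolding induces_def
  proof (intro conjI endo ballI)
    fix g assume "g \<in> carrier G"
    then obtain h where "h \<in> generate G (s ` V)" "m n k g = m n k h" "m n k (\<phi> g) = m n k (\<phi> h)"
      using \<phi> unfolding approximable_def by blast
    then show "subst X (m n k g) - m n k (\<phi> g) \<in> Jp n k" using gen by simp
  qed
  then show ?thesis by blast
qed

lemma induces_var:
  assumes \<Phi>: "induces n k \<phi> \<Phi>" and a: "a \<in> V"
  shows "\<Phi> (var a) - (m n k (\<phi> (s a)) - 1) \<in> Jp n k"
proof -
  note re = endo_simps[OF J_endoD(1)[OF inducesD(1)[OF \<Phi>]]]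
  have "\<Phi> (1 + var a) - \<Phi> (m n k (s a)) \<in> Jp n k"
    by (rule J_endo_cong[OF inducesD(1)[OF \<Phi>] order_refl J_sym[OF m_s[OF a]]])
  from J_trans[OF this inducesD(2)[OF \<Phi> s_closed[OF a]]] show ?thesis by (simp add: re algebra_simps)
qed

lemma induces_unique:
  assumes \<Phi>: "induces n k \<phi> \<Phi>" and \<Psi>: "induces n k \<psi> \<Psi>" and eq: "\<And>g. g \<in> carrier G \<Longrightarrow> \<phi> g = \<psi> g"
  shows "\<Phi> x - \<Psi> x \<in> Jp n k"
proof (rule endo_cong_generators[OF J_endoD(1)[OF inducesD(1)[OF \<Phi>]] J_endoD(1)[OF inducesD(1)[OF \<Psi>]]])
  fix a
  show "\<Phi> (var a) - \<Psi> (var a) \<in> Jp n k"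
  proof (cases "a \<in> V")
    case True
    show ?thesis
      using J_trans[OF induces_var[OF \<Phi> True] J_sym[OF induces_var[OF \<Psi> True, folded eq[OF s_closed[OF True]]]]] .
  next
    case False
    show ?thesis
      by (rule J_diff[OF J_endoD(2)[OF inducesD(1)[OF \<Phi>] order_refl var_notin[OF False]]
            J_endoD(2)[OF inducesD(1)[OF \<Psi>] order_refl var_notin[OF False]]])
  qed
qed

lemma induces_comp:
  assumes \<Phi>: "induces n k \<phi> \<Phi>" and \<Psi>: "induces n k \<psi> \<Psi>" and c: "\<And>g. g \<in> carrier G \<Longrightarrow> \<psi> g \<in> carrier G"
  shows "induces n k (\<lambda>g. \<phi> (\<psi> g)) (\<lambda>x. \<Phi> (\<Psi> x))"
  unfolding induces_def
proof (rule conjI[OF J_endo_comp[OF inducesD(1)[OF \<Phi>] inducesD(1)[OF \<Psi>]]], rule ballI)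
  fix g assume g: "g \<in> carrier G"
  show "\<Phi> (\<Psi> (m n k g)) - m n k (\<phi> (\<psi> g)) \<in> Jp n k"
    using J_trans[OF J_endo_cong[OF inducesD(1)[OF \<Phi>] order_refl inducesD(2)[OF \<Psi> g]] inducesD(2)[OF \<Phi> c[OF g]]] .
qed

lemma induces_id: "induces n k (\<lambda>g. g) (\<lambda>x. x)"
  unfolding induces_def by (simp add: J_endo_id)

lemma induces_cong: "induces n k \<phi> \<Phi> \<Longrightarrow> (\<And>g. g \<in> carrier G \<Longrightarrow> \<phi> g = \<psi> g) \<Longrightarrow> induces n k \<psi> \<Phi>"
  unfolding induces_def by simp

lemma induces_mono:
  assumes \<Phi>: "induces n k \<phi> \<Phi>" and n: "n' \<le> n" "k' \<le> k" and \<phi>: "\<And>g. g \<in> carrier G \<Longrightarrow> \<phi> g \<in> carrier G"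
  shows "induces n' k' \<phi> \<Phi>"
proof -
  have "int p ^ n = int p ^ (n - n') * int p ^ n'" using n by (simp flip: power_add)
  then have "J_endo (int p ^ (n - n') * int p ^ n') k \<Phi>" using inducesD(1)[OF \<Phi>] by simp
  moreover have "int p ^ (n - n') \<noteq> 0" using p by (simp add: prime_gt_0_nat)
  ultimately have e: "J_endo (int p ^ n') k' \<Phi>" using J_endo_mono n(2) by blast
  show ?thesis unfolding induces_def
  proof (intro conjI ballI e)
    fix g assume g: "g \<in> carrier G"
    have "\<Phi> (m n' k' g) - \<Phi> (m n k g) \<in> Jp n' k'"
      by (rule J_endo_cong[OF e order_refl J_sym[OF m_mono[OF g n]]])
    moreover have "\<Phi> (m n k g) - m n k (\<phi> g) \<in> Jp n' k'" using Jp_mono[OF inducesD(2)[OF \<Phi> g] n] .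
    moreover have "m n k (\<phi> g) - m n' k' (\<phi> g) \<in> Jp n' k'" using m_mono[OF \<phi>[OF g] n] .
    ultimately show "\<Phi> (m n' k' g) - m n' k' (\<phi> g) \<in> Jp n' k'" by (blast intro: J_trans)
  qed
qed

text \<open>The trace left in the algebra by acting trivially on the abelianization.\<close>

definition IA_like :: "('g \<Rightarrow> 'g) \<Rightarrow> bool" where
  "IA_like \<phi> \<longleftrightarrow> approximable \<phi> \<and> (\<forall>n k. \<forall>a\<in>V. k \<ge> 2 \<longrightarrow> m n k (\<phi> (s a)) - m n k (s a) \<in> Jp n 2)"

lemma IA_like_induces:
  assumes \<phi>: "IA_like \<phi>" and \<Phi>: "induces n k \<phi> \<Phi>" and k: "k \<ge> 2"
  shows "\<Phi> (var a) - var a \<in> Jp n 2"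
proof (cases "a \<in> V")
  case True
  have "\<Phi> (var a) - (m n k (\<phi> (s a)) - 1) \<in> Jp n 2"
    using Jp_mono[OF induces_var[OF \<Phi> True] order_refl k] .
  moreover have "(m n k (\<phi> (s a)) - 1) - (m n k (s a) - 1) \<in> Jp n 2"
    using \<phi> True k unfolding IA_like_def by simp
  moreover have "(m n k (s a) - 1) - var a \<in> Jp n 2"
    using Jp_mono[OF m_s[OF True] order_refl k] by (simp add: diff_diff_eq)
  ultimately show ?thesis by (blast intro: J_trans)
next
  case False
  have "\<Phi> (var a) \<in> Jp n 2"
    by (rule J_endoD(2)[OF inducesD(1)[OF \<Phi>] k var_notin[OF False]])
  then show ?thesis by (rule J_diff[OF _ var_notin[OF False]])
qed

text \<open>Membership in \<open>N\<^sub>j\<close>: conjugation by a unit modulo degree \<open>j\<close>, for each coefficient ring \<open>\<int>/p\<^sup>n\<close>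
  separately.\<close>

definition inner_mod :: "nat \<Rightarrow> ('g \<Rightarrow> 'g) \<Rightarrow> bool" where
  "inner_mod j \<phi> \<longleftrightarrow> (\<forall>n. \<exists>\<Phi> u. induces n j \<phi> \<Phi> \<and> u - 1 \<in> Jp n 1 \<and> (\<forall>x. \<Phi> x * u - u * x \<in> Jp n j))"

lemma inner_mod_cong: "inner_mod j \<phi> \<Longrightarrow> (\<And>g. g \<in> carrier G \<Longrightarrow> \<phi> g = \<psi> g) \<Longrightarrow> inner_mod j \<psi>"
  unfolding inner_mod_def using induces_cong by meson

text \<open>Induced endomorphisms are unique modulo \<open>J\<close>, so the unit serves for one that is induced at a
  deeper level as well.\<close>

lemma inner_mod_witness:
  assumes \<phi>: "inner_mod j \<phi>" and \<Phi>: "induces n k \<phi> \<Phi>" and k: "j \<le> k"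
    and c: "\<And>g. g \<in> carrier G \<Longrightarrow> \<phi> g \<in> carrier G"
  obtains u where "u - 1 \<in> Jp n 1" "\<And>x. \<Phi> x * u - u * x \<in> Jp n j"
proof -
  obtain \<Psi> u where u: "induces n j \<phi> \<Psi>" "u - 1 \<in> Jp n 1" "\<And>x. \<Psi> x * u - u * x \<in> Jp n j"
    using \<phi> unfolding inner_mod_def by blast
  have "\<Phi> x * u - \<Psi> x * u \<in> Jp n j" for x
    using J_mult_right[OF induces_unique[OF induces_mono[OF \<Phi> order_refl k c] u(1) HOL.refl]] by (simp add: left_diff_distrib)
  then show ?thesis using that[OF u(2)] J_trans u(3) by blast
qed

lemma inner_mod_mono:
  assumes \<phi>: "inner_mod k \<phi>" and k: "j \<le> k" and c: "\<And>g. g \<in> carrier G \<Longrightarrow> \<phi> g \<in> carrier G"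
  shows "inner_mod j \<phi>"
  unfolding inner_mod_def
proof
  fix n
  obtain \<Phi> u where a: "induces n k \<phi> \<Phi>" and u: "u - 1 \<in> Jp n 1" and x: "\<And>x. \<Phi> x * u - u * x \<in> Jp n k"
    using \<phi> unfolding inner_mod_def by blast
  show "\<exists>\<Phi> u. induces n j \<phi> \<Phi> \<and> u - 1 \<in> Jp n 1 \<and> (\<forall>x. \<Phi> x * u - u * x \<in> Jp n j)"
    using induces_mono[OF a order_refl k c] u Jp_mono[OF x order_refl k] by blast
qed

lemma inner_mod_2: assumes "IA_like \<phi>" shows "inner_mod 2 \<phi>"
  unfolding inner_mod_def
proof
  fix n
  obtain \<Phi> where \<Phi>: "induces n 2 \<phi> \<Phi>" using induces_exists[of \<phi> 2 n] assms IA_like_def by auto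
  have "\<Phi> x - x \<in> Jp n 2" for x
    by (rule endo_cong_generators[OF J_endoD(1)[OF inducesD(1)[OF \<Phi>]] J_endoD(1)[OF J_endo_id]])
      (rule IA_like_induces[OF assms \<Phi> order_refl])
  then show "\<exists>\<Phi> u. induces n 2 \<phi> \<Phi> \<and> u - 1 \<in> Jp n 1 \<and> (\<forall>x. \<Phi> x * u - u * x \<in> Jp n 2)"
    using \<Phi> by (intro exI[of _ \<Phi>] exI[of _ 1]) simp
qed

lemma inner_mod_comp:
  assumes \<phi>: "inner_mod j \<phi>" and \<psi>: "inner_mod j \<psi>" and j: "j \<ge> 1" and c: "\<And>g. g \<in> carrier G \<Longrightarrow> \<psi> g \<in> carrier G"
  shows "inner_mod j (\<lambda>g. \<phi> (\<psi> g))"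
  unfolding inner_mod_def
proof
  fix n
  obtain \<Phi> u where \<Phi>: "induces n j \<phi> \<Phi>" and u: "u - 1 \<in> Jp n 1" "\<And>x. \<Phi> x * u - u * x \<in> Jp n j"
    using \<phi> unfolding inner_mod_def by blast
  obtain \<Psi> t where \<Psi>: "induces n j \<psi> \<Psi>" and t: "t - 1 \<in> Jp n 1" "\<And>x. \<Psi> x * t - t * x \<in> Jp n j"
    using \<psi> unfolding inner_mod_def by blast
  note re = endo_simps[OF J_endoD(1)[OF inducesD(1)[OF \<Phi>]]]
  have "\<Phi> t - 1 \<in> Jp n 1" using J_endo_cong[OF inducesD(1)[OF \<Phi>] j t(1)] by (simp add: re)
  then have 1: "\<Phi> t * u - 1 \<in> Jp n 1" by (rule unit_mult[OF _ u(1)])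
  have "\<Phi> (\<Psi> x) * (\<Phi> t * u) - \<Phi> t * u * x \<in> Jp n j" for x
  proof -
    have "\<Phi> (\<Psi> x * t) * u - \<Phi> (t * x) * u \<in> Jp n j"
      by (intro J_mult_cong J_refl J_endo_cong[OF inducesD(1)[OF \<Phi>] order_refl] t(2))
    moreover have "\<Phi> t * (\<Phi> x * u) - \<Phi> t * (u * x) \<in> Jp n j"
      by (intro J_mult_cong[OF J_refl] u(2))
    ultimately show ?thesis by (simp only: re mult.assoc) (rule J_trans)
  qed
  then show "\<exists>\<Phi> u. induces n j (\<lambda>g. \<phi> (\<psi> g)) \<Phi> \<and> u - 1 \<in> Jp n 1 \<and> (\<forall>x. \<Phi> x * u - u * x \<in> Jp n j)"
    using induces_comp[OF \<Phi> \<Psi> c] 1 by blast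
qed

lemma inner_mod_inv:
  assumes \<phi>: "inner_mod j \<phi>" and \<psi>: "approximable \<psi>" and j: "j \<ge> 1" and c: "\<And>g. g \<in> carrier G \<Longrightarrow> \<phi> (\<psi> g) = g"
  shows "inner_mod j \<psi>"
  unfolding inner_mod_def
proof
  fix n
  obtain \<Phi> u where \<Phi>: "induces n j \<phi> \<Phi>" and u: "u - 1 \<in> Jp n 1" "\<And>x. \<Phi> x * u - u * x \<in> Jp n j"
    using \<phi> unfolding inner_mod_def by blast
  obtain \<Psi> where \<Psi>: "induces n j \<psi> \<Psi>" using induces_exists[OF \<psi> j] by blast
  have e: "\<Phi> (\<Psi> x) - x \<in> Jp n j" for x
    by (rule induces_unique[OF induces_comp[OF \<Phi> \<Psi> approximable_closed[OF \<psi>]] induces_id c])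
  let ?u = "trunc_inv j u"
  have "\<Psi> x * ?u - ?u * x \<in> Jp n j" for x
  proof -
    have "u * \<Psi> x - x * u \<in> Jp n j"
      by (rule J_trans[OF J_sym[OF u(2)]]) (intro J_mult_cong J_refl e)
    then have "?u * (u * \<Psi> x) * ?u - ?u * (x * u) * ?u \<in> Jp n j"
      by (rule J_mult_cong[OF J_mult_cong[OF J_refl] J_refl])
    moreover have "1 * \<Psi> x * ?u - (?u * u) * \<Psi> x * ?u \<in> Jp n j"
      by (rule J_mult_cong[OF J_mult_cong[OF J_sym[OF trunc_inv(2)[OF u(1)]] J_refl] J_refl])
    moreover have "?u * x * (u * ?u) - ?u * x * 1 \<in> Jp n j"
      by (rule J_mult_cong[OF J_refl trunc_inv(1)[OF u(1)]])
    ultimately show ?thesis by (simp only: mult.assoc mult_1_left mult_1_right) (blast intro: J_trans)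
  qed
  then show "\<exists>\<Phi> u. induces n j \<psi> \<Phi> \<and> u - 1 \<in> Jp n 1 \<and> (\<forall>x. \<Phi> x * u - u * x \<in> Jp n j)"
    using \<Psi> trunc_inv(3)[OF u(1) j] by blast
qed

lemma inner_mod_inner:
  assumes g: "g \<in> carrier G" and approximable: "approximable \<phi>" and \<phi>: "\<And>h. h \<in> carrier G \<Longrightarrow> \<phi> h = g \<otimes> h \<otimes> inv g" and j: "j \<ge> 1"
  shows "inner_mod j \<phi>"
  unfolding inner_mod_def
proof
  fix n
  obtain \<Phi> where \<Phi>: "induces n j \<phi> \<Phi>" using induces_exists[OF approximable j] by blast
  note re = endo_simps[OF J_endoD(1)[OF inducesD(1)[OF \<Phi>]]]
  let ?u = "m n j g"
  have "\<Phi> x * ?u - ?u * x \<in> Jp n j" for x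
  proof (rule conj_generators[OF J_endoD(1)[OF inducesD(1)[OF \<Phi>]]])
    fix a
    show "\<Phi> (var a) * ?u - ?u * var a \<in> Jp n j"
    proof (cases "a \<in> V")
      case False
      show ?thesis
        by (rule J_diff[OF J_mult_right[OF J_endoD(2)[OF inducesD(1)[OF \<Phi>] order_refl var_notin[OF False]]]
              J_mult_left[OF var_notin[OF False]]])
    next
      case True
      note sa = s_closed[OF True]
      have "\<Phi> (var a) * ?u - (m n j (\<phi> (s a)) - 1) * ?u \<in> Jp n j"
        by (intro J_mult_cong J_refl induces_var[OF \<Phi> True])
      moreover have "m n j (\<phi> (s a)) * ?u - m n j (g \<otimes> s a) \<in> Jp n j"
        using J_sym[OF m_mult[OF approximable_closed[OF approximable sa] g]] g sa by (simp add: \<phi> m_assoc)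
      moreover have "m n j (g \<otimes> s a) - ?u * m n j (s a) \<in> Jp n j" by (rule m_mult[OF g sa])
      moreover have "?u * m n j (s a) - ?u * (1 + var a) \<in> Jp n j"
        by (rule J_mult_cong[OF J_refl m_s[OF True]])
      ultimately have "(\<Phi> (var a) * ?u - (m n j (\<phi> (s a)) - 1) * ?u) +
          ((m n j (\<phi> (s a)) * ?u - m n j (g \<otimes> s a)) + ((m n j (g \<otimes> s a) - ?u * m n j (s a))
          + (?u * m n j (s a) - ?u * (1 + var a)))) \<in> Jp n j" by (intro J_add)
      then show ?thesis by (simp add: algebra_simps)
    qed
  qed
  then show "\<exists>\<Phi> u. induces n j \<phi> \<Phi> \<and> u - 1 \<in> Jp n 1 \<and> (\<forall>x. \<Phi> x * u - u * x \<in> Jp n j)"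
    using \<Phi> m_unip[OF g j] by blast
qed

text \<open>A commutator is \<open>1\<close> plus a commutator of elements of degree one, up to a unit factor.\<close>

lemma derived_mod_2: assumes "d \<in> derived G (carrier G)" and k: "k \<ge> 2" shows "m n k d - 1 \<in> Jp n 2"
proof -
  have k1: "k \<ge> 1" using k by simp
  let ?S = "{d \<in> carrier G. m n k d - 1 \<in> Jp n 2}"
  have mm: "m n k (g \<otimes> h) - m n k g * m n k h \<in> Jp n 2" if "g \<in> carrier G" "h \<in> carrier G" for g h
    by (rule Jp_mono[OF m_mult[OF that] order_refl k])
  have "subgroup ?S G"
  proof (rule subgroupI)
    have "\<one> \<in> ?S" using Jp_mono[OF m_one[OF k1] order_refl k] by simp
    then show "?S \<noteq> {}" by blast
    fix d assume d: "d \<in> ?S"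
    have "m n k (inv d) * 1 - m n k (inv d) * m n k d \<in> Jp n 2"
      by (rule J_mult_cong[OF J_refl J_sym]) (use d in blast)
    then show "inv d \<in> ?S"
      using J_trans[OF _ Jp_mono[OF m_inv[OF k1, of d] order_refl k]] d by simp
    fix e assume e: "e \<in> ?S"
    have "m n k (d \<otimes> e) - 1 \<in> Jp n 2"
      by (rule J_trans[OF mm unit_mult]) (use d e in blast)+
    then show "d \<otimes> e \<in> ?S" using d e by simp
  qed blast
  moreover have "derived_set G (carrier G) \<subseteq> ?S"
  proof
    fix d assume "d \<in> derived_set G (carrier G)"
    then obtain g h where g: "g \<in> carrier G" and h: "h \<in> carrier G" and d: "d = g \<otimes> h \<otimes> inv g \<otimes> inv h" by blast
    have dG: "d \<in> carrier G" using g h d by simp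
    have hg: "h \<otimes> g \<in> carrier G" using g h by simp
    have "d \<otimes> (h \<otimes> g) = g \<otimes> h" unfolding d using g h by (simp add: m_assoc) (simp add: m_assoc[symmetric])
    then have 1: "m n k d * m n k (h \<otimes> g) - m n k g * m n k h \<in> Jp n 2"
      using J_trans[OF J_sym[OF mm[OF dG hg]]] mm[OF g h] by simp
    have "(m n k g - 1) * (m n k h - 1) \<in> Jp n (1 + 1)" "(m n k h - 1) * (m n k g - 1) \<in> Jp n (1 + 1)"
      by (intro J_times m_unip g h k1)+
    then have "(m n k g - 1) * (m n k h - 1) - (m n k h - 1) * (m n k g - 1) \<in> Jp n (1 + 1)" by (rule J_diff)
    then have 2: "m n k g * m n k h - m n k h * m n k g \<in> Jp n 2"
      by (simp add: algebra_simps numeral_2_eq_2)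
    have "m n k d * m n k (h \<otimes> g) - m n k (h \<otimes> g) \<in> Jp n 2"
      by (rule J_trans[OF J_trans[OF 1 2] J_sym[OF mm[OF h g]]])
    then have "(m n k d - 1) * m n k (h \<otimes> g) \<in> Jp n 2" by (simp add: left_diff_distrib)
    then have "m n k d - 1 \<in> Jp n 2" by (rule unit_cancel_right[OF m_unip[OF hg k1]])
    then show "d \<in> ?S" using dG by blast
  qed
  ultimately have "derived G (carrier G) \<subseteq> ?S" unfolding derived_def by (intro generate_subgroup_incl)
  then show ?thesis using assms(1) by blast
qed

lemma IA_like_I: assumes \<phi>: "approximable \<phi>" and D: "\<And>g. g \<in> carrier G \<Longrightarrow> \<phi> g \<otimes> inv g \<in> derived G (carrier G)"
  shows "IA_like \<phi>"
  unfolding IA_like_def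
proof (intro conjI allI ballI impI \<phi>)
  fix n k a assume a: "a \<in> V" and k: "(2::nat) \<le> k"
  let ?g = "s a" and ?d = "\<phi> (s a) \<otimes> inv (s a)"
  have g: "?g \<in> carrier G" "\<phi> ?g \<in> carrier G" using s_closed[OF a] approximable_closed[OF \<phi>] by auto
  have "\<phi> ?g = ?d \<otimes> ?g" using g by (simp add: m_assoc)
  then have "m n k (\<phi> ?g) - m n k ?d * m n k ?g \<in> Jp n k" using m_mult[of ?d ?g n k] g by simp
  then have "m n k (\<phi> ?g) - m n k ?d * m n k ?g \<in> Jp n 2" using Jp_mono[OF _ order_refl k] by blast
  moreover have "m n k ?d * m n k ?g - 1 * m n k ?g \<in> Jp n 2"
    by (rule J_mult_cong[OF derived_mod_2[OF D[OF g(1)] k] J_refl])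
  ultimately show "m n k (\<phi> ?g) - m n k ?g \<in> Jp n 2" by (simp only: mult_1_left) (rule J_trans)
qed

section \<open>Commutators and roots\<close>

text \<open>After conjugation by its unit, an element of \<open>N\<^sub>j\<close> moves the letters only in degree \<open>j\<close>.\<close>

lemma inner_mod_shift_endo:
  assumes \<phi>: "approximable \<phi>" "inner_mod j \<phi>" and \<Phi>: "induces n (Suc j) \<phi> \<Phi>" and j: "j \<ge> 1"
  obtains u \<Delta> where "u - 1 \<in> Jp n 1" "J_endo (int p ^ n) (Suc j) \<Delta>"
    "\<And>x. \<Delta> x - trunc_inv (Suc j) u * \<Phi> x * u \<in> Jp n (Suc j)"
    "\<And>a. \<Delta> (var a) - var a \<in> Jp n j"
proof -
  obtain u where u: "u - 1 \<in> Jp n 1" "\<And>x. \<Phi> x * u - u * x \<in> Jp n j"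
    using inner_mod_witness[OF \<phi>(2) \<Phi> _ approximable_closed[OF \<phi>(1)]] by auto
  obtain \<Delta> where \<Delta>: "J_endo (int p ^ n) (Suc j) \<Delta>"
      "\<And>x. \<Delta> x - trunc_inv (Suc j) u * \<Phi> x * u \<in> Jp n (Suc j)"
    using conj_endo[OF inducesD(1)[OF \<Phi>] _ u(1)] by auto
  let ?u = "trunc_inv (Suc j) u"
  have "\<Delta> (var a) - var a \<in> Jp n j" for a
  proof -
    have "\<Delta> (var a) - ?u * \<Phi> (var a) * u \<in> Jp n j"
      by (rule Jp_mono[OF \<Delta>(2) order_refl]) simp
    moreover have "?u * (\<Phi> (var a) * u) - ?u * (u * var a) \<in> Jp n j"
      by (rule J_mult_cong[OF J_refl u(2)])
    moreover have "?u * u * var a - 1 * var a \<in> Jp n j"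
      by (rule J_mult_cong[OF Jp_mono[OF trunc_inv(2)[OF u(1)] order_refl] J_refl]) simp
    ultimately show ?thesis by (simp only: mult.assoc mult_1_left) (blast intro: J_trans)
  qed
  then show ?thesis using that u(1) \<Delta> by blast
qed

text \<open>Here \<open>\<theta>\<close> is the commutator of \<open>\<phi>\<close> and \<open>\<psi>\<close>.  The corrected endomorphism \<open>\<Delta>\<close> of \<open>\<phi>\<close> commutes with \<open>\<Psi>\<close> modulo
  degree \<open>j + 1\<close>, since both orders send \<open>a\<close> to \<open>a\<close> plus the sum of the two displacements.  Undoing the
  correction leaves conjugation by \<open>u \<Psi>(u\<^sup>-\<^sup>1)\<close>.\<close>

lemma inner_mod_commutator:
  assumes \<phi>: "approximable \<phi>" "inner_mod j \<phi>" and \<psi>: "IA_like \<psi>" and \<theta>: "approximable \<theta>"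
    and \<phi>': "approximable \<phi>'" "\<And>g. g \<in> carrier G \<Longrightarrow> \<phi> (\<phi>' g) = g"
    and \<psi>': "approximable \<psi>'" "\<And>g. g \<in> carrier G \<Longrightarrow> \<psi> (\<psi>' g) = g"
    and eq: "\<And>g. g \<in> carrier G \<Longrightarrow> \<theta> (\<psi> (\<phi> g)) = \<phi> (\<psi> g)"
    and j: "j \<ge> 2"
  shows "inner_mod (Suc j) \<theta>"
  unfolding inner_mod_def
proof
  fix n
  let ?k = "Suc j"
  have k: "?k \<ge> 1" by simp
  have g\<psi>: "approximable \<psi>" using \<psi> by (simp add: IA_like_def)
  obtain \<Phi> where \<Phi>: "induces n ?k \<phi> \<Phi>" using induces_exists[OF \<phi>(1) k] by blast
  obtain \<Psi> where \<Psi>: "induces n ?k \<psi> \<Psi>" using induces_exists[OF g\<psi> k] by blast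
  obtain \<Theta> where \<Theta>: "induces n ?k \<theta> \<Theta>" using induces_exists[OF \<theta> k] by blast
  obtain \<Phi>' where \<Phi>': "induces n ?k \<phi>' \<Phi>'" using induces_exists[OF \<phi>'(1) k] by blast
  obtain \<Psi>' where \<Psi>': "induces n ?k \<psi>' \<Psi>'" using induces_exists[OF \<psi>'(1) k] by blast
  obtain u \<Delta> where u: "u - 1 \<in> Jp n 1" and \<Delta>: "J_endo (int p ^ n) ?k \<Delta>"
      "\<And>x. \<Delta> x - trunc_inv ?k u * \<Phi> x * u \<in> Jp n ?k" "\<And>a. \<Delta> (var a) - var a \<in> Jp n j"
    using inner_mod_shift_endo[OF \<phi> \<Phi>] j by auto
  have \<Psi>v: "\<Psi> (var a) - var a \<in> Jp n 2" for a using IA_like_induces[OF \<psi> \<Psi>] j by simp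
  note re\<Delta> = endo_simps[OF J_endoD(1)[OF \<Delta>(1)]] and re\<Psi> = endo_simps[OF J_endoD(1)[OF inducesD(1)[OF \<Psi>]]]
  have comm: "\<Delta> (\<Psi> x) - \<Psi> (\<Delta> x) \<in> Jp n ?k" for x
  proof (rule endo_cong_generators[OF J_endoD(1)[OF J_endo_comp[OF \<Delta>(1) inducesD(1)[OF \<Psi>]]]
          J_endoD(1)[OF J_endo_comp[OF inducesD(1)[OF \<Psi>] \<Delta>(1)]]])
    fix a
    let ?e = "\<Psi> (var a) - var a" and ?d = "\<Delta> (var a) - var a"
    have 1: "\<Delta> ?e - ?e \<in> Jp n (2 + j - 1)"
      by (rule J_endo_shift[OF \<Delta>(1) \<Delta>(3) _ \<Psi>v]) (use j in auto)
    have 2: "\<Psi> ?d - ?d \<in> Jp n (j + 2 - 1)"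
      by (rule J_endo_shift[OF inducesD(1)[OF \<Psi>] \<Psi>v _ \<Delta>(3)]) (use j in auto)
    have "2 + j - 1 = ?k" "j + 2 - 1 = ?k" by simp_all
    then have "(\<Delta> ?e - ?e) - (\<Psi> ?d - ?d) \<in> Jp n ?k" using J_diff[of _ _ ?k] 1 2 by metis
    then show "\<Delta> (\<Psi> (var a)) - \<Psi> (\<Delta> (var a)) \<in> Jp n ?k" by (simp add: re\<Delta> re\<Psi> algebra_simps)
  qed
  let ?u = "trunc_inv ?k u"
  let ?c = "u * \<Psi> ?u"
  have cu: "?c - 1 \<in> Jp n 1"
  proof (rule unit_mult[OF u])
    show "\<Psi> ?u - 1 \<in> Jp n 1"
      using J_endo_cong[OF inducesD(1)[OF \<Psi>] k trunc_inv(3)[OF u k]] by (simp add: re\<Psi>)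
  qed
  have \<Theta>1: "\<Theta> (\<Psi> (\<Phi> x)) - \<Phi> (\<Psi> x) \<in> Jp n ?k" for x
    by (rule induces_unique[OF induces_comp[OF \<Theta> induces_comp[OF \<Psi> \<Phi> approximable_closed[OF \<phi>(1)]]] induces_comp[OF \<Phi> \<Psi> approximable_closed[OF g\<psi>]]])
      (use eq approximable_closed[OF \<phi>(1)] approximable_closed[OF g\<psi>] in auto)
  have surj: "\<Psi> (\<Phi> (\<Phi>' (\<Psi>' y))) - y \<in> Jp n ?k" for y
    by (rule induces_unique[OF induces_comp[OF \<Psi> induces_comp[OF \<Phi> induces_comp[OF \<Phi>' \<Psi>' approximable_closed[OF \<psi>'(1)]]]] induces_id])
      (use \<phi>'(2) \<psi>'(2) approximable_closed[OF \<phi>(1)] approximable_closed[OF \<phi>'(1)] approximable_closed[OF \<psi>'(1)] in auto)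
  have key: "\<Phi> (\<Psi> x) * ?c - ?c * \<Psi> (\<Phi> x) \<in> Jp n ?k" for x
  proof -
    have 1: "?u * \<Phi> (\<Psi> x) * u - \<Psi> (?u * \<Phi> x * u) \<in> Jp n ?k"
      using J_trans[OF J_trans[OF J_sym[OF \<Delta>(2)] comm] J_endo_cong[OF inducesD(1)[OF \<Psi>] order_refl \<Delta>(2)]] .
    have "u * ?u * (\<Phi> (\<Psi> x) * u * \<Psi> ?u) - 1 * (\<Phi> (\<Psi> x) * u * \<Psi> ?u) \<in> Jp n ?k"
      by (rule J_mult_cong[OF trunc_inv(1)[OF u] J_refl])
    moreover have "u * (?u * \<Phi> (\<Psi> x) * u) * \<Psi> ?u - u * \<Psi> (?u * \<Phi> x * u) * \<Psi> ?u \<in> Jp n ?k"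
      by (rule J_mult_cong[OF J_mult_cong[OF J_refl 1] J_refl])
    moreover have "u * \<Psi> ?u * \<Psi> (\<Phi> x) * \<Psi> (u * ?u) - u * \<Psi> ?u * \<Psi> (\<Phi> x) * \<Psi> 1 \<in> Jp n ?k"
      by (rule J_mult_cong[OF J_refl J_endo_cong[OF inducesD(1)[OF \<Psi>] order_refl trunc_inv(1)[OF u]]])
    ultimately show ?thesis
      by (simp only: mult.assoc mult_1_left mult_1_right re\<Psi>) (blast intro: J_trans J_sym)
  qed
  have "\<Theta> y * ?c - ?c * y \<in> Jp n ?k" for y
  proof -
    let ?x = "\<Phi>' (\<Psi>' y)"
    have "\<Theta> y * ?c - \<Theta> (\<Psi> (\<Phi> ?x)) * ?c \<in> Jp n ?k"
      by (rule J_mult_cong[OF J_endo_cong[OF inducesD(1)[OF \<Theta>] order_refl J_sym[OF surj]] J_refl])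
    moreover have "\<Theta> (\<Psi> (\<Phi> ?x)) * ?c - \<Phi> (\<Psi> ?x) * ?c \<in> Jp n ?k"
      by (rule J_mult_cong[OF \<Theta>1 J_refl])
    moreover have "?c * \<Psi> (\<Phi> ?x) - ?c * y \<in> Jp n ?k"
      by (rule J_mult_cong[OF J_refl surj])
    ultimately show ?thesis using key[of ?x] by (blast intro: J_trans)
  qed
  then show "\<exists>\<Phi> u. induces n ?k \<theta> \<Phi> \<and> u - 1 \<in> Jp n 1 \<and> (\<forall>x. \<Phi> x * u - u * x \<in> Jp n ?k)"
    using \<Theta> cu by blast
qed

lemma induces_funpow:
  assumes \<Phi>: "induces n k \<phi> \<Phi>" and c: "\<And>g. g \<in> carrier G \<Longrightarrow> \<phi> g \<in> carrier G"
  shows "induces n k (\<phi> ^^ r) (\<Phi> ^^ r)"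
proof (induction r)
  case 0 show ?case using induces_id by (simp add: id_def)
next
  case (Suc r)
  have cr: "g \<in> carrier G \<Longrightarrow> (\<phi> ^^ r) g \<in> carrier G" for g
    by (induction r) (auto simp: c)
  show ?case using induces_comp[OF \<Phi> Suc cr] by (simp add: o_def)
qed

text \<open>For \<open>q = p\<close> the modulus drops from \<open>p\<^sup>n\<^sup>+\<^sup>1\<close> to \<open>p\<^sup>n\<close>, because a factor \<open>p\<close> is cancelled; for \<open>q \<noteq> p\<close> the element \<open>w\<close> is
  multiplied by an inverse \<open>b\<close> of \<open>q\<close> modulo \<open>p\<^sup>n\<close>.\<close>

lemma inner_of_prime_multiple_inner:
  assumes q: "prime (q :: nat)"
    and w: "\<And>a. of_nat q * \<delta> a - (w * var a - var a * w) \<in> Jp (Suc n) (Suc j)"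
  obtains w' where "\<And>a. a \<in> V \<Longrightarrow> \<delta> a - (w' * var a - var a * w') \<in> Jp n (Suc j)"
proof (cases "q = p")
  case True
  have cp: "w * var v - var v * w \<in> J (int p) (Suc j)" for v
  proof -
    have "of_int (int p) * \<delta> v \<in> J (int p) (Suc j)" by (rule J_modulus)
    moreover have "(w * var v - var v * w) - of_int (int p) * \<delta> v \<in> J (int p) (Suc j)"
      using J_mono[OF J_sym[OF w[of v]], of "int p" "Suc j"] True by simp
    ultimately show ?thesis using J_transfer by blast
  qed
  obtain z w' where z: "\<And>M. w - (z + of_int (int p) * w') \<in> J M j"
      "\<And>v M k. v \<in> V \<Longrightarrow> z * var v - var v * z \<in> J M k"
    using centralizer_mod[of w "int p" j] cp by blast
  have "\<delta> a - (w' * var a - var a * w') \<in> Jp n (Suc j)" if a: "a \<in> V" for a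
  proof -
    let ?r = "w - (z + of_int (int p) * w')"
    have r: "?r * var a - var a * ?r \<in> Jp (Suc n) (Suc j)"
      using J_diff[OF _ J_times[OF var_in_J1 z(1)]] J_times[OF z(1) var_in_J1]
      by (metis Suc_eq_plus1 plus_1_eq_Suc)
    have "of_int (int p) * (\<delta> a - (w' * var a - var a * w'))
       = (of_nat q * \<delta> a - (w * var a - var a * w)) + (?r * var a - var a * ?r) + (z * var a - var a * z)"
      using True mult_of_nat_commute[of p "var a"]
      by (simp add: algebra_simps) (metis mult.assoc)
    also have "\<dots> \<in> Jp (Suc n) (Suc j)" by (intro J_add w r z(2) a)
    finally have "of_int (int p) * (\<delta> a - (w' * var a - var a * w')) \<in> J (int p * int p ^ n) (Suc j)" by simp
    then show ?thesis by (rule J_scale_cancel) (use p in \<open>auto simp: prime_gt_0_nat\<close>)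
  qed
  then show ?thesis using that by blast
next
  case False
  have "coprime (int q) (int p ^ n)"
    using q p False by (simp add: primes_coprime)
  then obtain b c where b: "b * int q + c * int p ^ n = 1"
    using bezout_int[of "int q" "int p ^ n"] by (auto simp: coprime_iff_gcd_eq_1)
  have "\<delta> a - (of_int b * w * var a - var a * (of_int b * w)) \<in> Jp n (Suc j)" for a
  proof -
    have c: "1 - int q * b = int p ^ n * c" using b by (simp add: algebra_simps)
    have "of_int (1 - int q * b) * \<delta> a = of_int (int p ^ n) * (of_int c * \<delta> a)"
      unfolding c by (simp add: mult.assoc)
    then have 1: "of_int (1 - int q * b) * \<delta> a \<in> Jp n (Suc j)" using J_modulus by metis
    have "of_int b * (of_nat q * \<delta> a - (w * var a - var a * w)) \<in> Jp n (Suc j)"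
      by (rule J_mult_left[OF Jp_mono[OF w]]) auto
    note J_add[OF 1 this]
    moreover have "of_int (1 - int q * b) * \<delta> a + of_int b * (of_nat q * \<delta> a - (w * var a - var a * w))
        = \<delta> a - (of_int b * w * var a - of_int b * (var a * w))"
      using mult_of_nat_commute[of q "of_int b :: 'a free_alg"] by (simp add: algebra_simps)
    moreover have "of_int b * (var a * w) = var a * (of_int b * w)"
      by (metis mult.assoc mult_of_int_commute)
    ultimately show ?thesis by (simp only:)
  qed
  then show ?thesis using that by blast
qed

text \<open>To find the unit modulo \<open>p\<^sup>n\<close>, everything is set up modulo \<open>p\<^sup>n\<^sup>+\<^sup>1\<close>.  The corrected endomorphism
  \<open>a \<mapsto> a + \<delta>\<^sub>a\<close> has \<open>q\<close>-th power \<open>a \<mapsto> a + q \<delta>\<^sub>a\<close>, as it fixes \<open>\<delta>\<^sub>a\<close> modulo degree \<open>j + 1\<close>.\<close>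

lemma inner_mod_torsion:
  assumes \<phi>: "approximable \<phi>" "inner_mod j \<phi>" and j: "j \<ge> 2" and q: "prime (q :: nat)" and pw: "inner_mod (Suc j) (\<phi> ^^ q)"
  shows "inner_mod (Suc j) \<phi>"
  unfolding inner_mod_def
proof
  fix n
  let ?k = "Suc j"
  have k: "?k \<ge> 1" by simp
  obtain \<Phi> where \<Phi>: "induces (Suc n) ?k \<phi> \<Phi>" using induces_exists[OF \<phi>(1) k] by blast
  have j1: "j \<ge> 1" using j by simp
  obtain u \<Delta> where u: "u - 1 \<in> Jp (Suc n) 1" and \<Delta>: "J_endo (int p ^ Suc n) ?k \<Delta>"
      "\<And>x. \<Delta> x - trunc_inv ?k u * \<Phi> x * u \<in> Jp (Suc n) ?k" "\<And>a. \<Delta> (var a) - var a \<in> Jp (Suc n) j"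
    using inner_mod_shift_endo[OF \<phi> \<Phi> j1] by blast
  note re\<Delta> = endo_simps[OF J_endoD(1)[OF \<Delta>(1)]] and re\<Phi> = endo_simps[OF J_endoD(1)[OF inducesD(1)[OF \<Phi>]]]
  define \<delta> where "\<delta> a = \<Delta> (var a) - var a" for a
  have \<delta>: "\<delta> a \<in> Jp (Suc n) j" for a using \<Delta>(3) by (simp add: \<delta>_def)
  have \<Delta>\<delta>: "\<Delta> (\<delta> a) - \<delta> a \<in> Jp (Suc n) ?k" for a
  proof -
    have "\<Delta> (\<delta> a) - \<delta> a \<in> Jp (Suc n) (2 + j - 1)"
      by (rule J_endo_shift[OF \<Delta>(1) \<Delta>(3) j1 Jp_mono[OF \<delta> order_refl j]]) (use j in auto)
    then show ?thesis by simp
  qed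
  have pow: "(\<Delta> ^^ r) (var a) - (var a + of_nat r * \<delta> a) \<in> Jp (Suc n) ?k" for r a
  proof (induction r)
    case (Suc r)
    have "\<Delta> ((\<Delta> ^^ r) (var a)) - \<Delta> (var a + of_int (int r) * \<delta> a) \<in> Jp (Suc n) ?k"
      using J_endo_cong[OF \<Delta>(1) order_refl Suc] by simp
    moreover have "of_int (int r) * (\<Delta> (\<delta> a) - \<delta> a) \<in> Jp (Suc n) ?k" by (rule J_mult_left[OF \<Delta>\<delta>])
    ultimately have "(\<Delta> ((\<Delta> ^^ r) (var a)) - \<Delta> (var a + of_int (int r) * \<delta> a)) + of_int (int r) * (\<Delta> (\<delta> a) - \<delta> a) \<in> Jp (Suc n) ?k"
      by (rule J_add)
    moreover have "\<Delta> (var a + of_int (int r) * \<delta> a) = var a + \<delta> a + of_int (int r) * \<Delta> (\<delta> a)"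
      unfolding re\<Delta> endo_of_int[OF J_endoD(1)[OF \<Delta>(1)]] by (simp add: \<delta>_def)
    ultimately show ?case by (simp add: algebra_simps)
  qed simp
  have u\<Delta>: "u * \<Delta> x - \<Phi> x * u \<in> Jp (Suc n) ?k" for x
  proof -
    have "u * \<Delta> x - u * (trunc_inv ?k u * \<Phi> x * u) \<in> Jp (Suc n) ?k" by (rule J_mult_cong[OF J_refl \<Delta>(2)])
    moreover have "u * trunc_inv ?k u * (\<Phi> x * u) - 1 * (\<Phi> x * u) \<in> Jp (Suc n) ?k"
      by (rule J_mult_cong[OF trunc_inv(1)[OF u] J_refl])
    ultimately show ?thesis by (simp only: mult.assoc mult_1_left) (rule J_trans)
  qed
  \<comment> \<open>iterated correcting units, stated without inverses\<close>
  have "\<exists>U. U - 1 \<in> Jp (Suc n) 1 \<and> (\<forall>x. U * (\<Delta> ^^ r) x - (\<Phi> ^^ r) x * U \<in> Jp (Suc n) ?k)" for r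
  proof (induction r)
    case 0 show ?case by (rule exI[of _ 1]) simp
  next
    case (Suc r)
    then obtain U where U: "U - 1 \<in> Jp (Suc n) 1" "\<And>x. U * (\<Delta> ^^ r) x - (\<Phi> ^^ r) x * U \<in> Jp (Suc n) ?k" by blast
    have "\<Phi> U * u - 1 \<in> Jp (Suc n) 1"
      by (rule unit_mult[OF _ u]) (use J_endo_cong[OF inducesD(1)[OF \<Phi>] k U(1)] in \<open>simp add: re\<Phi>\<close>)
    moreover have "\<Phi> U * u * (\<Delta> ^^ Suc r) x - (\<Phi> ^^ Suc r) x * (\<Phi> U * u) \<in> Jp (Suc n) ?k" for x
    proof -
      have "\<Phi> U * (u * \<Delta> ((\<Delta> ^^ r) x)) - \<Phi> U * (\<Phi> ((\<Delta> ^^ r) x) * u) \<in> Jp (Suc n) ?k"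
        by (rule J_mult_cong[OF J_refl u\<Delta>])
      moreover have "\<Phi> (U * (\<Delta> ^^ r) x) * u - \<Phi> ((\<Phi> ^^ r) x * U) * u \<in> Jp (Suc n) ?k"
        by (rule J_mult_cong[OF J_endo_cong[OF inducesD(1)[OF \<Phi>] order_refl U(2)] J_refl])
      ultimately show ?thesis by (simp only: re\<Phi> mult.assoc funpow.simps o_apply) (rule J_trans)
    qed
    ultimately show ?case by blast
  qed
  then obtain U where U: "U - 1 \<in> Jp (Suc n) 1" "\<And>x. U * (\<Delta> ^^ q) x - (\<Phi> ^^ q) x * U \<in> Jp (Suc n) ?k" by blast
  have cq: "g \<in> carrier G \<Longrightarrow> (\<phi> ^^ r) g \<in> carrier G" for g r
    by (induction r) (auto simp: approximable_closed[OF \<phi>(1)])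
  obtain t where t: "t - 1 \<in> Jp (Suc n) 1" "\<And>x. (\<Phi> ^^ q) x * t - t * x \<in> Jp (Suc n) ?k"
    using inner_mod_witness[OF pw induces_funpow[OF \<Phi> approximable_closed[OF \<phi>(1)]] order_refl cq] by blast
  let ?U = "trunc_inv ?k U"
  let ?w = "?U * t"
  have w1: "?w - 1 \<in> Jp (Suc n) 1" by (rule unit_mult[OF trunc_inv(3)[OF U(1) k] t(1)])
  have w: "(\<Delta> ^^ q) x * ?w - ?w * x \<in> Jp (Suc n) ?k" for x
  proof -
    have "1 * ((\<Delta> ^^ q) x * ?w) - ?U * U * ((\<Delta> ^^ q) x * ?w) \<in> Jp (Suc n) ?k"
      by (rule J_mult_cong[OF J_sym[OF trunc_inv(2)[OF U(1)]] J_refl])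
    moreover have "?U * (U * (\<Delta> ^^ q) x) * ?w - ?U * ((\<Phi> ^^ q) x * U) * ?w \<in> Jp (Suc n) ?k"
      by (rule J_mult_cong[OF J_mult_cong[OF J_refl U(2)] J_refl])
    moreover have "?U * (\<Phi> ^^ q) x * ((U * ?U) * t) - ?U * (\<Phi> ^^ q) x * (1 * t) \<in> Jp (Suc n) ?k"
      by (rule J_mult_cong[OF J_refl J_mult_cong[OF trunc_inv(1)[OF U(1)] J_refl]])
    moreover have "?U * ((\<Phi> ^^ q) x * t) - ?U * (t * x) \<in> Jp (Suc n) ?k"
      by (rule J_mult_cong[OF J_refl t(2)])
    ultimately show ?thesis by (simp only: mult.assoc mult_1_left) (blast intro: J_trans)
  qed
  have "of_nat q * \<delta> a - (?w * var a - var a * ?w) \<in> Jp (Suc n) ?k" for a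
  proof -
    have "(\<Delta> ^^ q) (var a) * ?w - (var a + of_nat q * \<delta> a) * ?w \<in> Jp (Suc n) ?k"
      by (rule J_mult_cong[OF pow J_refl])
    moreover have "of_nat q * (\<delta> a * (?w - 1)) \<in> Jp (Suc n) ?k"
      using J_mult_left[OF J_times[OF \<delta> w1]] by simp
    ultimately have "((\<Delta> ^^ q) (var a) * ?w - ?w * var a) - ((\<Delta> ^^ q) (var a) * ?w - (var a + of_nat q * \<delta> a) * ?w)
        - of_nat q * (\<delta> a * (?w - 1)) \<in> Jp (Suc n) ?k"
      by (intro J_diff[OF J_diff[OF w]])
    moreover have "((\<Delta> ^^ q) (var a) * ?w - ?w * var a) - ((\<Delta> ^^ q) (var a) * ?w - (var a + of_nat q * \<delta> a) * ?w)
        - of_nat q * (\<delta> a * (?w - 1)) = of_nat q * \<delta> a - (?w * var a - var a * ?w)"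
      by (simp add: algebra_simps)
    ultimately show ?thesis by (simp only:)
  qed
  then obtain w' where w': "\<And>a. a \<in> V \<Longrightarrow> \<delta> a - (w' * var a - var a * w') \<in> Jp n ?k"
    using inner_of_prime_multiple_inner[OF q, of \<delta> ?w n j] by blast
  define c where "c = pair w' (\<lambda>w. if w = [] then 1 else 0)"
  \<comment> \<open>removing the constant term of \<open>w'\<close> keeps all commutators and makes \<open>1 + w'\<close> a unit\<close>
  let ?v = "w' - of_int c"
  have v: "?v \<in> Jp n 1" unfolding c_def by (rule J1_const)
  have un: "u - 1 \<in> Jp n 1" by (rule Jp_mono[OF u]) simp_all
  have uv: "u * (1 + ?v) - 1 \<in> Jp n 1" by (rule unit_mult[OF un]) (use v in simp)
  have \<Phi>n: "induces n ?k \<phi> \<Phi>" by (rule induces_mono[OF \<Phi> _ order_refl approximable_closed[OF \<phi>(1)]]) simp_all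
  have "\<Phi> x * (u * (1 + ?v)) - u * (1 + ?v) * x \<in> Jp n ?k" for x
  proof (rule conj_generators[OF J_endoD(1)[OF inducesD(1)[OF \<Phi>n]]])
    fix a
    show "\<Phi> (var a) * (u * (1 + ?v)) - u * (1 + ?v) * var a \<in> Jp n ?k"
    proof (cases "a \<in> V")
      case False
      show ?thesis
        by (rule J_diff[OF J_mult_right[OF J_endoD(2)[OF inducesD(1)[OF \<Phi>n] order_refl var_notin[OF False]]]
              J_mult_left[OF var_notin[OF False]]])
    next
      case True
      have "\<delta> a * ?v \<in> Jp n ?k" using J_times[OF Jp_mono[OF \<delta>, of n j] v] by simp
      then have "(\<delta> a - (w' * var a - var a * w')) + \<delta> a * ?v \<in> Jp n ?k" by (rule J_add[OF w'[OF True]])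
      moreover have "(\<delta> a - (w' * var a - var a * w')) + \<delta> a * ?v = \<Delta> (var a) * (1 + ?v) - (1 + ?v) * var a"
        using mult_of_int_commute[of c "var a"] by (simp add: \<delta>_def algebra_simps)
      ultimately have 1: "\<Delta> (var a) * (1 + ?v) - (1 + ?v) * var a \<in> Jp n ?k" by simp
      have "\<Phi> (var a) * u * (1 + ?v) - u * \<Delta> (var a) * (1 + ?v) \<in> Jp n ?k"
        by (rule J_mult_cong[OF J_sym[OF Jp_mono[OF u\<Delta>]] J_refl]) simp_all
      moreover have "u * (\<Delta> (var a) * (1 + ?v)) - u * ((1 + ?v) * var a) \<in> Jp n ?k"
        by (rule J_mult_cong[OF J_refl 1])
      ultimately show ?thesis by (simp only: mult.assoc) (rule J_trans)
    qed
  qed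
  then show "\<exists>\<Phi> u. induces n ?k \<phi> \<Phi> \<and> u - 1 \<in> Jp n 1 \<and> (\<forall>x. \<Phi> x * u - u * x \<in> Jp n ?k)"
    using \<Phi>n uv by blast
qed

end

section \<open>Finite p-groups\<close>

text \<open>Another prime dividing the order would give, by Sylow, an element of that order.\<close>

lemma order_prime_power_of_exponent:
  assumes Q: "group Q" and fin: "finite (carrier Q)" and p: "prime (p::nat)"
    and ex: "\<And>x. x \<in> carrier Q \<Longrightarrow> x [^]\<^bsub>Q\<^esub> (p ^ r :: nat) = \<one>\<^bsub>Q\<^esub>"
  shows "\<exists>k. order Q = p ^ k"
proof -
  interpret group Q by (rule Q)
  have o0: "order Q \<noteq> 0" using fin by (simp add: order_gt_0_iff_finite)
  have np: "\<not> is_unit p" using p by (meson not_prime_unit)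
  obtain y where y: "order Q = p ^ multiplicity p (order Q) * y" "\<not> p dvd y"
    using multiplicity_decompose'[OF o0 np] .
  have "y = 1"
  proof (rule ccontr)
    assume "y \<noteq> 1"
    then obtain q where q: "prime q" "q dvd y" using prime_factor_nat by blast
    then obtain z where z: "y = q * z" by blast
    have "order Q = q ^ 1 * (p ^ multiplicity p (order Q) * z)" using y(1) z by (metis mult.left_commute power_one_right)
    then obtain H where H: "subgroup H Q" "card H = q ^ 1" using sylow_thm[OF q(1) Q _ fin] by blast
    interpret H: subgroup H Q by (rule H(1))
    have Hg: "group (Q\<lparr>carrier := H\<rparr>)" using H.subgroup_is_group[OF Q] .
    have "H \<noteq> {\<one>\<^bsub>Q\<^esub>}" using H(2) prime_gt_1_nat[OF q(1)] by auto
    then obtain x where x: "x \<in> H" "x \<noteq> \<one>\<^bsub>Q\<^esub>" using H.one_closed by blast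
    have xQ: "x \<in> carrier Q" using x H.subset by blast
    have "x [^]\<^bsub>Q\<lparr>carrier := H\<rparr>\<^esub> order (Q\<lparr>carrier := H\<rparr>) = \<one>\<^bsub>Q\<^esub>"
      using group.pow_order_eq_1[OF Hg, of x] x(1) by simp
    then have "x [^]\<^bsub>Q\<^esub> q = \<one>\<^bsub>Q\<^esub>"
      using H(2) nat_pow_consistent[of x q H] by (simp add: order_def)
    then have 1: "ord x dvd q" using pow_eq_id[OF xQ] by blast
    have 2: "ord x dvd p ^ r" using pow_eq_id[OF xQ] ex[OF xQ] by blast
    have "p \<noteq> q" using y(2) q(2) by blast
    then have "coprime q (p ^ r)" using p q(1) by (simp add: primes_coprime)
    then have "ord x dvd 1" using 1 2 by (meson coprime_common_divisor)
    then have "x [^]\<^bsub>Q\<^esub> (1::nat) = \<one>\<^bsub>Q\<^esub>" using pow_eq_id[OF xQ] by blast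
    then show False using x(2) xQ by simp
  qed
  then show ?thesis using y(1) by auto
qed

text \<open>Orbits have \<open>p\<close>-power length, so those that are not fixed points contribute multiples of \<open>p\<close>.\<close>

lemma fixed_points_mod_p:
  assumes H: "group H" and o: "order H = p ^ r" and p: "prime (p::nat)" and fin: "finite X"
    and cl: "\<And>g x. g \<in> carrier H \<Longrightarrow> x \<in> X \<Longrightarrow> a g x \<in> X"
    and am: "\<And>g h x. g \<in> carrier H \<Longrightarrow> h \<in> carrier H \<Longrightarrow> x \<in> X \<Longrightarrow> a (g \<otimes>\<^bsub>H\<^esub> h) x = a g (a h x)"
    and a1: "\<And>x. x \<in> X \<Longrightarrow> a \<one>\<^bsub>H\<^esub> x = x"
    and f: "\<And>g x. g \<in> carrier H \<Longrightarrow> x \<in> X \<Longrightarrow> int p dvd f (a g x) - f x"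
  shows "int p dvd (\<Sum>x\<in>X. f x) - (\<Sum>x | x \<in> X \<and> (\<forall>g\<in>carrier H. a g x = x). f x)"
proof -
  interpret H: group H by (rule H)
  define \<phi> where "\<phi> g = (\<lambda>x\<in>X. a g x)" for g
  have bij: "\<phi> g \<in> Bij X" if g: "g \<in> carrier H" for g
  proof -
    have "bij_betw (\<phi> g) X X"
    proof (rule bij_betwI[where g = "\<phi> (inv\<^bsub>H\<^esub> g)"])
      show "\<phi> g \<in> X \<rightarrow> X" "\<phi> (inv\<^bsub>H\<^esub> g) \<in> X \<rightarrow> X" using cl g by (auto simp: \<phi>_def)
      show "\<phi> (inv\<^bsub>H\<^esub> g) (\<phi> g x) = x" if "x \<in> X" for x
        using am[of "inv\<^bsub>H\<^esub> g" g x] that g cl a1 by (simp add: \<phi>_def)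
      show "\<phi> g (\<phi> (inv\<^bsub>H\<^esub> g) x) = x" if "x \<in> X" for x
        using am[of g "inv\<^bsub>H\<^esub> g" x] that g cl a1 by (simp add: \<phi>_def)
    qed
    then show ?thesis by (simp add: Bij_def \<phi>_def)
  qed
  have "group_hom H (BijGroup X) \<phi>"
  proof (rule group_hom.intro[OF H group_BijGroup], unfold group_hom_axioms_def, rule homI)
    show "\<phi> g \<in> carrier (BijGroup X)" if "g \<in> carrier H" for g using bij[OF that] by (simp add: BijGroup_def)
    fix g h assume gh: "g \<in> carrier H" "h \<in> carrier H"
    then show "\<phi> (g \<otimes>\<^bsub>H\<^esub> h) = \<phi> g \<otimes>\<^bsub>BijGroup X\<^esub> \<phi> h"
      using bij am cl by (auto simp: BijGroup_def compose_def \<phi>_def fun_eq_iff)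
  qed
  then interpret A: group_action H X \<phi> by (simp add: group_action_def)
  let ?F = "{x \<in> X. \<forall>g\<in>carrier H. a g x = x}"
  have orb: "int p dvd (\<Sum>x\<in>b. if x \<in> ?F then 0 else f x)" if bo: "b \<in> orbits H X \<phi>" for b
  proof -
    obtain x where x: "x \<in> X" "b = orbit H \<phi> x" using bo by (auto simp: orbits_def)
    have b: "b = {a g x | g. g \<in> carrier H}" using x by (auto simp: orbit_def \<phi>_def)
    have fx: "int p dvd f y - f x" if "y \<in> b" for y using that b f x(1) by blast
    have bX: "b \<subseteq> X" using b cl x(1) by blast
    have "card b dvd p ^ r"
      using A.orbit_stabilizer_theorem[OF x(1)] x(2) o by (metis dvd_triv_left)
    then consider "card b = 1" | "p dvd card b"
      using divides_primepow_nat[OF p, of "card b" r] by (metis dvd_power neq0_conv power_0)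
    then show ?thesis
    proof cases
      case 1
      then obtain z where z: "b = {z}" by (rule card_1_singletonE)
      have xb: "x \<in> b" using A.orbit_refl[OF x(1)] x(2) by simp
      then have "b = {x}" using z by simp
      moreover have "x \<in> ?F" using calculation b x(1) by blast
      ultimately show ?thesis by simp
    next
      case 2
      have "y \<notin> ?F" if y: "y \<in> b" for y
      proof
        assume yF: "y \<in> ?F"
        have "x \<in> orbit H \<phi> y" using A.orbit_sym[of x y] x y bX by auto
        then have "x = y" using yF by (auto simp: orbit_def \<phi>_def)
        then have "b = {x}" using yF b y by auto
        then have "p dvd 1" using 2 by simp
        then show False using p by (meson not_prime_unit)
      qed
      then have "(\<Sum>y\<in>b. if y \<in> ?F then 0 else f y) = (\<Sum>y\<in>b. f y)"
        by (intro sum.cong) auto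
      also have "\<dots> = (\<Sum>y\<in>b. f y - f x) + int (card b) * f x"
        by (simp add: sum_subtractf)
      also have "int p dvd \<dots>"
        using 2 by (intro dvd_add dvd_sum fx dvd_mult2) auto
      finally show ?thesis .
    qed
  qed
  have "(\<Sum>x\<in>X. f x) - (\<Sum>x\<in>?F. f x) = (\<Sum>x\<in>X. if x \<in> ?F then 0 else f x)"
  proof -
    have "(\<Sum>x\<in>X. f x) = (\<Sum>x\<in>X. (if x \<in> ?F then 0 else f x) + (if x \<in> ?F then f x else 0))"
      by (intro sum.cong) auto
    also have "\<dots> = (\<Sum>x\<in>X. if x \<in> ?F then 0 else f x) + (\<Sum>x\<in>X. if x \<in> ?F then f x else 0)"
      by (rule sum.distrib)
    also have "(\<Sum>x\<in>X. if x \<in> ?F then f x else 0) = (\<Sum>x\<in>?F. f x)"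
      using fin by (intro sum.mono_neutral_cong_right) auto
    finally show ?thesis by simp
  qed
  also have "\<dots> = (\<Sum>b\<in>orbits H X \<phi>. \<Sum>x\<in>b. if x \<in> ?F then 0 else f x)"
    by (rule A.disjoint_sum[OF fin, symmetric])
  also have "int p dvd \<dots>" by (rule dvd_sum) (rule orb)
  finally show ?thesis .
qed

definition left_translate :: "('q, 'm) monoid_scheme \<Rightarrow> 'q \<Rightarrow> ('q \<Rightarrow> int) \<Rightarrow> 'q \<Rightarrow> int" where
  "left_translate Q a f q = f (inv\<^bsub>Q\<^esub> a \<otimes>\<^bsub>Q\<^esub> q)"

text \<open>The operator on functions given by the product of the \<open>a - 1\<close> in the group ring, for \<open>a\<close> in the list.\<close>

definition aug_op :: "('q, 'm) monoid_scheme \<Rightarrow> 'q list \<Rightarrow> ('q \<Rightarrow> int) \<Rightarrow> 'q \<Rightarrow> int" where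
  "aug_op Q ws f = foldr (\<lambda>a h q. left_translate Q a h q - h q) ws f"

lemma aug_op_Nil: "aug_op Q [] f = f" by (simp add: aug_op_def)
lemma aug_op_Cons: "aug_op Q (a # ws) f q = left_translate Q a (aug_op Q ws f) q - aug_op Q ws f q" by (simp add: aug_op_def)
lemma aug_op_snoc: "aug_op Q (ws @ [a]) f = aug_op Q ws (\<lambda>q. left_translate Q a f q - f q)" by (simp add: aug_op_def)

lemma aug_op_diff: "aug_op Q ws (\<lambda>q. f q - g q) q = aug_op Q ws f q - aug_op Q ws g q"
  by (induction ws arbitrary: q) (simp_all add: aug_op_Nil aug_op_Cons left_translate_def)

lemma aug_op_cong:
  assumes Q: "group Q" and ws: "set ws \<subseteq> carrier Q" and fg: "\<And>q. q \<in> carrier Q \<Longrightarrow> M dvd f q - g q"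
    and q: "q \<in> carrier Q"
  shows "M dvd aug_op Q ws f q - aug_op Q ws g q"
  using ws q
proof (induction ws arbitrary: q)
  case (Cons a ws)
  interpret group Q by (rule Q)
  have "M dvd aug_op Q ws f (inv\<^bsub>Q\<^esub> a \<otimes>\<^bsub>Q\<^esub> q) - aug_op Q ws g (inv\<^bsub>Q\<^esub> a \<otimes>\<^bsub>Q\<^esub> q)"
    using Cons.prems by (intro Cons.IH) auto
  moreover have "M dvd aug_op Q ws f q - aug_op Q ws g q" using Cons by simp
  ultimately have "M dvd (aug_op Q ws f (inv\<^bsub>Q\<^esub> a \<otimes>\<^bsub>Q\<^esub> q) - aug_op Q ws g (inv\<^bsub>Q\<^esub> a \<otimes>\<^bsub>Q\<^esub> q)) - (aug_op Q ws f q - aug_op Q ws g q)"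
    by (rule dvd_diff)
  then show ?case by (simp add: aug_op_Cons left_translate_def algebra_simps)
qed (simp add: aug_op_Nil fg)

lemma aug_op_append: "aug_op Q (us @ ws) f = aug_op Q us (aug_op Q ws f)"
  by (simp add: aug_op_def)

lemma aug_op_cong_eq:
  assumes "group Q" "set ws \<subseteq> carrier Q" "\<And>q. q \<in> carrier Q \<Longrightarrow> f q = g q" "q \<in> carrier Q"
  shows "aug_op Q ws f q = aug_op Q ws g q"
  using aug_op_cong[of Q ws 0 f g q] assms by simp

lemma aug_op_commute:
  assumes Q: "group Q" and us: "set us \<subseteq> carrier Q" and x: "x \<in> carrier Q" "y \<in> carrier Q"
    and xy: "x \<otimes>\<^bsub>Q\<^esub> y = y \<otimes>\<^bsub>Q\<^esub> x" and q: "q \<in> carrier Q"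
  shows "aug_op Q (us @ [x, y] @ vs) f q = aug_op Q (us @ [y, x] @ vs) f q"
proof -
  interpret group Q by (rule Q)
  have "inv\<^bsub>Q\<^esub> x \<otimes>\<^bsub>Q\<^esub> inv\<^bsub>Q\<^esub> y = inv\<^bsub>Q\<^esub> y \<otimes>\<^bsub>Q\<^esub> inv\<^bsub>Q\<^esub> x"
    using xy x by (metis inv_mult_group)
  then have e: "inv\<^bsub>Q\<^esub> x \<otimes>\<^bsub>Q\<^esub> (inv\<^bsub>Q\<^esub> y \<otimes>\<^bsub>Q\<^esub> r) = inv\<^bsub>Q\<^esub> y \<otimes>\<^bsub>Q\<^esub> (inv\<^bsub>Q\<^esub> x \<otimes>\<^bsub>Q\<^esub> r)" if "r \<in> carrier Q" for r
    using that x by (metis inv_closed m_assoc)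
  show ?thesis unfolding aug_op_append
  proof (rule aug_op_cong_eq[OF Q us _ q])
    fix r assume r: "r \<in> carrier Q"
    show "aug_op Q [x, y] (aug_op Q vs f) r = aug_op Q [y, x] (aug_op Q vs f) r"
      by (simp add: aug_op_Cons aug_op_Nil left_translate_def e[OF r])
  qed
qed

lemma aug_op_right_translate:
  assumes Q: "group Q" and ws: "set ws \<subseteq> carrier Q" and z: "z \<in> carrier Q" and q: "q \<in> carrier Q"
  shows "aug_op Q ws (\<lambda>r. f (r \<otimes>\<^bsub>Q\<^esub> z)) q = aug_op Q ws f (q \<otimes>\<^bsub>Q\<^esub> z)"
  using ws q
proof (induction ws arbitrary: q)
  case (Cons a ws)
  interpret group Q by (rule Q)
  show ?case using Cons z by (simp add: aug_op_Cons left_translate_def m_assoc)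
qed (simp add: aug_op_Nil)

lemma sum_aug_op:
  assumes Q: "group Q" and ws: "set (a # ws) \<subseteq> carrier Q"
  shows "(\<Sum>q\<in>carrier Q. aug_op Q (a # ws) f q) = 0"
proof -
  interpret group Q by (rule Q)
  have a: "a \<in> carrier Q" using ws by simp
  have "(\<Sum>q\<in>carrier Q. aug_op Q ws f (inv\<^bsub>Q\<^esub> a \<otimes>\<^bsub>Q\<^esub> q)) = (\<Sum>q\<in>carrier Q. aug_op Q ws f q)"
    by (rule sum.reindex_bij_witness[where i = "\<lambda>q. a \<otimes>\<^bsub>Q\<^esub> q" and j = "\<lambda>q. inv\<^bsub>Q\<^esub> a \<otimes>\<^bsub>Q\<^esub> q"])
      (use a in \<open>simp_all add: m_assoc[symmetric]\<close>)
  then show ?thesis by (simp add: aug_op_Cons left_translate_def sum_subtractf)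
qed

text \<open>Call a function good if long products of the \<open>a - 1\<close> annihilate it modulo \<open>p\<close>.  The quotient of all
  functions by the good ones is a finite \<open>p\<close>-group on which \<open>Q\<close> acts; were it non-trivial, it would have a
  fixed point besides zero, that is a function \<open>f\<close> which is not good although \<open>(a - 1) f\<close> is good for
  all \<open>a\<close>.  But such an \<open>f\<close> is good, with one more factor.\<close>

lemma augmentation_nilpotent:
  assumes Q: "group Q" and o: "order Q = p ^ r" and p: "prime (p::nat)"
  shows "\<exists>k. \<forall>ws. set ws \<subseteq> carrier Q \<longrightarrow> k \<le> length ws \<longrightarrow> (\<forall>q\<in>carrier Q. int p dvd aug_op Q ws f q)"
proof -
  interpret Q: group Q by (rule Q)
  have finQ: "finite (carrier Q)" using o p by (metis Q.order_gt_0_iff_finite prime_gt_0_nat zero_less_power)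
  define ann where "ann f k \<longleftrightarrow> (\<forall>ws. set ws \<subseteq> carrier Q \<longrightarrow> k \<le> length ws \<longrightarrow> (\<forall>q\<in>carrier Q. int p dvd aug_op Q ws f q))" for f k
  define gd where "gd f \<longleftrightarrow> (\<exists>k. ann f k)" for f
  have ann_mono: "ann f k \<Longrightarrow> k \<le> k' \<Longrightarrow> ann f k'" for f k k' unfolding ann_def by (meson order_trans)
  have gd_diff: "gd (\<lambda>q. f q - g q)" if gfg: "gd f" "gd g" for f g
  proof -
    obtain k k' where "ann f k" "ann g k'" using gfg gd_def by auto
    then have "ann f (max k k')" "ann g (max k k')" using ann_mono by auto
    then have "ann (\<lambda>q. f q - g q) (max k k')" unfolding ann_def aug_op_diff by (meson dvd_diff)
    then show ?thesis using gd_def by blast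
  qed
  have gd_cong: "gd f" if gg: "gd g" and fg: "\<And>q. q \<in> carrier Q \<Longrightarrow> int p dvd f q - g q" for f g
  proof -
    obtain k where k: "ann g k" using gg gd_def by auto
    have "ann f k" unfolding ann_def
    proof (intro allI impI ballI)
      fix ws q assume ws: "set ws \<subseteq> carrier Q" "k \<le> length ws" "q \<in> carrier Q"
      have "int p dvd aug_op Q ws f q - aug_op Q ws g q" by (rule aug_op_cong[OF Q ws(1) fg ws(3)])
      moreover have "int p dvd aug_op Q ws g q" using k ws unfolding ann_def by blast
      ultimately show "int p dvd aug_op Q ws f q" by (metis dvd_add_left_iff diff_add_cancel)
    qed
    then show ?thesis using gd_def by blast
  qed
  have gd0: "gd (\<lambda>_. 0)"
  proof -
    have "aug_op Q ws (\<lambda>_. 0) q = 0" for ws q by (induction ws arbitrary: q) (auto simp: aug_op_Nil aug_op_Cons left_translate_def)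
    then show ?thesis unfolding gd_def ann_def by simp
  qed
  have gd_neg: "gd (\<lambda>q. - f q)" if "gd f" for f using gd_diff[OF gd0 that] by simp
  have gd_add: "gd (\<lambda>q. f q + g q)" if "gd f" "gd g" for f g using gd_diff[OF that(1) gd_neg[OF that(2)]] by simp
  have gd_p: "gd (\<lambda>q. int p * f q)" for f by (rule gd_cong[OF gd0]) simp
  have gd_trans: "gd (left_translate Q a f)" if gf: "gd f" and a: "a \<in> carrier Q" for a f
  proof -
    obtain k where k: "ann f k" using gf gd_def by auto
    have "ann (\<lambda>q. left_translate Q a f q - f q) k" unfolding ann_def
    proof (intro allI impI ballI)
      fix ws q assume "set ws \<subseteq> carrier Q" "k \<le> length ws" "q \<in> carrier Q"
      then show "int p dvd aug_op Q ws (\<lambda>q. left_translate Q a f q - f q) q"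
        using k a unfolding ann_def aug_op_snoc[symmetric] by simp
    qed
    then have "gd (\<lambda>q. left_translate Q a f q - f q)" using gd_def by blast
    from gd_add[OF this gf] show ?thesis by simp
  qed
  have gd_step: "gd f" if "\<And>a. a \<in> carrier Q \<Longrightarrow> gd (\<lambda>q. left_translate Q a f q - f q)" for f
  proof -
    have "\<forall>a\<in>carrier Q. \<exists>k. ann (\<lambda>q. left_translate Q a f q - f q) k" using that gd_def by blast
    then obtain K where K: "\<And>a. a \<in> carrier Q \<Longrightarrow> ann (\<lambda>q. left_translate Q a f q - f q) (K a)" by metis
    let ?k = "Max (K ` carrier Q)"
    have "ann f (Suc ?k)" unfolding ann_def
    proof (intro allI impI ballI)
      fix ws q assume ws: "set ws \<subseteq> carrier Q" "Suc ?k \<le> length ws" and q: "q \<in> carrier Q"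
      then obtain vs a where v: "ws = vs @ [a]" by (cases ws rule: rev_cases) auto
      have a: "a \<in> carrier Q" using ws v by simp
      have "K a \<le> ?k" using finQ a by (intro Max_ge) auto
      then have kv: "K a \<le> length vs" using ws v by simp
      have "int p dvd aug_op Q vs (\<lambda>q. left_translate Q a f q - f q) q"
        using K[OF a, unfolded ann_def, rule_format, of vs q] kv ws(1) v q by simp
      then show "int p dvd aug_op Q ws f q" by (simp add: v aug_op_snoc)
    qed
    then show ?thesis using gd_def by blast
  qed
  \<comment> \<open>functions supported on \<open>Q\<close>, so that translations form an action\<close>
  define W where "W = \<lparr>carrier = {f :: 'a \<Rightarrow> int. \<forall>q. q \<notin> carrier Q \<longrightarrow> f q = 0}, mult = (\<lambda>(f :: 'a \<Rightarrow> int) g q. f q + g q), one = (\<lambda>_. 0)\<rparr>"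
  have W: "comm_group W"
  proof (rule comm_groupI)
    fix f assume "f \<in> carrier W"
    then show "\<exists>g\<in>carrier W. g \<otimes>\<^bsub>W\<^esub> f = \<one>\<^bsub>W\<^esub>"
      by (intro bexI[of _ "\<lambda>q. - f q"]) (auto simp: W_def)
  qed (auto simp: W_def fun_eq_iff)
  interpret W: comm_group W by (rule W)
  have Winv: "inv\<^bsub>W\<^esub> f = (\<lambda>q. - f q)" if "f \<in> carrier W" for f
    by (rule W.inv_equality) (use that in \<open>auto simp: W_def fun_eq_iff\<close>)
  define GD where "GD = {f \<in> carrier W. gd f}"
  have GD: "subgroup GD W"
    by (rule W.subgroupI) (use gd0 gd_add gd_neg Winv in \<open>auto simp: GD_def W_def\<close>)
  then interpret N: normal GD W by (rule W.subgroup_imp_normal)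
  have coset_eq: "GD #>\<^bsub>W\<^esub> f = GD #>\<^bsub>W\<^esub> g \<longleftrightarrow> gd (\<lambda>q. f q - g q)" if "f \<in> carrier W" "g \<in> carrier W" for f g
  proof
    assume "GD #>\<^bsub>W\<^esub> f = GD #>\<^bsub>W\<^esub> g"
    then have "f \<in> GD #>\<^bsub>W\<^esub> g" using W.rcos_self[OF that(1) GD] by simp
    then obtain h where "h \<in> GD" "f = h \<otimes>\<^bsub>W\<^esub> g" by (auto simp: r_coset_def)
    then show "gd (\<lambda>q. f q - g q)" by (simp add: GD_def W_def)
  next
    assume g: "gd (\<lambda>q. f q - g q)"
    have "(\<lambda>q. f q - g q) \<in> GD" using g that by (simp add: GD_def W_def)
    moreover have "f = (\<lambda>q. f q - g q) \<otimes>\<^bsub>W\<^esub> g" by (simp add: W_def)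
    ultimately have "f \<in> GD #>\<^bsub>W\<^esub> g" unfolding r_coset_def by blast
    then show "GD #>\<^bsub>W\<^esub> f = GD #>\<^bsub>W\<^esub> g" using W.repr_independence[OF _ that(2) GD] by metis
  qed
  let ?X = "W Mod GD"
  have X: "group ?X" by (rule N.factorgroup_is_group)
  have finX: "finite (carrier ?X)"
  proof -
    let ?R = "{f \<in> carrier W. \<forall>q. f q \<in> {0..<int p}}"
    have "carrier ?X \<subseteq> (\<lambda>f. GD #>\<^bsub>W\<^esub> f) ` ?R"
    proof
      fix C assume "C \<in> carrier ?X"
      then obtain f where f: "f \<in> carrier W" "C = GD #>\<^bsub>W\<^esub> f" by (auto simp: carrier_FactGroup)
      let ?g = "\<lambda>q. f q mod int p"
      have "?g \<in> ?R" using f p by (auto simp: W_def prime_gt_0_nat)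
      moreover have "gd (\<lambda>q. f q - ?g q)"
        by (rule gd_cong[OF gd0]) (simp add: minus_mod_eq_mult_div)
      ultimately show "C \<in> (\<lambda>f. GD #>\<^bsub>W\<^esub> f) ` ?R" using coset_eq[OF f(1), of ?g] f(2) by blast
    qed
    moreover have "finite ?R"
    proof (rule finite_subset)
      show "?R \<subseteq> {f. \<forall>q. (q \<in> carrier Q \<longrightarrow> f q \<in> {0..<int p}) \<and> (q \<notin> carrier Q \<longrightarrow> f q = 0)}"
        by (auto simp: W_def)
    qed (rule finite_set_of_finite_funs, use finQ in auto)
    ultimately show ?thesis by (meson finite_imageI finite_subset)
  qed
  have Wpow: "f [^]\<^bsub>W\<^esub> (n::nat) = (\<lambda>q. int n * f q)" if "f \<in> carrier W" for f n
    by (induction n) (auto simp: W_def algebra_simps)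
  have "\<exists>k. order ?X = p ^ k"
  proof (rule order_prime_power_of_exponent[OF X finX p, where r = 1])
    fix C assume "C \<in> carrier ?X"
    then obtain f where f: "f \<in> carrier W" "C = GD #>\<^bsub>W\<^esub> f" by (auto simp: carrier_FactGroup)
    have "C [^]\<^bsub>?X\<^esub> p = GD #>\<^bsub>W\<^esub> (f [^]\<^bsub>W\<^esub> p)"
      using group_hom.hom_nat_pow[of W ?X "\<lambda>x. GD #>\<^bsub>W\<^esub> x" f p] f X N.r_coset_hom_Mod W.is_group
      by (simp add: group_hom_def group_hom_axioms_def)
    also have "\<dots> = GD #>\<^bsub>W\<^esub> \<one>\<^bsub>W\<^esub>"
      using coset_eq[of "f [^]\<^bsub>W\<^esub> p" "\<one>\<^bsub>W\<^esub>"] f(1) gd_p by (simp add: Wpow) (simp add: W_def)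
    also have "\<dots> = \<one>\<^bsub>?X\<^esub>" using N.subset by (simp add: FactGroup_def W.coset_mult_one)
    finally show "C [^]\<^bsub>?X\<^esub> (p ^ 1 :: nat) = \<one>\<^bsub>?X\<^esub>" by simp
  qed
  then obtain k where k: "card (carrier ?X) = p ^ k" by (auto simp: order_def)
  define T where "T a f = (\<lambda>q. if q \<in> carrier Q then left_translate Q a f q else 0)" for a and f :: "'a \<Rightarrow> int"
  have TW: "T a f \<in> carrier W" for a f by (simp add: T_def W_def)
  have T_gd: "gd (T a f) \<longleftrightarrow> gd (left_translate Q a f)" for a f
    using gd_cong[of "left_translate Q a f" "T a f"] gd_cong[of "T a f" "left_translate Q a f"] by (auto simp: T_def)
  have T_coset: "GD #>\<^bsub>W\<^esub> T a f = GD #>\<^bsub>W\<^esub> T a g" if "a \<in> carrier Q" "f \<in> carrier W" "g \<in> carrier W" "GD #>\<^bsub>W\<^esub> f = GD #>\<^bsub>W\<^esub> g" for a f g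
  proof -
    have "gd (left_translate Q a (\<lambda>q. f q - g q))" using gd_trans coset_eq that by blast
    then have "gd (\<lambda>q. T a f q - T a g q)" by (rule gd_cong) (simp add: T_def left_translate_def)
    then show ?thesis using coset_eq TW by blast
  qed
  define act where "act a C = GD #>\<^bsub>W\<^esub> T a (SOME f. f \<in> carrier W \<and> C = GD #>\<^bsub>W\<^esub> f)" for a C
  have act: "act a (GD #>\<^bsub>W\<^esub> f) = GD #>\<^bsub>W\<^esub> T a f" if "a \<in> carrier Q" "f \<in> carrier W" for a f
  proof -
    let ?f = "SOME f'. f' \<in> carrier W \<and> GD #>\<^bsub>W\<^esub> f = GD #>\<^bsub>W\<^esub> f'"
    have "?f \<in> carrier W \<and> GD #>\<^bsub>W\<^esub> f = GD #>\<^bsub>W\<^esub> ?f" by (rule someI[where P = "\<lambda>f'. f' \<in> carrier W \<and> GD #>\<^bsub>W\<^esub> f = GD #>\<^bsub>W\<^esub> f'" and x = f]) (use that in simp)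
    then show ?thesis unfolding act_def using T_coset[OF that(1), of ?f f] that by metis
  qed
  have Tm: "T (a \<otimes>\<^bsub>Q\<^esub> b) f = T a (T b f)" if "a \<in> carrier Q" "b \<in> carrier Q" for a b f
    using that by (auto simp: T_def left_translate_def fun_eq_iff Q.inv_mult_group Q.m_assoc)
  have "int p dvd (\<Sum>C\<in>carrier ?X. 1) - (\<Sum>C | C \<in> carrier ?X \<and> (\<forall>a\<in>carrier Q. act a C = C). 1)"
  proof (rule fixed_points_mod_p[OF Q o p finX])
    fix a b C assume a: "a \<in> carrier Q" and "C \<in> carrier ?X"
    then obtain f where f: "f \<in> carrier W" "C = GD #>\<^bsub>W\<^esub> f" by (auto simp: carrier_FactGroup)
    show "act a C \<in> carrier ?X" using f act[OF a] TW by (auto simp: carrier_FactGroup)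
    assume b: "b \<in> carrier Q"
    show "act (a \<otimes>\<^bsub>Q\<^esub> b) C = act a (act b C)" using f a b act TW Tm by simp
  next
    fix C assume "C \<in> carrier ?X"
    then obtain f where f: "f \<in> carrier W" "C = GD #>\<^bsub>W\<^esub> f" by (auto simp: carrier_FactGroup)
    have "T \<one>\<^bsub>Q\<^esub> f = f" using f(1) by (auto simp: T_def left_translate_def W_def fun_eq_iff)
    then show "act \<one>\<^bsub>Q\<^esub> C = C" using f act by simp
  qed simp
  moreover have "{C \<in> carrier ?X. \<forall>a\<in>carrier Q. act a C = C} = {\<one>\<^bsub>?X\<^esub>}"
  proof (intro equalityI subsetI)
    fix C assume C: "C \<in> {C \<in> carrier ?X. \<forall>a\<in>carrier Q. act a C = C}"
    then obtain f where f: "f \<in> carrier W" "C = GD #>\<^bsub>W\<^esub> f" by (auto simp: carrier_FactGroup)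
    have "gd f"
    proof (rule gd_step)
      fix a assume a: "a \<in> carrier Q"
      then have "GD #>\<^bsub>W\<^esub> T a f = GD #>\<^bsub>W\<^esub> f" using C f act by auto
      then have "gd (\<lambda>q. T a f q - f q)" using coset_eq TW f by blast
      then show "gd (\<lambda>q. left_translate Q a f q - f q)" by (rule gd_cong) (simp add: T_def)
    qed
    then have "f \<in> GD" using f(1) unfolding GD_def by blast
    then show "C \<in> {\<one>\<^bsub>?X\<^esub>}" using f W.coset_join2[OF f(1) GD] by (simp add: FactGroup_def)
  next
    fix C assume "C \<in> {\<one>\<^bsub>?X\<^esub>}"
    then have C: "C = GD #>\<^bsub>W\<^esub> \<one>\<^bsub>W\<^esub>" using N.subset by (simp add: FactGroup_def W.coset_mult_one)
    have "T a \<one>\<^bsub>W\<^esub> = \<one>\<^bsub>W\<^esub>" for a by (auto simp: T_def left_translate_def W_def)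
    then show "C \<in> {C \<in> carrier ?X. \<forall>a\<in>carrier Q. act a C = C}" using C act by (auto simp: carrier_FactGroup)
  qed
  ultimately have "int p dvd int (p ^ k) - 1" using k by simp
  have "k = 0"
  proof (rule ccontr)
    assume "k \<noteq> 0"
    then have "int p dvd int (p ^ k)" by simp
    then have "int p dvd int (p ^ k) - (int (p ^ k) - 1)" using \<open>int p dvd int (p ^ k) - 1\<close> by (rule dvd_diff)
    then show False using p by (simp add: prime_gt_1_nat)
  qed
  then have "card (carrier ?X) = 1" using k by simp
  then have all: "gd f" if "f \<in> carrier W" for f
  proof -
    obtain Z where "carrier ?X = {Z}" using \<open>card (carrier ?X) = 1\<close> by (rule card_1_singletonE)
    then have "(\<lambda>f. GD #>\<^bsub>W\<^esub> f) ` carrier W = {Z}" by (simp add: carrier_FactGroup)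
    then have "GD #>\<^bsub>W\<^esub> f = Z" "GD #>\<^bsub>W\<^esub> \<one>\<^bsub>W\<^esub> = Z" using that W.one_closed by blast+
    then have "GD #>\<^bsub>W\<^esub> f = GD #>\<^bsub>W\<^esub> \<one>\<^bsub>W\<^esub>" by simp
    then show ?thesis using coset_eq[OF that W.one_closed] by (simp add: W_def)
  qed
  have "gd f" by (rule gd_cong[OF all[of "\<lambda>q. if q \<in> carrier Q then f q else 0"]]) (auto simp: W_def)
  then show ?thesis unfolding gd_def ann_def .
qed

section \<open>Torsion-free nilpotent quotients from a central filtration\<close>

lemma (in group) coset_eq_iff:
  assumes "subgroup N G" "x \<in> carrier G" "y \<in> carrier G"
  shows "N #> x = N #> y \<longleftrightarrow> x \<otimes> inv y \<in> N"
proof -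
  have "x \<in> N #> y \<longleftrightarrow> x \<otimes> inv y \<in> N"
  proof
    assume "x \<in> N #> y"
    then obtain n where n: "n \<in> N" "x = n \<otimes> y" by (auto simp: r_coset_def)
    have "n \<in> carrier G" using n subgroup.subset[OF assms(1)] by blast
    then show "x \<otimes> inv y \<in> N" using n assms by (simp add: m_assoc)
  next
    assume "x \<otimes> inv y \<in> N"
    moreover have "x = x \<otimes> inv y \<otimes> y" using assms by (simp add: m_assoc)
    ultimately show "x \<in> N #> y" unfolding r_coset_def by blast
  qed
  moreover have "N #> x = N #> y \<longleftrightarrow> x \<in> N #> y"
    using rcos_self[OF assms(2,1)] repr_independence[OF _ assms(3,1)] by metis
  ultimately show ?thesis by blast
qed

lemma (in group) quotient_eq_one:
  assumes x: "x \<in> carrier G" and s: "s \<in> carrier G"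
  shows "inv x \<otimes> s = \<one> \<longleftrightarrow> s = x" "s \<otimes> inv x = \<one> \<longleftrightarrow> s = x"
proof -
  have "s = x \<otimes> (inv x \<otimes> s)" using x s by (simp add: m_assoc[symmetric])
  then show "inv x \<otimes> s = \<one> \<longleftrightarrow> s = x" using x by auto
  have "s = (s \<otimes> inv x) \<otimes> x" using x s by (simp add: m_assoc)
  then show "s \<otimes> inv x = \<one> \<longleftrightarrow> s = x" using x by auto
qed

lemma (in group) FactGroup_pow:
  assumes "N \<lhd> G" "x \<in> carrier G"
  shows "(N #> x) [^]\<^bsub>G Mod N\<^esub> (n::nat) = N #> (x [^] n)"
proof -
  interpret N: normal N G by (rule assms)
  have "group_hom G (G Mod N) (\<lambda>a. N #> a)"
    using N.r_coset_hom_Mod N.factorgroup_is_group by (simp add: group_hom_def group_hom_axioms_def)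
  from group_hom.hom_nat_pow[OF this assms(2)] show ?thesis by simp
qed

text \<open>The \<open>N k\<close> are normal and \<open>T / N k\<close> is nilpotent by the commutator condition.  It is torsion-free, as
  a root of an element of \<open>N k\<close> descends through the filtration one prime and one step at a time.\<close>

lemma residually_torsion_free_nilpotentI:
  fixes T :: "('t, 'm) monoid_scheme" and N :: "nat \<Rightarrow> 't set"
  assumes T: "group T" and sub: "\<And>k. subgroup (N k) T" and N0: "N 0 = carrier T"
    and dec: "\<And>k. N (Suc k) \<subseteq> N k"
    and comm: "\<And>k x y. x \<in> N k \<Longrightarrow> y \<in> carrier T \<Longrightarrow>
        x \<otimes>\<^bsub>T\<^esub> y \<otimes>\<^bsub>T\<^esub> inv\<^bsub>T\<^esub> x \<otimes>\<^bsub>T\<^esub> inv\<^bsub>T\<^esub> y \<in> N (Suc k)"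
    and tors: "\<And>k q x. x \<in> N k \<Longrightarrow> prime (q::nat) \<Longrightarrow> x [^]\<^bsub>T\<^esub> q \<in> N (Suc k) \<Longrightarrow> x \<in> N (Suc k)"
    and sep: "\<And>x. x \<in> carrier T \<Longrightarrow> (\<And>k. x \<in> N k) \<Longrightarrow> x = \<one>\<^bsub>T\<^esub>"
  shows "residually_torsion_free_nilpotent T"
proof -
  interpret T: group T by (rule T)
  have NT: "x \<in> N k \<Longrightarrow> x \<in> carrier T" for x k using subgroup.subset[OF sub] by blast
  have dec': "j \<le> k \<Longrightarrow> N k \<subseteq> N j" for j k using dec by (rule lift_Suc_antimono_le)
  have normal: "N k \<lhd> T" for k unfolding T.normal_inv_iff
  proof (intro conjI ballI sub)
    fix y x assume y: "y \<in> carrier T" and x: "x \<in> N k"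
    note xT = NT[OF x]
    have ix: "inv\<^bsub>T\<^esub> x \<in> N k" using subgroup.m_inv_closed[OF sub x] .
    have "inv\<^bsub>T\<^esub> x \<otimes>\<^bsub>T\<^esub> y \<otimes>\<^bsub>T\<^esub> inv\<^bsub>T\<^esub> (inv\<^bsub>T\<^esub> x) \<otimes>\<^bsub>T\<^esub> inv\<^bsub>T\<^esub> y \<in> N k"
      using comm[OF ix y] dec by blast
    then have "x \<otimes>\<^bsub>T\<^esub> (inv\<^bsub>T\<^esub> x \<otimes>\<^bsub>T\<^esub> y \<otimes>\<^bsub>T\<^esub> inv\<^bsub>T\<^esub> (inv\<^bsub>T\<^esub> x) \<otimes>\<^bsub>T\<^esub> inv\<^bsub>T\<^esub> y) \<in> N k"
      using subgroup.m_closed[OF sub x] by blast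
    moreover have "x \<otimes>\<^bsub>T\<^esub> (inv\<^bsub>T\<^esub> x \<otimes>\<^bsub>T\<^esub> y \<otimes>\<^bsub>T\<^esub> inv\<^bsub>T\<^esub> (inv\<^bsub>T\<^esub> x) \<otimes>\<^bsub>T\<^esub> inv\<^bsub>T\<^esub> y) = y \<otimes>\<^bsub>T\<^esub> x \<otimes>\<^bsub>T\<^esub> inv\<^bsub>T\<^esub> y"
      using xT y by (simp add: T.m_assoc) (simp add: T.m_assoc[symmetric])
    ultimately show "y \<otimes>\<^bsub>T\<^esub> x \<otimes>\<^bsub>T\<^esub> inv\<^bsub>T\<^esub> y \<in> N k" by simp
  qed
  have root_prime: "y \<in> N k" if y: "y \<in> carrier T" "prime q" "y [^]\<^bsub>T\<^esub> (q::nat) \<in> N k" for y q k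
  proof -
    have "j \<le> k \<Longrightarrow> y \<in> N j" for j
    proof (induction j)
      case 0 then show ?case using y N0 by simp
    next
      case (Suc j)
      then show ?case using tors[of y j q] y dec'[of "Suc j" k] by auto
    qed
    then show ?thesis by simp
  qed
  have root: "x \<in> carrier T \<Longrightarrow> 0 < n \<Longrightarrow> x [^]\<^bsub>T\<^esub> n \<in> N k \<Longrightarrow> x \<in> N k" for x k and n :: nat
  proof (induction n rule: less_induct)
    case (less n)
    show ?case
    proof (cases "n = 1")
      case True then show ?thesis using less.prems by simp
    next
      case False
      then obtain q where q: "prime q" "q dvd n" using prime_factor_nat by blast
      then obtain m where m: "n = m * q" by (metis dvd_def mult.commute)
      have "(x [^]\<^bsub>T\<^esub> m) [^]\<^bsub>T\<^esub> q \<in> N k" using less.prems m by (simp add: T.nat_pow_pow)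
      then have "x [^]\<^bsub>T\<^esub> m \<in> N k" using root_prime q(1) less.prems(1) by (meson T.nat_pow_closed)
      moreover have "m < n" "0 < m" using m less.prems(2) prime_gt_1_nat[OF q(1)] by auto
      ultimately show ?thesis using less.IH less.prems(1) by blast
    qed
  qed
  show ?thesis unfolding residually_torsion_free_nilpotent_def
  proof (intro conjI T ballI impI)
    fix x assume x: "x \<in> carrier T" "x \<noteq> \<one>\<^bsub>T\<^esub>"
    then obtain k where k: "x \<notin> N k" using sep by blast
    interpret Nk: normal "N k" T by (rule normal)
    let ?Q = "T Mod N k"
    let ?c = "\<lambda>x. N k #>\<^bsub>T\<^esub> x"
    have Q: "group ?Q" by (rule Nk.factorgroup_is_group)
    interpret h: group_hom T ?Q ?c
      using Nk.r_coset_hom_Mod Q T by (simp add: group_hom_def group_hom_axioms_def)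
    have c1: "?c z = \<one>\<^bsub>?Q\<^esub> \<longleftrightarrow> z \<in> N k" if "z \<in> carrier T" for z
      using T.coset_join1[OF _ that sub] T.coset_join2[OF that sub] Nk.subset by auto
    have "torsion_free_group ?Q" unfolding torsion_free_group_def
    proof (intro conjI Q ballI allI impI)
      fix C and n :: nat assume C: "C \<in> carrier ?Q" and n: "n > 0" "C [^]\<^bsub>?Q\<^esub> n = \<one>\<^bsub>?Q\<^esub>"
      obtain z where z: "z \<in> carrier T" "C = ?c z" using C by (auto simp: carrier_FactGroup)
      have "?c (z [^]\<^bsub>T\<^esub> n) = \<one>\<^bsub>?Q\<^esub>" using n(2) z T.FactGroup_pow[OF normal z(1)] by simp
      then have "z [^]\<^bsub>T\<^esub> n \<in> N k" using c1 z by simp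
      then have "z \<in> N k" using root z n by blast
      then show "C = \<one>\<^bsub>?Q\<^esub>" using c1 z by simp
    qed
    moreover have "nilpotent_group ?Q" unfolding nilpotent_group_def
    proof (intro conjI Q exI)
      have "lower_central ?Q j \<subseteq> ?c ` N j" for j
      proof (induction j)
        case 0 show ?case by (simp add: N0 carrier_FactGroup)
      next
        case (Suc j)
        have "subgroup (?c ` N (Suc j)) ?Q" by (rule h.subgroup_img_is_subgroup[OF sub])
        moreover have "{x \<otimes>\<^bsub>?Q\<^esub> y \<otimes>\<^bsub>?Q\<^esub> inv\<^bsub>?Q\<^esub> x \<otimes>\<^bsub>?Q\<^esub> inv\<^bsub>?Q\<^esub> y |x y. x \<in> lower_central ?Q j \<and> y \<in> carrier ?Q} \<subseteq> ?c ` N (Suc j)"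
        proof (rule subsetI, elim CollectE exE conjE)
          fix z X Y assume z: "z = X \<otimes>\<^bsub>?Q\<^esub> Y \<otimes>\<^bsub>?Q\<^esub> inv\<^bsub>?Q\<^esub> X \<otimes>\<^bsub>?Q\<^esub> inv\<^bsub>?Q\<^esub> Y"
            and X: "X \<in> lower_central ?Q j" and Y: "Y \<in> carrier ?Q"
          obtain x where x: "x \<in> N j" "X = ?c x" using X Suc by blast
          obtain y where y: "y \<in> carrier T" "Y = ?c y" using Y by (auto simp: carrier_FactGroup)
          have "z = ?c (x \<otimes>\<^bsub>T\<^esub> y \<otimes>\<^bsub>T\<^esub> inv\<^bsub>T\<^esub> x \<otimes>\<^bsub>T\<^esub> inv\<^bsub>T\<^esub> y)"
            unfolding z x(2) y(2) using NT[OF x(1)] y(1) by (simp only: h.hom_mult h.hom_inv T.m_closed T.inv_closed)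
          then show "z \<in> ?c ` N (Suc j)" using comm[OF x(1) y(1)] by blast
        qed
        ultimately show ?case using group.generate_subgroup_incl[OF Q] by simp
      qed
      then have "lower_central ?Q k \<subseteq> {\<one>\<^bsub>?Q\<^esub>}" using c1 NT by blast
      moreover have "\<one>\<^bsub>?Q\<^esub> \<in> lower_central ?Q j" for j
        by (cases j) (simp_all add: generate.one monoid.one_closed[OF group.is_monoid[OF Q]] del: one_FactGroup)
      ultimately show "lower_central ?Q k = {\<one>\<^bsub>?Q\<^esub>}" by blast
    qed
    moreover have "?c x \<noteq> \<one>\<^bsub>?Q\<^esub>" using c1 x k by blast
    ultimately show "\<exists>N. N \<lhd> T \<and> torsion_free_group (T Mod N) \<and> nilpotent_group (T Mod N) \<and> N #>\<^bsub>T\<^esub> x \<noteq> \<one>\<^bsub>T Mod N\<^esub>"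
      using normal by blast
  qed
qed

section \<open>Groups given by a presentation\<close>

lemma pres_eq_lists: "pres_eq S R v w \<Longrightarrow> v \<in> lists (S \<times> UNIV) \<and> w \<in> lists (S \<times> UNIV)"
  by (induction rule: pres_eq.induct) auto

lemma pres_eq_context:
  assumes "pres_eq S R v w" "x \<in> lists (S \<times> UNIV)" "y \<in> lists (S \<times> UNIV)"
  shows "pres_eq S R (x @ v @ y) (x @ w @ y)"
  using assms
proof (induction rule: pres_eq.induct)
  case (refl w) then show ?case by (intro pres_eq.refl) auto
next
  case (sym v w) then show ?case by (blast intro: pres_eq.sym)
next
  case (trans u v w) then show ?case by (blast intro: pres_eq.trans)
next
  case (cancel u v s b)
  have "pres_eq S R ((x @ u) @ [(s, b), (s, \<not> b)] @ (v @ y)) ((x @ u) @ (v @ y))"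
    by (rule pres_eq.cancel) (use cancel in auto)
  then show ?case by simp
next
  case (relator u v r)
  have "pres_eq S R ((x @ u) @ r @ (v @ y)) ((x @ u) @ (v @ y))"
    by (rule pres_eq.relator) (use relator in auto)
  then show ?case by simp
qed

lemma pres_eq_append:
  assumes "pres_eq S R v v'" "pres_eq S R w w'" shows "pres_eq S R (v @ w) (v' @ w')"
proof (rule pres_eq.trans)
  show "pres_eq S R (v @ w) (v' @ w)"
    using pres_eq_context[OF assms(1), of "[]" w] pres_eq_lists[OF assms(2)] by simp
  show "pres_eq S R (v' @ w) (v' @ w')"
    using pres_eq_context[OF assms(2), of v' "[]"] pres_eq_lists[OF assms(1)] by simp
qed

definition word_class :: "'a set \<Rightarrow> 'a word set \<Rightarrow> 'a word \<Rightarrow> 'a word set" where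
  "word_class S R w = pres_rel S R `` {w}"

lemma in_word_class: "v \<in> word_class S R w \<longleftrightarrow> pres_eq S R w v" by (simp add: word_class_def pres_rel_def)

lemma word_class_eq: "pres_eq S R v w \<Longrightarrow> word_class S R v = word_class S R w"
  unfolding set_eq_iff in_word_class by (meson pres_eq.trans pres_eq.sym)

lemma carrier_presented: "carrier (presented_group S R) = word_class S R ` lists (S \<times> UNIV)"
  by (auto simp: presented_group_def quotient_def word_class_def)

lemma one_presented: "\<one>\<^bsub>presented_group S R\<^esub> = word_class S R []"
  by (simp add: presented_group_def word_class_def)

lemma mult_presented:
  assumes "v \<in> lists (S \<times> UNIV)" "w \<in> lists (S \<times> UNIV)"
  shows "word_class S R v \<otimes>\<^bsub>presented_group S R\<^esub> word_class S R w = word_class S R (v @ w)"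
proof -
  have "(\<Union>x\<in>word_class S R v. \<Union>y\<in>word_class S R w. word_class S R (x @ y)) = word_class S R (v @ w)"
  proof (intro equalityI subsetI)
    fix z assume "z \<in> (\<Union>x\<in>word_class S R v. \<Union>y\<in>word_class S R w. word_class S R (x @ y))"
    then obtain x y where xy: "pres_eq S R v x" "pres_eq S R w y" "pres_eq S R (x @ y) z"
      by (auto simp: in_word_class)
    then show "z \<in> word_class S R (v @ w)" unfolding in_word_class by (blast intro: pres_eq.trans pres_eq_append)
  next
    fix z assume z: "z \<in> word_class S R (v @ w)"
    have "v \<in> word_class S R v" "w \<in> word_class S R w" using assms by (simp_all only: in_word_class pres_eq.refl)
    then show "z \<in> (\<Union>x\<in>word_class S R v. \<Union>y\<in>word_class S R w. word_class S R (x @ y))"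
      by (intro UN_I[of v] UN_I[of w] z)
  qed
  then show ?thesis by (simp add: presented_group_def word_class_def)
qed

definition letter_inv :: "'a \<times> bool \<Rightarrow> 'a \<times> bool" where "letter_inv l = (fst l, \<not> snd l)"

lemma letter_inv_pair: "letter_inv (s, b) = (s, \<not> b)" by (simp add: letter_inv_def)

lemma word_inverse:
  "w \<in> lists (S \<times> UNIV) \<Longrightarrow> pres_eq S R (rev (map letter_inv w) @ w) []"
proof (induction w)
  case Nil then show ?case by (auto intro: pres_eq.refl)
next
  case (Cons l w)
  obtain s b where l: "l = (s, b)" by (cases l)
  have s: "s \<in> S" and w: "w \<in> lists (S \<times> UNIV)" using Cons.prems l by auto
  have iw: "rev (map letter_inv w) \<in> lists (S \<times> UNIV)" using w by (auto simp: letter_inv_def in_lists_conv_set)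
  have "pres_eq S R (rev (map letter_inv w) @ [(s, \<not> b), (s, \<not> \<not> b)] @ w) (rev (map letter_inv w) @ w)"
    by (rule pres_eq.cancel[OF iw w s])
  from pres_eq.trans[OF this Cons.IH[OF w]] show ?case by (simp add: l letter_inv_pair)
qed

lemma group_presented: "group (presented_group S R)"
proof (rule groupI)
  let ?A = "presented_group S R"
  let ?L = "lists (S \<times> (UNIV :: bool set))"
  show "\<one>\<^bsub>?A\<^esub> \<in> carrier ?A" by (auto simp: carrier_presented one_presented)
  fix x assume "x \<in> carrier ?A"
  then obtain v where v: "v \<in> ?L" "x = word_class S R v" by (auto simp: carrier_presented)
  show "\<one>\<^bsub>?A\<^esub> \<otimes>\<^bsub>?A\<^esub> x = x" using v mult_presented[of "[]" S v R] by (simp add: one_presented)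
  have "rev (map letter_inv v) \<in> ?L" using v by (auto simp: letter_inv_def in_lists_conv_set)
  then show "\<exists>y\<in>carrier ?A. y \<otimes>\<^bsub>?A\<^esub> x = \<one>\<^bsub>?A\<^esub>"
    using v mult_presented[of "rev (map letter_inv v)" S v R] word_class_eq[OF word_inverse[OF v(1)]]
    by (auto simp: carrier_presented one_presented)
  fix y assume "y \<in> carrier ?A"
  then obtain w where w: "w \<in> ?L" "y = word_class S R w" by (auto simp: carrier_presented)
  have vw: "v @ w \<in> ?L" using v w by auto
  show "x \<otimes>\<^bsub>?A\<^esub> y \<in> carrier ?A"
    unfolding v(2) w(2) mult_presented[OF v(1) w(1)] carrier_presented by (rule imageI[OF vw])
  fix z assume "z \<in> carrier ?A"
  then obtain u where u: "u \<in> ?L" "z = word_class S R u" by (auto simp: carrier_presented)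
  have wu: "w @ u \<in> ?L" using u w by auto
  show "x \<otimes>\<^bsub>?A\<^esub> y \<otimes>\<^bsub>?A\<^esub> z = x \<otimes>\<^bsub>?A\<^esub> (y \<otimes>\<^bsub>?A\<^esub> z)"
    using u v w mult_presented[OF v(1) w(1), of R] mult_presented[OF vw u(1), of R]
      mult_presented[OF w(1) u(1), of R] mult_presented[OF v(1) wu, of R] by simp
qed

lemma presented_generate:
  "carrier (presented_group S R) = generate (presented_group S R) ((\<lambda>s. word_class S R [(s, True)]) ` S)"
proof -
  let ?A = "presented_group S R"
  let ?g = "\<lambda>s. word_class S R [(s, True)]"
  interpret A: group ?A by (rule group_presented)
  have gA: "?g ` S \<subseteq> carrier ?A" by (auto simp: carrier_presented)
  have letter: "word_class S R [(s, b)] \<in> generate ?A (?g ` S)" if s: "s \<in> S" for s b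
  proof (cases b)
    case True then show ?thesis using s by (auto intro: generate.incl)
  next
    case False
    have "pres_eq S R ([] @ [(s, False), (s, \<not> False)] @ []) ([] @ [])" by (rule pres_eq.cancel) (use s in auto)
    then have e: "word_class S R [(s, False), (s, True)] = word_class S R []" by (intro word_class_eq) simp
    then have "word_class S R [(s, False)] \<otimes>\<^bsub>?A\<^esub> ?g s = \<one>\<^bsub>?A\<^esub>"
      using s by (subst mult_presented) (simp_all add: one_presented)
    then have "inv\<^bsub>?A\<^esub> (?g s) = word_class S R [(s, False)]"
      by (rule A.inv_equality) (use s in \<open>auto simp: carrier_presented\<close>)
    then show ?thesis using generate.inv[of "?g s" "?g ` S" ?A] s False by auto
  qed
  have "w \<in> lists (S \<times> UNIV) \<Longrightarrow> word_class S R w \<in> generate ?A (?g ` S)" for w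
  proof (induction w)
    case Nil then show ?case using generate.one[of ?A] by (simp add: one_presented)
  next
    case (Cons l w)
    obtain s b where l: "l = (s, b)" by (cases l)
    have "word_class S R [l] \<otimes>\<^bsub>?A\<^esub> word_class S R w = word_class S R (l # w)"
      using Cons.prems by (subst mult_presented) auto
    then show ?case using generate.eng[OF letter[of s b] Cons.IH] Cons.prems l by auto
  qed
  then show ?thesis using A.generate_incl[OF gA] by (auto simp: carrier_presented)
qed

section \<open>The pro-p completion as a topological group\<close>

locale pro_p = A: group A for A :: "('c, 'm) monoid_scheme" + fixes p :: nat assumes p: "prime p"
begin

abbreviation "P \<equiv> p_power_index_normal p A"
abbreviation "PG \<equiv> pro_p_completion p A"
abbreviation "PT \<equiv> pro_p_topology p A"

lemma P_normal: "N \<in> P \<Longrightarrow> N \<lhd> A" by (simp add: p_power_index_normal_def)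
lemma P_group: "N \<in> P \<Longrightarrow> group (A Mod N)" using normal.factorgroup_is_group[OF P_normal] .
lemma P_subgroup: "N \<in> P \<Longrightarrow> subgroup N A" using normal_imp_subgroup[OF P_normal] .
lemma P_order: "N \<in> P \<Longrightarrow> \<exists>k. order (A Mod N) = p ^ k" by (simp add: p_power_index_normal_def)
lemma P_finite: "N \<in> P \<Longrightarrow> finite (carrier (A Mod N))"
  using P_order[of N] p by (metis card_ge_0_finite order_def prime_gt_0_nat zero_less_power)

lemma P_I:
  assumes "N \<lhd> A" "finite (carrier (A Mod N))" "\<And>x. x \<in> carrier A \<Longrightarrow> x [^]\<^bsub>A\<^esub> (p ^ r :: nat) \<in> N"
  shows "N \<in> P"
proof -
  have "\<exists>k. order (A Mod N) = p ^ k"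
  proof (rule order_prime_power_of_exponent[OF normal.factorgroup_is_group[OF assms(1)] assms(2) p])
    fix C assume "C \<in> carrier (A Mod N)"
    then obtain x where x: "x \<in> carrier A" "C = N #>\<^bsub>A\<^esub> x" by (auto simp: carrier_FactGroup)
    show "C [^]\<^bsub>A Mod N\<^esub> (p ^ r :: nat) = \<one>\<^bsub>A Mod N\<^esub>"
      using A.coset_join2[OF _ normal_imp_subgroup[OF assms(1)] assms(3)[OF x(1)]] x
      by (simp add: A.FactGroup_pow[OF assms(1)])
  qed
  then show ?thesis using assms(1) by (simp add: p_power_index_normal_def)
qed

lemma P_pow: assumes "N \<in> P" shows "\<exists>k. \<forall>x\<in>carrier A. x [^]\<^bsub>A\<^esub> (p ^ k :: nat) \<in> N"
proof -
  obtain k where k: "order (A Mod N) = p ^ k" using P_order[OF assms] by blast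
  have "x [^]\<^bsub>A\<^esub> (p ^ k :: nat) \<in> N" if x: "x \<in> carrier A" for x
  proof -
    have c: "N #>\<^bsub>A\<^esub> x \<in> carrier (A Mod N)" using x by (auto simp: carrier_FactGroup)
    have "(N #>\<^bsub>A\<^esub> x) [^]\<^bsub>A Mod N\<^esub> order (A Mod N) = \<one>\<^bsub>A Mod N\<^esub>"
      by (rule group.pow_order_eq_1[OF P_group[OF assms] c])
    then have "N #>\<^bsub>A\<^esub> (x [^]\<^bsub>A\<^esub> (p ^ k :: nat)) = N"
      using k by (simp add: A.FactGroup_pow[OF P_normal[OF assms] x])
    then show ?thesis using A.coset_join1[OF _ _ P_subgroup[OF assms]] x by simp
  qed
  then show ?thesis by blast
qed

text \<open>The finite \<open>p\<close>-quotients form a directed system.\<close>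

lemma P_Int: assumes N: "N \<in> P" and M: "M \<in> P" shows "N \<inter> M \<in> P"
proof -
  have sub: "subgroup (N \<inter> M) A" using A.subgroups_Inter_pair[OF P_subgroup[OF N] P_subgroup[OF M]] .
  have nrm: "N \<inter> M \<lhd> A"
    using P_normal[OF N] P_normal[OF M] sub unfolding A.normal_inv_iff by blast
  obtain k where k: "\<And>x. x \<in> carrier A \<Longrightarrow> x [^]\<^bsub>A\<^esub> (p ^ k :: nat) \<in> N" using P_pow[OF N] by blast
  obtain l where l: "\<And>x. x \<in> carrier A \<Longrightarrow> x [^]\<^bsub>A\<^esub> (p ^ l :: nat) \<in> M" using P_pow[OF M] by blast
  show ?thesis
  proof (rule P_I[OF nrm, where r = "k + l"])
    fix x assume x: "x \<in> carrier A"
    have "x [^]\<^bsub>A\<^esub> (p ^ (k + l) :: nat) = (x [^]\<^bsub>A\<^esub> (p ^ l :: nat)) [^]\<^bsub>A\<^esub> (p ^ k :: nat)"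
      "x [^]\<^bsub>A\<^esub> (p ^ (k + l) :: nat) = (x [^]\<^bsub>A\<^esub> (p ^ k :: nat)) [^]\<^bsub>A\<^esub> (p ^ l :: nat)"
      using x by (simp_all add: A.nat_pow_pow power_add mult.commute)
    then show "x [^]\<^bsub>A\<^esub> (p ^ (k + l) :: nat) \<in> N \<inter> M" using k[of "x [^]\<^bsub>A\<^esub> (p ^ l :: nat)"] l[of "x [^]\<^bsub>A\<^esub> (p ^ k :: nat)"] x by simp
  next
    have "carrier (A Mod (N \<inter> M)) \<subseteq> (\<lambda>(C, D). C \<inter> D) ` (carrier (A Mod N) \<times> carrier (A Mod M))"
    proof
      fix C assume "C \<in> carrier (A Mod (N \<inter> M))"
      then obtain x where x: "x \<in> carrier A" "C = (N \<inter> M) #>\<^bsub>A\<^esub> x" by (auto simp: carrier_FactGroup)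
      have "C = (N #>\<^bsub>A\<^esub> x) \<inter> (M #>\<^bsub>A\<^esub> x)"
      proof (intro equalityI subsetI)
        fix y assume "y \<in> (N #>\<^bsub>A\<^esub> x) \<inter> (M #>\<^bsub>A\<^esub> x)"
        then obtain n m where nm: "n \<in> N" "m \<in> M" "y = n \<otimes>\<^bsub>A\<^esub> x" "y = m \<otimes>\<^bsub>A\<^esub> x" by (auto simp: r_coset_def)
        have "n \<in> carrier A" "m \<in> carrier A" using nm subgroup.subset[OF P_subgroup[OF N]] subgroup.subset[OF P_subgroup[OF M]] by auto
        then have "n = m" using nm(3,4) x(1) by simp
        then show "y \<in> C" using nm x(2) by (auto simp: r_coset_def)
      qed (use x(2) in \<open>auto simp: r_coset_def\<close>)
      then show "C \<in> (\<lambda>(C, D). C \<inter> D) ` (carrier (A Mod N) \<times> carrier (A Mod M))"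
        using x(1) by (auto simp: carrier_FactGroup)
    qed
    then show "finite (carrier (A Mod (N \<inter> M)))"
      using P_finite[OF N] P_finite[OF M] by (meson finite_SigmaI finite_imageI finite_subset)
  qed
qed

lemma P_carrier: "carrier A \<in> P"
proof (rule P_I[where r = 0])
  show "carrier A \<lhd> A" unfolding A.normal_inv_iff using A.subgroup_self by auto
  have "carrier (A Mod carrier A) \<subseteq> {carrier A}"
    using A.coset_join2[OF _ A.subgroup_self] by (auto simp: carrier_FactGroup)
  then show "finite (carrier (A Mod carrier A))" by (rule finite_subset) simp
qed simp

lemma P_finite_lower:
  assumes "finite F" "F \<subseteq> P" shows "\<exists>M\<in>P. \<forall>N\<in>F. M \<subseteq> N"
  using assms
proof (induction F)
  case empty then show ?case using P_carrier by blast
next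
  case (insert N F)
  then obtain M where "M \<in> P" "\<forall>N\<in>F. M \<subseteq> N" by auto
  then show ?case using P_Int[of M N] insert.prems by (intro bexI[of _ "M \<inter> N"]) auto
qed

lemma carrier_PG: "carrier PG = {f \<in> (\<Pi>\<^sub>E N \<in> P. carrier (A Mod N)).
    \<forall>N \<in> P. \<forall>M \<in> P. N \<subseteq> M \<longrightarrow> f M = M <#>\<^bsub>A\<^esub> f N}"
  by (simp add: pro_p_completion_def)

lemma mult_PG: "g \<otimes>\<^bsub>PG\<^esub> h = (\<lambda>N\<in>P. g N <#>\<^bsub>A\<^esub> h N)"
  by (simp add: pro_p_completion_def)

lemma one_PG: "\<one>\<^bsub>PG\<^esub> = (\<lambda>N\<in>P. N)"
  by (simp add: pro_p_completion_def)

lemma PG_PiE: "g \<in> carrier PG \<Longrightarrow> g \<in> (\<Pi>\<^sub>E N \<in> P. carrier (A Mod N))"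
  unfolding carrier_PG by (erule CollectE) (erule conjunct1)

lemma PG_at: "g \<in> carrier PG \<Longrightarrow> N \<in> P \<Longrightarrow> g N \<in> carrier (A Mod N)"
  by (drule PG_PiE) (rule PiE_mem)

lemma PG_extensional: "g \<in> carrier PG \<Longrightarrow> g \<in> extensional P"
  by (drule PG_PiE) (simp add: PiE_iff)

lemma PG_at_coset: "g \<in> carrier PG \<Longrightarrow> N \<in> P \<Longrightarrow> \<exists>c\<in>carrier A. g N = N #>\<^bsub>A\<^esub> c"
  by (drule (1) PG_at) (auto simp: carrier_FactGroup)

lemma PG_compat: "g \<in> carrier PG \<Longrightarrow> N \<in> P \<Longrightarrow> M \<in> P \<Longrightarrow> N \<subseteq> M \<Longrightarrow> g M = M <#>\<^bsub>A\<^esub> g N"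
  unfolding carrier_PG by blast

lemma coset_coarsen:
  assumes "N \<in> P" "M \<in> P" "N \<subseteq> M" "c \<in> carrier A"
  shows "M <#>\<^bsub>A\<^esub> (N #>\<^bsub>A\<^esub> c) = M #>\<^bsub>A\<^esub> c"
proof -
  have N: "N \<subseteq> carrier A" "M \<subseteq> carrier A" using subgroup.subset P_subgroup assms by auto
  have "M <#>\<^bsub>A\<^esub> (N #>\<^bsub>A\<^esub> c) = (M <#>\<^bsub>A\<^esub> N) #>\<^bsub>A\<^esub> c"
    using A.setmult_rcos_assoc[OF N(2,1) assms(4)] .
  also have "M <#>\<^bsub>A\<^esub> N = M"
  proof (intro equalityI subsetI)
    fix x assume "x \<in> M <#>\<^bsub>A\<^esub> N"
    then show "x \<in> M" using subgroup.m_closed[OF P_subgroup[OF assms(2)]] assms(3) by (auto simp: set_mult_def)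
  next
    fix x assume x: "x \<in> M"
    then have "x = x \<otimes>\<^bsub>A\<^esub> \<one>\<^bsub>A\<^esub>" using N by auto
    then show "x \<in> M <#>\<^bsub>A\<^esub> N" using x subgroup.one_closed[OF P_subgroup[OF assms(1)]] unfolding set_mult_def by blast
  qed
  finally show ?thesis .
qed

lemma PG_compat_coset:
  "g \<in> carrier PG \<Longrightarrow> N \<in> P \<Longrightarrow> M \<in> P \<Longrightarrow> N \<subseteq> M \<Longrightarrow> c \<in> carrier A \<Longrightarrow> g N = N #>\<^bsub>A\<^esub> c \<Longrightarrow> g M = M #>\<^bsub>A\<^esub> c"
  by (drule (3) PG_compat) (simp add: coset_coarsen)

lemma PG_eqI: "g \<in> carrier PG \<Longrightarrow> h \<in> carrier PG \<Longrightarrow> (\<And>N. N \<in> P \<Longrightarrow> g N = h N) \<Longrightarrow> g = h"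
  by (rule extensionalityI[OF PG_extensional PG_extensional])

text \<open>Compatibility need only be checked on a common representative.\<close>

lemma PG_I:
  assumes "f \<in> extensional P" "\<And>N. N \<in> P \<Longrightarrow> f N \<in> carrier (A Mod N)"
    "\<And>N M. N \<in> P \<Longrightarrow> M \<in> P \<Longrightarrow> N \<subseteq> M \<Longrightarrow> \<exists>c\<in>carrier A. f N = N #>\<^bsub>A\<^esub> c \<and> f M = M #>\<^bsub>A\<^esub> c"
  shows "f \<in> carrier PG"
proof -
  have "f M = M <#>\<^bsub>A\<^esub> f N" if NM: "N \<in> P" "M \<in> P" "N \<subseteq> M" for N M
  proof -
    obtain c where "c \<in> carrier A" "f N = N #>\<^bsub>A\<^esub> c" "f M = M #>\<^bsub>A\<^esub> c" using assms(3)[OF NM] by blast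
    then show ?thesis using coset_coarsen[OF NM] by simp
  qed
  moreover have "f \<in> (\<Pi>\<^sub>E N \<in> P. carrier (A Mod N))" using assms(1,2) by (simp add: PiE_iff)
  ultimately show ?thesis unfolding carrier_PG by (intro CollectI conjI ballI impI)
qed

lemma group_PG: "group PG"
proof (rule groupI)
  show one: "\<one>\<^bsub>PG\<^esub> \<in> carrier PG"
  proof (rule PG_I)
    show "\<one>\<^bsub>PG\<^esub> N \<in> carrier (A Mod N)" if "N \<in> P" for N
      using monoid.one_closed[OF group.is_monoid[OF P_group[OF that]]] that by (simp add: one_PG)
    show "\<exists>c\<in>carrier A. \<one>\<^bsub>PG\<^esub> N = N #>\<^bsub>A\<^esub> c \<and> \<one>\<^bsub>PG\<^esub> M = M #>\<^bsub>A\<^esub> c" if "N \<in> P" "M \<in> P" for N M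
      using that subgroup.subset[OF P_subgroup] by (intro bexI[of _ "\<one>\<^bsub>A\<^esub>"]) (auto simp: one_PG A.coset_mult_one)
  qed (simp add: one_PG)
  fix x assume x: "x \<in> carrier PG"
  have g1: "N \<in> P \<Longrightarrow> N <#>\<^bsub>A\<^esub> x N = x N" for N
    using monoid.l_one[OF group.is_monoid[OF P_group] PG_at[OF x]] by simp
  show "\<one>\<^bsub>PG\<^esub> \<otimes>\<^bsub>PG\<^esub> x = x"
    by (rule extensionalityI[of _ P]) (simp_all add: mult_PG one_PG g1 PG_extensional[OF x])
  let ?y = "\<lambda>N\<in>P. inv\<^bsub>A Mod N\<^esub> (x N)"
  have y: "?y \<in> carrier PG"
  proof (rule PG_I)
    show "?y N \<in> carrier (A Mod N)" if "N \<in> P" for N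
      using group.inv_closed[OF P_group PG_at[OF x]] that by simp
    fix N M assume NM: "N \<in> P" "M \<in> P" "N \<subseteq> M"
    obtain c where c: "c \<in> carrier A" "x N = N #>\<^bsub>A\<^esub> c" using PG_at_coset[OF x NM(1)] by blast
    have inv: "inv\<^bsub>A Mod K\<^esub> (K #>\<^bsub>A\<^esub> c) = K #>\<^bsub>A\<^esub> inv\<^bsub>A\<^esub> c" if "K \<in> P" for K
    proof -
      have "group_hom A (A Mod K) (\<lambda>a. K #>\<^bsub>A\<^esub> a)"
        using normal.r_coset_hom_Mod[OF P_normal[OF that]] P_group[OF that] A.is_group by (simp add: group_hom_def group_hom_axioms_def)
      from group_hom.hom_inv[OF this c(1)] show ?thesis by simp
    qed
    show "\<exists>c\<in>carrier A. ?y N = N #>\<^bsub>A\<^esub> c \<and> ?y M = M #>\<^bsub>A\<^esub> c"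
      using c NM inv PG_compat_coset[OF x NM c] by (intro bexI[of _ "inv\<^bsub>A\<^esub> c"]) auto
  qed simp
  have "?y N <#>\<^bsub>A\<^esub> x N = N" if "N \<in> P" for N
    using group.l_inv[OF P_group PG_at[OF x]] that by simp
  then have "?y \<otimes>\<^bsub>PG\<^esub> x = \<one>\<^bsub>PG\<^esub>"
    by (intro extensionalityI[of _ P]) (simp_all add: mult_PG one_PG)
  then show "\<exists>y\<in>carrier PG. y \<otimes>\<^bsub>PG\<^esub> x = \<one>\<^bsub>PG\<^esub>" using y by blast
  fix y assume y: "y \<in> carrier PG"
  show "x \<otimes>\<^bsub>PG\<^esub> y \<in> carrier PG"
  proof (rule PG_I)
    show "(x \<otimes>\<^bsub>PG\<^esub> y) N \<in> carrier (A Mod N)" if "N \<in> P" for N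
      using monoid.m_closed[OF group.is_monoid[OF P_group[OF that]] PG_at[OF x that] PG_at[OF y that]] that by (simp add: mult_PG)
    fix N M assume NM: "N \<in> P" "M \<in> P" "N \<subseteq> M"
    obtain c where c: "c \<in> carrier A" "x N = N #>\<^bsub>A\<^esub> c" using PG_at_coset[OF x NM(1)] by blast
    obtain d where d: "d \<in> carrier A" "y N = N #>\<^bsub>A\<^esub> d" using PG_at_coset[OF y NM(1)] by blast
    show "\<exists>c\<in>carrier A. (x \<otimes>\<^bsub>PG\<^esub> y) N = N #>\<^bsub>A\<^esub> c \<and> (x \<otimes>\<^bsub>PG\<^esub> y) M = M #>\<^bsub>A\<^esub> c"
      using c d NM PG_compat_coset[OF x NM c] PG_compat_coset[OF y NM d] normal.rcos_sum[OF P_normal]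
      by (intro bexI[of _ "c \<otimes>\<^bsub>A\<^esub> d"]) (auto simp: mult_PG)
  qed (simp add: mult_PG)
  fix z assume z: "z \<in> carrier PG"
  have "(x N <#>\<^bsub>A\<^esub> y N) <#>\<^bsub>A\<^esub> z N = x N <#>\<^bsub>A\<^esub> (y N <#>\<^bsub>A\<^esub> z N)" if "N \<in> P" for N
    using monoid.m_assoc[OF group.is_monoid[OF P_group[OF that]] PG_at[OF x that] PG_at[OF y that] PG_at[OF z that]] by simp
  then show "x \<otimes>\<^bsub>PG\<^esub> y \<otimes>\<^bsub>PG\<^esub> z = x \<otimes>\<^bsub>PG\<^esub> (y \<otimes>\<^bsub>PG\<^esub> z)" by (auto simp: mult_PG fun_eq_iff)
qed

sublocale PG: group PG by (rule group_PG)

lemma PG_mult_at: "N \<in> P \<Longrightarrow> (g \<otimes>\<^bsub>PG\<^esub> h) N = g N <#>\<^bsub>A\<^esub> h N" by (simp add: mult_PG)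
lemma PG_one_at: "N \<in> P \<Longrightarrow> \<one>\<^bsub>PG\<^esub> N = N" by (simp add: one_PG)

lemma PG_proj_hom: "N \<in> P \<Longrightarrow> group_hom PG (A Mod N) (\<lambda>g. g N)"
  unfolding group_hom_def group_hom_axioms_def
  using P_group PG_at group_PG by (auto intro!: homI simp: PG_mult_at)

definition emb :: "'c \<Rightarrow> 'c set \<Rightarrow> 'c set" where "emb c = (\<lambda>N\<in>P. N #>\<^bsub>A\<^esub> c)"

lemma emb_at: "N \<in> P \<Longrightarrow> emb c N = N #>\<^bsub>A\<^esub> c" by (simp add: emb_def)

lemma emb_closed: "c \<in> carrier A \<Longrightarrow> emb c \<in> carrier PG"
  by (rule PG_I) (auto simp: emb_def carrier_FactGroup)

lemma emb_hom: "group_hom A PG emb"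
  unfolding group_hom_def group_hom_axioms_def
  using A.is_group group_PG emb_closed normal.rcos_sum[OF P_normal]
  by (auto intro!: homI simp: mult_PG emb_def fun_eq_iff)

lemma topspace_PT: "topspace PT = carrier PG"
  unfolding pro_p_topology_def using PG_PiE by (auto simp: topspace_subtopology)

lemma proj_continuous: "N \<in> P \<Longrightarrow> continuous_map PT (discrete_topology (carrier (A Mod N))) (\<lambda>g. g N)"
  unfolding pro_p_topology_def
  by (rule continuous_map_from_subtopology, rule continuous_map_product_projection[where X = "\<lambda>N. discrete_topology (carrier (A Mod N))"])

lemma proj_preimage:
  "N \<in> P \<Longrightarrow> {g \<in> topspace PT. g N \<in> D \<inter> carrier (A Mod N)} = {g \<in> carrier PG. g N \<in> D}"
  using PG_at by (auto simp: topspace_PT)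

lemma closedin_proj: "N \<in> P \<Longrightarrow> closedin PT {g \<in> carrier PG. g N \<in> D}"
  unfolding proj_preimage[symmetric] by (rule closedin_continuous_map_preimage[OF proj_continuous]) simp_all

lemma openin_proj: "N \<in> P \<Longrightarrow> openin PT {g \<in> carrier PG. g N \<in> D}"
  unfolding proj_preimage[symmetric] by (rule openin_continuous_map_preimage[OF proj_continuous]) simp_all

text \<open>The completion is cut out of a product of finite discrete spaces by closed conditions.\<close>

lemma compact_PT: "compact_space PT"
proof -
  let ?X = "product_topology (\<lambda>N. discrete_topology (carrier (A Mod N))) P"
  have X: "compact_space ?X"
    unfolding compact_space_product_topology using P_finite by (auto simp: compact_space_discrete_topology)
  have pc: "N \<in> P \<Longrightarrow> continuous_map ?X (discrete_topology (carrier (A Mod N))) (\<lambda>g. g N)" for N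
    by (rule continuous_map_product_projection)
  have cl: "closedin ?X {f \<in> topspace ?X. f M = M <#>\<^bsub>A\<^esub> f N}" if NM: "N \<in> P" "M \<in> P" "N \<subseteq> M" for N M
  proof -
    have "continuous_map ?X (discrete_topology (carrier (A Mod M))) ((\<lambda>C. M <#>\<^bsub>A\<^esub> C) \<circ> (\<lambda>f. f N))"
    proof (rule continuous_map_compose[OF pc[OF NM(1)]])
      have "M <#>\<^bsub>A\<^esub> C \<in> carrier (A Mod M)" if "C \<in> carrier (A Mod N)" for C
        using that coset_coarsen[OF NM] by (auto simp: carrier_FactGroup)
      then show "continuous_map (discrete_topology (carrier (A Mod N))) (discrete_topology (carrier (A Mod M))) (\<lambda>C. M <#>\<^bsub>A\<^esub> C)"
        by simp
    qed
    from closedin_continuous_maps_eq[OF Hausdorff_space_discrete_topology pc[OF NM(2)] this]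
    show ?thesis by simp
  qed
  have "carrier PG = topspace ?X \<inter> (\<Inter>(N, M)\<in>{(N, M). N \<in> P \<and> M \<in> P \<and> N \<subseteq> M}. {f \<in> topspace ?X. f M = M <#>\<^bsub>A\<^esub> f N})"
    unfolding carrier_PG by (intro equalityI subsetI; clarsimp)
  also have "closedin ?X \<dots>"
  proof -
    have "{(N, M). N \<in> P \<and> M \<in> P \<and> N \<subseteq> M} \<noteq> {}" using P_carrier by auto
    then show ?thesis
      by (intro closedin_Int closedin_topspace closedin_INT) (auto intro!: cl simp del: topspace_product_topology)
  qed
  finally have "compactin ?X (carrier PG)" using closedin_compact_space[OF X] by blast
  then show ?thesis unfolding pro_p_topology_def by (rule compact_space_subtopology)
qed

lemma Hausdorff_PT: "Hausdorff_space PT"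
  unfolding pro_p_topology_def
  by (intro Hausdorff_space_subtopology) (simp add: Hausdorff_space_product_topology)

lemma conj_continuous:
  assumes g: "g \<in> carrier PG"
  shows "continuous_map PT PT (\<lambda>x\<in>carrier PG. g \<otimes>\<^bsub>PG\<^esub> x \<otimes>\<^bsub>PG\<^esub> inv\<^bsub>PG\<^esub> g)" (is "continuous_map _ _ ?c")
proof -
  have "continuous_map PT (product_topology (\<lambda>N. discrete_topology (carrier (A Mod N))) P) ?c"
    unfolding continuous_map_componentwise topspace_PT
  proof (intro conjI ballI)
    show "?c ` carrier PG \<subseteq> extensional P" using g by (auto simp: mult_PG)
    fix N assume N: "N \<in> P"
    have "continuous_map PT (discrete_topology (carrier (A Mod N))) ((\<lambda>C. g N <#>\<^bsub>A\<^esub> C <#>\<^bsub>A\<^esub> (inv\<^bsub>PG\<^esub> g) N) \<circ> (\<lambda>x. x N))"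
    proof (rule continuous_map_compose[OF proj_continuous[OF N]])
      have "g N <#>\<^bsub>A\<^esub> C <#>\<^bsub>A\<^esub> (inv\<^bsub>PG\<^esub> g) N \<in> carrier (A Mod N)" if "C \<in> carrier (A Mod N)" for C
        using monoid.m_closed[OF group.is_monoid[OF P_group[OF N]]] PG_at[OF g N] PG_at[OF PG.inv_closed[OF g] N] that by (simp del: mult_FactGroup add: mult_FactGroup[symmetric, of A N])
      then show "continuous_map (discrete_topology (carrier (A Mod N))) (discrete_topology (carrier (A Mod N))) (\<lambda>C. g N <#>\<^bsub>A\<^esub> C <#>\<^bsub>A\<^esub> (inv\<^bsub>PG\<^esub> g) N)"
        by simp
    qed
    then show "continuous_map PT (discrete_topology (carrier (A Mod N))) (\<lambda>x. ?c x N)"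
      by (rule continuous_map_eq) (simp add: topspace_PT PG_mult_at N)
  qed
  then show ?thesis
    unfolding pro_p_topology_def[of p A] continuous_map_in_subtopology
    using g by (auto simp: pro_p_topology_def[symmetric] topspace_PT)
qed

text \<open>A neighbourhood of the identity constrains finitely many coordinates only, and these are determined by
  one coordinate further down.\<close>

lemma continuous_at_one:
  assumes \<phi>: "continuous_map PT PT \<phi>" and one: "\<phi> \<one>\<^bsub>PG\<^esub> = \<one>\<^bsub>PG\<^esub>" and N: "N \<in> P"
  shows "\<exists>M\<in>P. \<forall>g\<in>carrier PG. g M = M \<longrightarrow> \<phi> g N = N"
proof -
  let ?X = "product_topology (\<lambda>N. discrete_topology (carrier (A Mod N))) P"
  have "openin PT {g \<in> topspace PT. \<phi> g \<in> {g \<in> carrier PG. g N \<in> {N}}}"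
    by (rule openin_continuous_map_preimage[OF \<phi> openin_proj[OF N]])
  then obtain W where W: "openin ?X W" "{g \<in> carrier PG. \<phi> g \<in> {g \<in> carrier PG. g N \<in> {N}}} = W \<inter> carrier PG"
    unfolding topspace_PT unfolding pro_p_topology_def openin_subtopology by blast
  have "\<one>\<^bsub>PG\<^esub> \<in> W" using W(2) one N PG.one_closed by (auto simp: PG_one_at)
  then obtain U where U: "finite {i \<in> P. U i \<noteq> topspace (discrete_topology (carrier (A Mod i)))}"
      "\<one>\<^bsub>PG\<^esub> \<in> Pi\<^sub>E P U" "Pi\<^sub>E P U \<subseteq> W"
    using W(1) unfolding openin_product_topology_alt by meson
  let ?F = "{i \<in> P. U i \<noteq> topspace (discrete_topology (carrier (A Mod i)))}"
  obtain M where M: "M \<in> P" "\<And>i. i \<in> ?F \<Longrightarrow> M \<subseteq> i" using P_finite_lower[OF U(1)] by auto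
  have "\<phi> g N = N" if g: "g \<in> carrier PG" "g M = M" for g
  proof -
    have "g i \<in> U i" if i: "i \<in> P" for i
    proof (cases "i \<in> ?F")
      case False
      then show ?thesis using i PG_at[OF g(1) i] by auto
    next
      case True
      have "M = M #>\<^bsub>A\<^esub> \<one>\<^bsub>A\<^esub>" using A.coset_mult_one subgroup.subset[OF P_subgroup[OF M(1)]] by simp
      then have "g i = i #>\<^bsub>A\<^esub> \<one>\<^bsub>A\<^esub>" using PG_compat_coset[OF g(1) M(1) i M(2)[OF True], of "\<one>\<^bsub>A\<^esub>"] g(2) by simp
      then have "g i = \<one>\<^bsub>PG\<^esub> i" using i A.coset_mult_one subgroup.subset[OF P_subgroup[OF i]] by (simp add: PG_one_at)
      then show ?thesis using U(2) i by (simp add: PiE_iff)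
    qed
    then have "g \<in> Pi\<^sub>E P U" using PG_extensional[OF g(1)] by (simp add: PiE_iff)
    then show ?thesis using U(3) W(2) g(1) by blast
  qed
  then show ?thesis using M(1) by blast
qed

text \<open>The image of \<open>A\<close> is dense, simultaneously for a coordinate and for its image under \<open>\<phi>\<close>.\<close>

lemma emb_approx:
  assumes \<phi>: "continuous_map PT PT \<phi>" "\<phi> \<in> hom PG PG" and N: "N \<in> P" "M \<in> P" and g: "g \<in> carrier PG"
  shows "\<exists>c\<in>carrier A. emb c M = g M \<and> \<phi> (emb c) N = \<phi> g N"
proof -
  interpret \<phi>: group_hom PG PG \<phi> using \<phi>(2) group_PG by (simp add: group_hom_def group_hom_axioms_def)
  obtain K where K: "K \<in> P" "\<And>h. h \<in> carrier PG \<Longrightarrow> h K = K \<Longrightarrow> \<phi> h N = N"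
    using continuous_at_one[OF \<phi>(1) \<phi>.hom_one N(1)] by blast
  let ?L = "K \<inter> M"
  have L: "?L \<in> P" using P_Int K(1) N(2) by blast
  obtain c where c: "c \<in> carrier A" "g ?L = ?L #>\<^bsub>A\<^esub> c" using PG_at_coset[OF g L] by blast
  have at: "g Q = emb c Q" if "Q \<in> P" "?L \<subseteq> Q" for Q
    using PG_compat_coset[OF g L that c] emb_at[OF that(1)] by simp
  let ?h = "g \<otimes>\<^bsub>PG\<^esub> inv\<^bsub>PG\<^esub> (emb c)"
  have e: "emb c \<in> carrier PG" by (rule emb_closed[OF c(1)])
  interpret pK: group_hom PG "A Mod K" "\<lambda>g. g K" by (rule PG_proj_hom[OF K(1)])
  interpret pN: group_hom PG "A Mod N" "\<lambda>g. g N" by (rule PG_proj_hom[OF N(1)])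
  have h: "?h \<in> carrier PG" using g e by simp
  have "?h K = g K \<otimes>\<^bsub>A Mod K\<^esub> inv\<^bsub>A Mod K\<^esub> (emb c K)" using g e by (simp only: pK.hom_mult pK.hom_inv PG.inv_closed)
  also have "\<dots> = \<one>\<^bsub>A Mod K\<^esub>" using at[OF K(1)] group.r_inv[OF P_group[OF K(1)] PG_at[OF e K(1)]] by simp
  finally have "\<phi> ?h N = N" using K(2)[OF h] by simp
  moreover have "g = ?h \<otimes>\<^bsub>PG\<^esub> emb c" using g e by (simp add: PG.m_assoc)
  then have "\<phi> g = \<phi> ?h \<otimes>\<^bsub>PG\<^esub> \<phi> (emb c)" using \<phi>.hom_mult[OF h e] by simp
  then have "\<phi> g N = \<phi> ?h N \<otimes>\<^bsub>A Mod N\<^esub> \<phi> (emb c) N" by (simp add: PG_mult_at N(1))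
  ultimately have "\<phi> g N = \<one>\<^bsub>A Mod N\<^esub> \<otimes>\<^bsub>A Mod N\<^esub> \<phi> (emb c) N" by simp
  also have "\<dots> = \<phi> (emb c) N"
    using monoid.l_one[OF group.is_monoid[OF P_group[OF N(1)]] PG_at[OF \<phi>.hom_closed[OF e] N(1)]] by simp
  finally show ?thesis using at[OF N(2)] c(1) by (metis inf_le2)
qed

end

section \<open>The Torelli group as a quotient of a group of automorphisms\<close>

lemma residually_torsion_free_nilpotent_FactGroupI:
  fixes B :: "('t, 'm) monoid_scheme" and N :: "nat \<Rightarrow> 't set"
  assumes B: "group B" and I: "I \<lhd> B" and sub: "\<And>k. subgroup (N k) B" and IN: "\<And>k. I \<subseteq> N k"
    and N0: "N 0 = carrier B" and dec: "\<And>k. N (Suc k) \<subseteq> N k"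
    and comm: "\<And>k x y. x \<in> N k \<Longrightarrow> y \<in> carrier B \<Longrightarrow>
        x \<otimes>\<^bsub>B\<^esub> y \<otimes>\<^bsub>B\<^esub> inv\<^bsub>B\<^esub> x \<otimes>\<^bsub>B\<^esub> inv\<^bsub>B\<^esub> y \<in> N (Suc k)"
    and tors: "\<And>k q x. x \<in> N k \<Longrightarrow> prime (q::nat) \<Longrightarrow> x [^]\<^bsub>B\<^esub> q \<in> N (Suc k) \<Longrightarrow> x \<in> N (Suc k)"
    and sep: "\<And>x. x \<in> carrier B \<Longrightarrow> (\<And>k. x \<in> N k) \<Longrightarrow> x \<in> I"
  shows "residually_torsion_free_nilpotent (B Mod I)"
proof -
  interpret B: group B by (rule B)
  interpret I: normal I B by (rule I)
  let ?c = "\<lambda>x. I #>\<^bsub>B\<^esub> x"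
  have Q: "group (B Mod I)" by (rule I.factorgroup_is_group)
  interpret h: group_hom B "B Mod I" ?c
    using I.r_coset_hom_Mod Q B by (simp add: group_hom_def group_hom_axioms_def)
  have NB: "x \<in> N k \<Longrightarrow> x \<in> carrier B" for x k using subgroup.subset[OF sub] by blast
  have img: "x \<in> N k" if x: "x \<in> carrier B" "?c x \<in> ?c ` N k" for x k
  proof -
    obtain y where y: "y \<in> N k" "?c x = ?c y" using x(2) by blast
    have "x \<in> ?c y" using B.rcos_self[OF x(1) I.subgroup_axioms] y(2) by simp
    then obtain i where "i \<in> I" "x = i \<otimes>\<^bsub>B\<^esub> y" by (auto simp: r_coset_def)
    then show ?thesis using subgroup.m_closed[OF sub] IN y(1) by blast
  qed
  show ?thesis
  proof (rule residually_torsion_free_nilpotentI[OF Q, where N = "\<lambda>k. ?c ` N k"])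
    show "subgroup (?c ` N k) (B Mod I)" for k by (rule h.subgroup_img_is_subgroup[OF sub])
    show "?c ` N 0 = carrier (B Mod I)" by (simp add: N0 carrier_FactGroup)
    show "?c ` N (Suc k) \<subseteq> ?c ` N k" for k using dec by blast
  next
    fix k X Y assume "X \<in> ?c ` N k" "Y \<in> carrier (B Mod I)"
    then obtain x y where x: "x \<in> N k" "X = ?c x" and y: "y \<in> carrier B" "Y = ?c y"
      by (auto simp: carrier_FactGroup)
    have "X \<otimes>\<^bsub>B Mod I\<^esub> Y \<otimes>\<^bsub>B Mod I\<^esub> inv\<^bsub>B Mod I\<^esub> X \<otimes>\<^bsub>B Mod I\<^esub> inv\<^bsub>B Mod I\<^esub> Y
        = ?c (x \<otimes>\<^bsub>B\<^esub> y \<otimes>\<^bsub>B\<^esub> inv\<^bsub>B\<^esub> x \<otimes>\<^bsub>B\<^esub> inv\<^bsub>B\<^esub> y)"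
      unfolding x(2) y(2) using NB[OF x(1)] y(1) by (simp only: h.hom_mult h.hom_inv B.m_closed B.inv_closed)
    then show "X \<otimes>\<^bsub>B Mod I\<^esub> Y \<otimes>\<^bsub>B Mod I\<^esub> inv\<^bsub>B Mod I\<^esub> X \<otimes>\<^bsub>B Mod I\<^esub> inv\<^bsub>B Mod I\<^esub> Y \<in> ?c ` N (Suc k)"
      using comm[OF x(1) y(1)] by blast
  next
    fix k X and q :: nat assume X: "X \<in> ?c ` N k" "prime q" "X [^]\<^bsub>B Mod I\<^esub> q \<in> ?c ` N (Suc k)"
    then obtain x where x: "x \<in> N k" "X = ?c x" by blast
    have "?c (x [^]\<^bsub>B\<^esub> q) \<in> ?c ` N (Suc k)" using X(3) x B.FactGroup_pow[OF I NB[OF x(1)]] by simp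
    then have "x [^]\<^bsub>B\<^esub> q \<in> N (Suc k)" by (rule img[rotated]) (use NB[OF x(1)] in simp)
    then show "X \<in> ?c ` N (Suc k)" using tors[OF x(1) X(2)] x(2) by blast
  next
    fix X assume X: "X \<in> carrier (B Mod I)" "\<And>k. X \<in> ?c ` N k"
    then obtain x where x: "x \<in> carrier B" "X = ?c x" by (auto simp: carrier_FactGroup)
    have "x \<in> I" using sep[OF x(1)] img[OF x(1)] X(2) x(2) by blast
    then show "X = \<one>\<^bsub>B Mod I\<^esub>" using B.coset_join2[OF x(1) I.subgroup_axioms] x(2) by simp
  qed
qed

text \<open>The properties of a compact Hausdorff topological group that make its continuous automorphisms a
  group with the inner ones as a normal subgroup.\<close>

locale compact_group = group G for G :: "('g, 'm) monoid_scheme" (structure) +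
  fixes T :: "'g topology"
  assumes topspace: "topspace T = carrier G" and compact: "compact_space T" and Hausdorff: "Hausdorff_space T"
    and conj_cont: "g \<in> carrier G \<Longrightarrow> continuous_map T T (\<lambda>x\<in>carrier G. g \<otimes> x \<otimes> inv g)"
begin

abbreviation "CA \<equiv> cont_Aut G T"

lemma carrier_CA: "\<phi> \<in> carrier CA \<longleftrightarrow> \<phi> \<in> auto G \<and> continuous_map T T \<phi>"
  by (simp add: cont_Aut_def)

lemma CA_auto: assumes \<phi>: "\<phi> \<in> carrier CA"
  shows "\<phi> \<in> hom G G" "bij_betw \<phi> (carrier G) (carrier G)" "\<phi> \<in> extensional (carrier G)"
    "\<phi> \<in> Bij (carrier G)" "continuous_map T T \<phi>"
  using \<phi> by (simp_all add: carrier_CA auto_def Bij_def)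

lemma CA_closed: "\<phi> \<in> carrier CA \<Longrightarrow> g \<in> carrier G \<Longrightarrow> \<phi> g \<in> carrier G"
  by (drule CA_auto(1)) (rule hom_in_carrier)

lemma CA_group_hom: "\<phi> \<in> carrier CA \<Longrightarrow> group_hom G G \<phi>"
  by (drule CA_auto(1)) (simp add: group_hom_def group_hom_axioms_def is_group)

lemma CA_mult: assumes "\<phi> \<in> carrier CA" "\<psi> \<in> carrier CA" shows "\<phi> \<otimes>\<^bsub>CA\<^esub> \<psi> = compose (carrier G) \<phi> \<psi>"
  using CA_auto(4)[OF assms(1)] CA_auto(4)[OF assms(2)] by (simp add: cont_Aut_def AutoGroup_def BijGroup_def)

lemma CA_mult_at: "\<phi> \<in> carrier CA \<Longrightarrow> \<psi> \<in> carrier CA \<Longrightarrow> g \<in> carrier G \<Longrightarrow> (\<phi> \<otimes>\<^bsub>CA\<^esub> \<psi>) g = \<phi> (\<psi> g)"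
  by (simp add: CA_mult compose_def)

lemma CA_one: "\<one>\<^bsub>CA\<^esub> = (\<lambda>x\<in>carrier G. x)"
  by (simp add: cont_Aut_def AutoGroup_def BijGroup_def)

text \<open>Inverses are continuous because a continuous bijection from a compact to a Hausdorff space is a
  homeomorphism.\<close>

lemma group_CA: "group CA"
proof -
  interpret Au: group "AutoGroup G" by (rule AutoGroup)
  have cA: "carrier (AutoGroup G) = auto G" by (simp add: AutoGroup_def)
  have mult: "\<phi> \<otimes>\<^bsub>AutoGroup G\<^esub> \<psi> = compose (carrier G) \<phi> \<psi>" if "\<phi> \<in> auto G" "\<psi> \<in> auto G" for \<phi> \<psi>
    using that by (simp add: AutoGroup_def BijGroup_def auto_def)
  have one: "\<one>\<^bsub>AutoGroup G\<^esub> = (\<lambda>x\<in>carrier G. x)" by (simp add: AutoGroup_def BijGroup_def)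
  let ?B = "{\<phi> \<in> auto G. continuous_map T T \<phi>}"
  have "subgroup ?B (AutoGroup G)"
  proof (rule Au.subgroupI)
    show "?B \<subseteq> carrier (AutoGroup G)" by (auto simp: cA)
    have "continuous_map T T (\<lambda>x\<in>carrier G. x)"
      by (rule continuous_map_eq[OF continuous_map_id]) (simp add: topspace)
    then show "?B \<noteq> {}" using id_in_auto by blast
    fix \<phi> assume \<phi>: "\<phi> \<in> ?B"
    then have bij: "bij_betw \<phi> (carrier G) (carrier G)" by (auto simp: auto_def Bij_def)
    let ?i = "inv\<^bsub>AutoGroup G\<^esub> \<phi>"
    have iA: "?i \<in> auto G" using Au.inv_closed \<phi> cA by auto
    have "homeomorphic_map T T \<phi>"
      by (rule continuous_imp_homeomorphic_map) (use \<phi> compact Hausdorff bij topspace in \<open>auto simp: bij_betw_def\<close>)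
    then obtain \<psi> where \<psi>: "homeomorphic_maps T T \<phi> \<psi>" by (auto simp: homeomorphic_map_maps)
    have ii: "?i y = \<psi> y" if y: "y \<in> carrier G" for y
    proof -
      have iy: "?i y \<in> carrier G" using iA y by (auto simp: auto_def hom_def)
      have "compose (carrier G) \<phi> ?i = (\<lambda>x\<in>carrier G. x)"
        using Au.r_inv[of \<phi>] \<phi> mult[of \<phi> ?i] iA by (simp add: cA one)
      then have "\<phi> (?i y) = y" using y by (metis compose_eq restrict_apply')
      then show ?thesis using \<psi> iy topspace by (metis homeomorphic_maps_def)
    qed
    have "continuous_map T T \<psi>" using \<psi> unfolding homeomorphic_maps_def by blast
    then have "continuous_map T T ?i"
      by (rule continuous_map_eq) (rule ii[symmetric], simp add: topspace)
    then show "?i \<in> ?B" using iA by blast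
    fix \<psi> assume \<psi>: "\<psi> \<in> ?B"
    have "continuous_map T T (compose (carrier G) \<phi> \<psi>)"
    proof (rule continuous_map_eq)
      show "continuous_map T T (\<phi> \<circ> \<psi>)" using \<phi> \<psi> by (intro continuous_map_compose[where X' = T]) simp_all
    qed (simp add: topspace compose_def)
    moreover have "\<phi> \<otimes>\<^bsub>AutoGroup G\<^esub> \<psi> \<in> auto G"
      using Au.m_closed[of \<phi> \<psi>] \<phi> \<psi> by (simp add: cA)
    ultimately show "\<phi> \<otimes>\<^bsub>AutoGroup G\<^esub> \<psi> \<in> ?B" using mult[of \<phi> \<psi>] \<phi> \<psi> by simp
  qed
  then show ?thesis unfolding cont_Aut_def by (rule subgroup.subgroup_is_group[OF _ AutoGroup])
qed

sublocale CA: group CA by (rule group_CA)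

lemma CA_inv_at:
  assumes "\<phi> \<in> carrier CA" "g \<in> carrier G"
  shows "\<phi> ((inv\<^bsub>CA\<^esub> \<phi>) g) = g" "(inv\<^bsub>CA\<^esub> \<phi>) (\<phi> g) = g"
proof -
  have "(\<phi> \<otimes>\<^bsub>CA\<^esub> inv\<^bsub>CA\<^esub> \<phi>) g = g" "(inv\<^bsub>CA\<^esub> \<phi> \<otimes>\<^bsub>CA\<^esub> \<phi>) g = g"
    using assms by (simp_all add: CA_one)
  then show "\<phi> ((inv\<^bsub>CA\<^esub> \<phi>) g) = g" "(inv\<^bsub>CA\<^esub> \<phi>) (\<phi> g) = g"
    using CA_mult_at assms CA.inv_closed by metis+
qed

lemma CA_eqI: "\<phi> \<in> carrier CA \<Longrightarrow> \<psi> \<in> carrier CA \<Longrightarrow> (\<And>g. g \<in> carrier G \<Longrightarrow> \<phi> g = \<psi> g) \<Longrightarrow> \<phi> = \<psi>"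
  by (rule extensionalityI[OF CA_auto(3) CA_auto(3)])

abbreviation inn :: "'g \<Rightarrow> 'g \<Rightarrow> 'g" where "inn g \<equiv> \<lambda>x\<in>carrier G. g \<otimes> x \<otimes> inv g"

lemma inn_CA: assumes g: "g \<in> carrier G" shows "inn g \<in> carrier CA"
proof -
  have "inn g \<in> hom G G"
    using g by (auto intro!: homI simp: m_assoc) (simp add: m_assoc[symmetric])
  moreover have "bij_betw (inn g) (carrier G) (carrier G)"
  proof (rule bij_betwI[where g = "inn (inv g)"])
    show "inn (inv g) (inn g x) = x" if "x \<in> carrier G" for x
      using g that by (simp add: m_assoc) (simp add: m_assoc[symmetric])
    show "inn g (inn (inv g) x) = x" if "x \<in> carrier G" for x
      using g that by (simp add: m_assoc) (simp add: m_assoc[symmetric])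
  qed (use g in auto)
  ultimately show ?thesis using conj_cont[OF g] by (simp add: carrier_CA auto_def Bij_def)
qed

lemma Inn_conv: "\<phi> \<in> Inn G \<longleftrightarrow> (\<exists>g\<in>carrier G. \<phi> = inn g)" by (auto simp: Inn_def)

lemma Inn_normal: "Inn G \<lhd> CA"
  unfolding CA.normal_inv_iff
proof (intro conjI ballI)
  have mult: "inn g \<otimes>\<^bsub>CA\<^esub> inn h = inn (g \<otimes> h)" if "g \<in> carrier G" "h \<in> carrier G" for g h
  proof (rule CA_eqI)
    show "inn g \<otimes>\<^bsub>CA\<^esub> inn h \<in> carrier CA" by (rule CA.m_closed[OF inn_CA[OF that(1)] inn_CA[OF that(2)]])
    show "inn (g \<otimes> h) \<in> carrier CA" using inn_CA that by blast
    fix x assume "x \<in> carrier G"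
    then show "(inn g \<otimes>\<^bsub>CA\<^esub> inn h) x = inn (g \<otimes> h) x"
      using that by (simp add: CA_mult_at[OF inn_CA[OF that(1)] inn_CA[OF that(2)]] m_assoc inv_mult_group)
  qed
  show "subgroup (Inn G) CA"
  proof (rule CA.subgroupI)
    show "Inn G \<subseteq> carrier CA" using inn_CA by (auto simp: Inn_def)
    show "Inn G \<noteq> {}" using one_closed by (auto simp: Inn_def)
    fix \<phi> assume "\<phi> \<in> Inn G"
    then obtain g where g: "g \<in> carrier G" "\<phi> = inn g" by (auto simp: Inn_def)
    have "inn (inv g) \<otimes>\<^bsub>CA\<^esub> inn g = inn (inv g \<otimes> g)" using g(1) by (intro mult) simp_all
    also have "\<dots> = \<one>\<^bsub>CA\<^esub>" unfolding CA_one by (rule restrict_ext) (use g(1) in simp)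
    finally have "inn (inv g) \<otimes>\<^bsub>CA\<^esub> inn g = \<one>\<^bsub>CA\<^esub>" .
    then have "inv\<^bsub>CA\<^esub> \<phi> = inn (inv g)" unfolding g(2)
      by (rule CA.inv_equality[OF _ inn_CA[OF g(1)] inn_CA[OF inv_closed[OF g(1)]]])
    then show "inv\<^bsub>CA\<^esub> \<phi> \<in> Inn G" using g Inn_conv inv_closed by blast
    fix \<psi> assume "\<psi> \<in> Inn G"
    then obtain h where h: "h \<in> carrier G" "\<psi> = inn h" by (auto simp: Inn_def)
    show "\<phi> \<otimes>\<^bsub>CA\<^esub> \<psi> \<in> Inn G" using g h mult Inn_conv m_closed by metis
  qed
  fix \<phi> \<psi> assume \<phi>: "\<phi> \<in> carrier CA" and "\<psi> \<in> Inn G"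
  then obtain g where g: "g \<in> carrier G" "\<psi> = inn g" by (auto simp: Inn_def)
  interpret \<phi>: group_hom G G \<phi> by (rule CA_group_hom[OF \<phi>])
  have "\<phi> \<otimes>\<^bsub>CA\<^esub> \<psi> \<otimes>\<^bsub>CA\<^esub> inv\<^bsub>CA\<^esub> \<phi> = inn (\<phi> g)"
  proof (rule CA_eqI)
    fix x assume x: "x \<in> carrier G"
    have ix: "(inv\<^bsub>CA\<^esub> \<phi>) x \<in> carrier G" using CA_closed[OF CA.inv_closed[OF \<phi>] x] .
    show "(\<phi> \<otimes>\<^bsub>CA\<^esub> \<psi> \<otimes>\<^bsub>CA\<^esub> inv\<^bsub>CA\<^esub> \<phi>) x = inn (\<phi> g) x"
      using g x \<phi> inn_CA ix by (simp add: CA_mult_at CA_inv_at)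
  qed (use g \<phi> inn_CA in auto)
  then show "\<phi> \<otimes>\<^bsub>CA\<^esub> \<psi> \<otimes>\<^bsub>CA\<^esub> inv\<^bsub>CA\<^esub> \<phi> \<in> Inn G" using g Inn_conv \<phi>.hom_closed by metis
qed

abbreviation "D \<equiv> derived G (carrier G)"

text \<open>The automorphisms that act trivially on the abelianization.\<close>

definition IA :: "('g \<Rightarrow> 'g) set" where
  "IA = {\<phi> \<in> carrier CA. \<forall>g\<in>carrier G. \<phi> g \<otimes> inv g \<in> D}"

lemma D_normal: "D \<lhd> G" by (rule derived_self_is_normal)
lemma D_subgroup: "subgroup D G" using normal_imp_subgroup[OF D_normal] .

lemma IA_subgroup: "subgroup IA CA"
proof (rule CA.subgroupI)
  interpret D: normal D G by (rule D_normal)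
  show "IA \<subseteq> carrier CA" by (auto simp: IA_def)
  have "\<one>\<^bsub>CA\<^esub> \<in> IA" unfolding IA_def using CA.one_closed D.one_closed by (simp add: CA_one)
  then show "IA \<noteq> {}" by blast
  fix \<phi> assume "\<phi> \<in> IA"
  then have \<phi>: "\<phi> \<in> carrier CA" "\<And>g. g \<in> carrier G \<Longrightarrow> \<phi> g \<otimes> inv g \<in> D" by (auto simp: IA_def)
  have "(inv\<^bsub>CA\<^esub> \<phi>) g \<otimes> inv g \<in> D" if g: "g \<in> carrier G" for g
  proof -
    let ?h = "(inv\<^bsub>CA\<^esub> \<phi>) g"
    have h: "?h \<in> carrier G" using CA_closed[OF CA.inv_closed[OF \<phi>(1)] g] .
    have "inv (\<phi> ?h \<otimes> inv ?h) \<in> D" using \<phi>(2)[OF h] by blast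
    then show ?thesis using CA_inv_at[OF \<phi>(1) g] h g by (simp add: inv_mult_group)
  qed
  then show "inv\<^bsub>CA\<^esub> \<phi> \<in> IA" using \<phi>(1) by (simp add: IA_def)
  fix \<psi> assume "\<psi> \<in> IA"
  then have \<psi>: "\<psi> \<in> carrier CA" "\<And>g. g \<in> carrier G \<Longrightarrow> \<psi> g \<otimes> inv g \<in> D" by (auto simp: IA_def)
  have "\<phi> (\<psi> g) \<otimes> inv g \<in> D" if g: "g \<in> carrier G" for g
  proof -
    have h: "\<psi> g \<in> carrier G" "\<phi> (\<psi> g) \<in> carrier G" using CA_closed \<phi> \<psi> g by auto
    have "(\<phi> (\<psi> g) \<otimes> inv (\<psi> g)) \<otimes> (\<psi> g \<otimes> inv g) \<in> D" using \<phi>(2)[OF h(1)] \<psi>(2)[OF g] by blast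
    moreover have "(\<phi> (\<psi> g) \<otimes> inv (\<psi> g)) \<otimes> (\<psi> g \<otimes> inv g) = \<phi> (\<psi> g) \<otimes> inv g"
      using h g by (simp add: m_assoc) (simp add: m_assoc[symmetric])
    ultimately show ?thesis by simp
  qed
  then show "\<phi> \<otimes>\<^bsub>CA\<^esub> \<psi> \<in> IA" using \<phi>(1) \<psi>(1) by (simp add: IA_def CA_mult_at)
qed

lemma Inn_IA: "Inn G \<subseteq> IA"
proof
  fix \<phi> assume "\<phi> \<in> Inn G"
  then obtain g where g: "g \<in> carrier G" "\<phi> = inn g" by (auto simp: Inn_def)
  have "g \<otimes> x \<otimes> inv g \<otimes> inv x \<in> D" if "x \<in> carrier G" for x
    unfolding derived_def using g(1) that by (intro generate.incl) blast
  then show "\<phi> \<in> IA" using g inn_CA by (simp add: IA_def)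
qed

lemma CA_coset: assumes \<phi>: "\<phi> \<in> carrier CA" and x: "x \<in> carrier G" shows "\<phi> ` (D #> x) = D #> \<phi> x"
proof -
  interpret \<phi>: group_hom G G \<phi> by (rule CA_group_hom[OF \<phi>])
  have "\<phi> ` carrier G = carrier G" using CA_auto(2)[OF \<phi>] by (simp add: bij_betw_def)
  then have D: "\<phi> ` D = D" using \<phi>.derived_img[of "carrier G"] by simp
  have "\<phi> ` (D #> x) = (\<lambda>d. d \<otimes> \<phi> x) ` (\<phi> ` D)"
    using x subgroup.subset[OF D_subgroup] by (auto simp: r_coset_def image_image intro!: image_eqI)
  then show ?thesis unfolding D by (auto simp: r_coset_def)
qed

text \<open>The abelianization has only one inner automorphism, so its outer automorphisms are
  automorphisms.\<close>

lemma Inn_abelianization: "Inn (G Mod D) = {\<lambda>X\<in>carrier (G Mod D). X}"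
proof -
  interpret Q: comm_group "G Mod D" by (rule derived_quot_is_comm_group)
  have eq: "(\<lambda>X\<in>carrier (G Mod D). Y \<otimes>\<^bsub>G Mod D\<^esub> X \<otimes>\<^bsub>G Mod D\<^esub> inv\<^bsub>G Mod D\<^esub> Y) = (\<lambda>X\<in>carrier (G Mod D). X)"
    if "Y \<in> carrier (G Mod D)" for Y
  proof (rule restrict_ext)
    fix X assume "X \<in> carrier (G Mod D)"
    then show "Y \<otimes>\<^bsub>G Mod D\<^esub> X \<otimes>\<^bsub>G Mod D\<^esub> inv\<^bsub>G Mod D\<^esub> Y = X"
      unfolding Q.m_comm[OF that \<open>X \<in> carrier (G Mod D)\<close>]
      by (simp only: Q.m_assoc[OF _ that] Q.inv_closed[OF that] Q.r_inv[OF that] Q.r_one)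
  qed
  obtain Y where Y: "Y \<in> carrier (G Mod D)" using Q.one_closed by blast
  show ?thesis unfolding Inn_def
  proof (intro equalityI subsetI)
    fix \<phi> assume "\<phi> \<in> {\<lambda>X\<in>carrier (G Mod D). Z \<otimes>\<^bsub>G Mod D\<^esub> X \<otimes>\<^bsub>G Mod D\<^esub> inv\<^bsub>G Mod D\<^esub> Z |Z. Z \<in> carrier (G Mod D)}"
    then obtain Z where "Z \<in> carrier (G Mod D)" "\<phi> = (\<lambda>X\<in>carrier (G Mod D). Z \<otimes>\<^bsub>G Mod D\<^esub> X \<otimes>\<^bsub>G Mod D\<^esub> inv\<^bsub>G Mod D\<^esub> Z)"
      by (elim CollectE exE conjE)
    then show "\<phi> \<in> {\<lambda>X\<in>carrier (G Mod D). X}" using eq by (simp only: singleton_iff)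
  next
    fix \<phi> assume "\<phi> \<in> {\<lambda>X\<in>carrier (G Mod D). X}"
    then have "\<phi> = (\<lambda>X\<in>carrier (G Mod D). Y \<otimes>\<^bsub>G Mod D\<^esub> X \<otimes>\<^bsub>G Mod D\<^esub> inv\<^bsub>G Mod D\<^esub> Y)"
      unfolding eq[OF Y] by (simp only: singleton_iff)
    then show "\<phi> \<in> {\<lambda>X\<in>carrier (G Mod D). Z \<otimes>\<^bsub>G Mod D\<^esub> X \<otimes>\<^bsub>G Mod D\<^esub> inv\<^bsub>G Mod D\<^esub> Z |Z. Z \<in> carrier (G Mod D)}"
      using Y by (intro CollectI exI conjI)
  qed
qed

text \<open>Multiplication in \<open>AutoGroup\<close> is meaningful only on bijections, so the induced maps are first shown
  to be bijective.\<close>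

lemma Out_quotient_map_eq:
  assumes C: "C \<subseteq> carrier CA"
  shows "Out_quotient_map G T D C = (\<lambda>\<phi>. \<lambda>X\<in>carrier (G Mod D). \<phi> ` X) ` C"
proof -
  let ?Q = "G Mod D"
  let ?I = "\<lambda>X\<in>carrier ?Q. X"
  have "Inn ?Q #>\<^bsub>cont_Aut ?Q (quotient_topology G T D)\<^esub> (\<lambda>X\<in>carrier ?Q. \<phi> ` X) = {\<lambda>X\<in>carrier ?Q. \<phi> ` X}"
    if "\<phi> \<in> C" for \<phi>
  proof -
    have \<phi>: "\<phi> \<in> carrier CA" using that C by blast
    note i\<phi> = CA.inv_closed[OF \<phi>]
    let ?\<psi> = "\<lambda>X\<in>carrier ?Q. \<phi> ` X"
    have at: "?\<psi> (D #> x) = D #> \<phi> x" if "x \<in> carrier G" for x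
      using CA_coset[OF \<phi> that] that by (auto simp: carrier_FactGroup)
    have bij: "bij_betw ?\<psi> (carrier ?Q) (carrier ?Q)"
    proof (rule bij_betwI[where g = "\<lambda>X. (inv\<^bsub>CA\<^esub> \<phi>) ` X"])
      show "?\<psi> \<in> carrier ?Q \<rightarrow> carrier ?Q"
        using at CA_closed[OF \<phi>] by (auto simp: carrier_FactGroup)
      show "(\<lambda>X. (inv\<^bsub>CA\<^esub> \<phi>) ` X) \<in> carrier ?Q \<rightarrow> carrier ?Q"
        using CA_coset[OF i\<phi>] CA_closed[OF i\<phi>] by (auto simp: carrier_FactGroup)
      fix X assume "X \<in> carrier ?Q"
      then obtain x where x: "x \<in> carrier G" "X = D #> x" by (auto simp: carrier_FactGroup)
      show "(inv\<^bsub>CA\<^esub> \<phi>) ` ?\<psi> X = X"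
        unfolding x(2) at[OF x(1)] CA_coset[OF i\<phi> CA_closed[OF \<phi> x(1)]] by (simp add: CA_inv_at[OF \<phi> x(1)])
      show "?\<psi> ((inv\<^bsub>CA\<^esub> \<phi>) ` X) = X"
        unfolding x(2) CA_coset[OF i\<phi> x(1)] at[OF CA_closed[OF i\<phi> x(1)]] by (simp add: CA_inv_at[OF \<phi> x(1)])
    qed
    then have B: "?\<psi> \<in> Bij (carrier ?Q)" by (simp add: Bij_def)
    have "?I \<otimes>\<^bsub>cont_Aut ?Q (quotient_topology G T D)\<^esub> ?\<psi> = compose (carrier ?Q) ?I ?\<psi>"
      using B id_Bij[of "carrier ?Q"] by (simp add: cont_Aut_def AutoGroup_def BijGroup_def)
    also have "\<dots> = ?\<psi>"
    proof (rule extensionalityI[of _ "carrier ?Q"])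
      fix X assume X: "X \<in> carrier ?Q"
      then have "?\<psi> X \<in> carrier ?Q" using bij_betw_apply[OF bij] by blast
      then show "compose (carrier ?Q) ?I ?\<psi> X = ?\<psi> X" using X by (simp add: compose_def)
    qed simp_all
    finally show ?thesis unfolding Inn_abelianization by (simp add: r_coset_def)
  qed
  then show ?thesis unfolding Out_quotient_map_def by auto
qed

lemma image_eq_singleton: "C \<noteq> {} \<Longrightarrow> f ` C = {y} \<longleftrightarrow> (\<forall>x\<in>C. f x = y)"
  by auto

text \<open>A class of automorphisms lies in the kernel exactly if all its members, equivalently one of them, act trivially
  on the abelianization.\<close>

lemma Torelli_eq: "Torelli G T = (CA\<lparr>carrier := IA\<rparr>) Mod Inn G"
proof -
  let ?B = "CA\<lparr>carrier := IA\<rparr>"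
  interpret IA: subgroup IA CA by (rule IA_subgroup)
  interpret I: normal "Inn G" CA by (rule Inn_normal)
  have act: "(\<lambda>X\<in>carrier (G Mod D). \<phi> ` X) = (\<lambda>X\<in>carrier (G Mod D). X) \<longleftrightarrow> \<phi> \<in> IA" if \<phi>: "\<phi> \<in> carrier CA" for \<phi>
  proof -
    have "(\<lambda>X\<in>carrier (G Mod D). \<phi> ` X) = (\<lambda>X\<in>carrier (G Mod D). X) \<longleftrightarrow> (\<forall>X\<in>carrier (G Mod D). \<phi> ` X = X)"
    proof
      assume eq: "(\<lambda>X\<in>carrier (G Mod D). \<phi> ` X) = (\<lambda>X\<in>carrier (G Mod D). X)"
      show "\<forall>X\<in>carrier (G Mod D). \<phi> ` X = X"
      proof
        fix X assume "X \<in> carrier (G Mod D)"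
        then show "\<phi> ` X = X" using fun_cong[OF eq, of X] by simp
      qed
    qed (rule restrict_ext, blast)
    also have "\<dots> \<longleftrightarrow> (\<forall>x\<in>carrier G. D #> \<phi> x = D #> x)"
      unfolding carrier_FactGroup ball_simps by (intro ball_cong HOL.refl) (simp add: CA_coset[OF \<phi>])
    also have "\<dots> \<longleftrightarrow> (\<forall>x\<in>carrier G. \<phi> x \<otimes> inv x \<in> D)"
      by (intro ball_cong HOL.refl coset_eq_iff[OF D_subgroup] CA_closed[OF \<phi>])
    also have "\<dots> \<longleftrightarrow> \<phi> \<in> IA" unfolding IA_def using \<phi> by blast
    finally show ?thesis .
  qed
  have coset: "C \<subseteq> carrier CA \<and> C \<noteq> {} \<and> (C \<subseteq> IA \<longleftrightarrow> \<phi> \<in> IA)"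
    if "C = Inn G #>\<^bsub>CA\<^esub> \<phi>" "\<phi> \<in> carrier CA" for C \<phi>
  proof (intro conjI iffI)
    have self: "\<phi> \<in> C" using CA.rcos_self[OF that(2) I.subgroup_axioms] that(1) by simp
    show "C \<subseteq> carrier CA" using that CA.r_coset_subset_G[OF I.subset] by simp
    show "C \<noteq> {}" using self by blast
    show "\<phi> \<in> IA" if "C \<subseteq> IA" using that self by blast
    show "C \<subseteq> IA" if "\<phi> \<in> IA" using that \<open>C = Inn G #>\<^bsub>CA\<^esub> \<phi>\<close> Inn_IA IA.m_closed by (auto simp: r_coset_def)
  qed
  have ker: "kernel (Out G T) (Out (G Mod D) (quotient_topology G T D)) (Out_quotient_map G T D)
      = (\<lambda>\<phi>. Inn G #>\<^bsub>CA\<^esub> \<phi>) ` IA"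
  proof -
    have "Out_quotient_map G T D C = {\<lambda>X\<in>carrier (G Mod D). X} \<longleftrightarrow> \<phi> \<in> IA"
      if C: "C = Inn G #>\<^bsub>CA\<^esub> \<phi>" "\<phi> \<in> carrier CA" for C \<phi>
    proof -
      have c: "C \<subseteq> carrier CA" "C \<noteq> {}" "C \<subseteq> IA \<longleftrightarrow> \<phi> \<in> IA" using coset[OF C] by auto
      have "Out_quotient_map G T D C = {\<lambda>X\<in>carrier (G Mod D). X}
          \<longleftrightarrow> (\<forall>\<psi>\<in>C. (\<lambda>X\<in>carrier (G Mod D). \<psi> ` X) = (\<lambda>X\<in>carrier (G Mod D). X))"
        unfolding Out_quotient_map_eq[OF c(1)] by (rule image_eq_singleton[OF c(2)])
      also have "\<dots> \<longleftrightarrow> C \<subseteq> IA" using act c(1) by blast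
      finally show ?thesis using c(3) by simp
    qed
    then have k: "Out_quotient_map G T D (Inn G #>\<^bsub>CA\<^esub> \<phi>) = {\<lambda>X\<in>carrier (G Mod D). X} \<longleftrightarrow> \<phi> \<in> IA"
      if "\<phi> \<in> carrier CA" for \<phi> using that by blast
    have one: "\<one>\<^bsub>Out (G Mod D) (quotient_topology G T D)\<^esub> = {\<lambda>X\<in>carrier (G Mod D). X}"
      unfolding Out_def one_FactGroup by (rule Inn_abelianization)
    have car: "carrier (Out G T) = (\<lambda>\<phi>. Inn G #>\<^bsub>CA\<^esub> \<phi>) ` carrier CA"
      unfolding Out_def by (rule carrier_FactGroup)
    show ?thesis unfolding kernel_def one car
    proof (intro equalityI subsetI)
      fix C assume "C \<in> {x. x \<in> (\<lambda>\<phi>. Inn G #>\<^bsub>CA\<^esub> \<phi>) ` carrier CA \<and> Out_quotient_map G T D x = {\<lambda>X\<in>carrier (G Mod D). X}}"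
      then obtain \<phi> where "\<phi> \<in> carrier CA" "C = Inn G #>\<^bsub>CA\<^esub> \<phi>" "Out_quotient_map G T D C = {\<lambda>X\<in>carrier (G Mod D). X}"
        by blast
      then show "C \<in> (\<lambda>\<phi>. Inn G #>\<^bsub>CA\<^esub> \<phi>) ` IA" using k by blast
    next
      fix C assume "C \<in> (\<lambda>\<phi>. Inn G #>\<^bsub>CA\<^esub> \<phi>) ` IA"
      then obtain \<phi> where \<phi>: "\<phi> \<in> IA" "C = Inn G #>\<^bsub>CA\<^esub> \<phi>" by blast
      have "\<phi> \<in> carrier CA" using IA.subset \<phi>(1) by blast
      then show "C \<in> {x. x \<in> (\<lambda>\<phi>. Inn G #>\<^bsub>CA\<^esub> \<phi>) ` carrier CA \<and> Out_quotient_map G T D x = {\<lambda>X\<in>carrier (G Mod D). X}}"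
        using k \<phi> by blast
    qed
  qed
  have rc: "Inn G #>\<^bsub>?B\<^esub> \<phi> = Inn G #>\<^bsub>CA\<^esub> \<phi>" for \<phi> by (simp add: r_coset_def)
  have "?B Mod Inn G = (CA Mod Inn G)\<lparr>carrier := (\<lambda>\<phi>. Inn G #>\<^bsub>CA\<^esub> \<phi>) ` IA\<rparr>"
    unfolding FactGroup_def by (auto simp: RCOSETS_def rc set_mult_def fun_eq_iff)
  then show ?thesis unfolding Torelli_def Let_def ker by (simp add: Out_def)
qed

end

section \<open>The Magnus representation of the pro-p completion\<close>

lemma finite_image_via:
  assumes "finite (F ` S)" "\<And>c d. c \<in> S \<Longrightarrow> d \<in> S \<Longrightarrow> F c = F d \<Longrightarrow> h c = h d"
  shows "finite (h ` S)"
proof -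
  have "h ` S \<subseteq> (\<lambda>y. h (SOME c. c \<in> S \<and> F c = y)) ` (F ` S)"
  proof
    fix z assume "z \<in> h ` S"
    then obtain c where c: "c \<in> S" "z = h c" by blast
    let ?d = "SOME d. d \<in> S \<and> F d = F c"
    have d: "?d \<in> S \<and> F ?d = F c" by (rule someI[of "\<lambda>d. d \<in> S \<and> F d = F c" c]) (use c in simp)
    then have "z = h ?d" using assms(2)[of c ?d] c by simp
    then show "z \<in> (\<lambda>y. h (SOME c. c \<in> S \<and> F c = y)) ` (F ` S)" using c(1) by blast
  qed
  then show ?thesis using assms(1) by (meson finite_imageI finite_subset)
qed

context commutation_graph
begin

text \<open>The inverse letter goes to the inverse of \<open>1 + v\<close> modulo degree \<open>k\<close>.\<close>

definition magnus_letter :: "nat \<Rightarrow> 'a \<times> bool \<Rightarrow> 'a free_alg" where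
  "magnus_letter k l = (if snd l then 1 + var (fst l) else trunc_inv k (1 + var (fst l)))"

definition magnus_word :: "nat \<Rightarrow> 'a word \<Rightarrow> 'a free_alg" where
  "magnus_word k w = prod_list (map (magnus_letter k) w)"

lemma var_unit: "(1 + var a) - 1 \<in> J M 1" using var_in_J1 by simp

lemma magnus_word_append: "magnus_word k (v @ w) = magnus_word k v * magnus_word k w" by (simp add: magnus_word_def)
lemma magnus_word_Nil: "magnus_word k [] = 1" by (simp add: magnus_word_def)

lemma magnus_word_unit: "k \<ge> 1 \<Longrightarrow> magnus_word k w - 1 \<in> J M 1"
proof (induction w)
  case (Cons l w)
  have "magnus_letter k l - 1 \<in> J M 1" unfolding magnus_letter_def using var_in_J1 trunc_inv(3)[OF var_unit] Cons.prems by simp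
  then show ?case using unit_mult[OF _ Cons.IH[OF Cons.prems], of "magnus_letter k l"] by (simp add: magnus_word_def)
qed (simp add: magnus_word_Nil)

lemma magnus_letter_cancel: "magnus_letter k (s, b) * magnus_letter k (s, \<not> b) - 1 \<in> J M k"
  unfolding magnus_letter_def using trunc_inv(1,2)[OF var_unit] by (cases b) simp_all

lemma magnus_word_relator:
  assumes "{u, v} \<in> E" shows "magnus_word k [(u, True), (v, True), (u, False), (v, False)] - 1 \<in> J M k"
proof -
  let ?u = "1 + var u" and ?v = "1 + var v"
  have "?u * ?v - ?v * ?u \<in> J M k" using var_comm[OF assms] by (simp add: algebra_simps)
  then have "?u * ?v * (trunc_inv k ?u * trunc_inv k ?v) - ?v * ?u * (trunc_inv k ?u * trunc_inv k ?v) \<in> J M k"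
    by (rule J_mult_cong[OF _ J_refl])
  moreover have "?v * (?u * trunc_inv k ?u) * trunc_inv k ?v - ?v * 1 * trunc_inv k ?v \<in> J M k"
    by (rule J_mult_cong[OF J_mult_cong[OF J_refl trunc_inv(1)[OF var_unit]] J_refl])
  moreover have "?v * trunc_inv k ?v - 1 \<in> J M k" by (rule trunc_inv(1)[OF var_unit])
  ultimately have "?u * (?v * (trunc_inv k ?u * trunc_inv k ?v)) - 1 \<in> J M k"
    by (simp only: mult.assoc mult_1_left mult_1_right) (blast intro: J_trans)
  then show ?thesis by (simp add: magnus_word_def magnus_letter_def)
qed

abbreviation "Rel \<equiv> {[(u, True), (v, True), (u, False), (v, False)] | u v. {u, v} \<in> E}"

lemma magnus_word_pres_eq: "pres_eq V Rel v w \<Longrightarrow> magnus_word k v - magnus_word k w \<in> J M k"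
proof (induction rule: pres_eq.induct)
  case (refl w) show ?case by simp
next
  case (sym v w) then show ?case by (blast intro: J_sym)
next
  case (trans u v w) then show ?case by (blast intro: J_trans)
next
  case (cancel u v s b)
  have "magnus_word k u * (magnus_letter k (s, b) * magnus_letter k (s, \<not> b)) * magnus_word k v - magnus_word k u * 1 * magnus_word k v \<in> J M k"
    by (rule J_mult_cong[OF J_mult_cong[OF J_refl magnus_letter_cancel] J_refl])
  then show ?case unfolding magnus_word_append by (simp add: magnus_word_def mult.assoc)
next
  case (relator u v r)
  then have "magnus_word k r - 1 \<in> J M k" using magnus_word_relator by blast
  then have "magnus_word k u * magnus_word k r * magnus_word k v - magnus_word k u * 1 * magnus_word k v \<in> J M k"
    by (intro J_mult_cong[OF J_mult_cong[OF J_refl] J_refl])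
  then show ?case unfolding magnus_word_append by (simp add: mult.assoc)
qed

lemma magnus_word_mono: assumes "k' \<le> k" shows "magnus_word k w - magnus_word k' w \<in> J M k'"
proof (induction w)
  case (Cons l w)
  have "magnus_letter k l - magnus_letter k' l \<in> J M k'"
  proof (cases "snd l")
    case False
    let ?u = "1 + var (fst l)"
    have "trunc_inv k ?u * (?u * trunc_inv k' ?u) - trunc_inv k ?u * 1 \<in> J M k'"
      by (rule J_mult_cong[OF J_refl trunc_inv(1)[OF var_unit]])
    moreover have "trunc_inv k ?u * ?u * trunc_inv k' ?u - 1 * trunc_inv k' ?u \<in> J M k'"
      by (rule J_mult_cong[OF J_mono[OF trunc_inv(2)[OF var_unit] dvd_refl assms] J_refl])
    ultimately have "trunc_inv k ?u - trunc_inv k' ?u \<in> J M k'"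
      by (simp only: mult.assoc mult_1_left mult_1_right) (blast intro: J_trans J_sym)
    then show ?thesis using False by (simp add: magnus_letter_def)
  qed (simp add: magnus_letter_def)
  then show ?case using J_mult_cong[OF _ Cons.IH] by (simp add: magnus_word_def)
qed (simp add: magnus_word_Nil)

end

locale raag_pro_p = commutation_graph V E for V :: "'a set" and E :: "'a set set" +
  fixes p :: nat assumes prime_p: "prime p"
begin

abbreviation "A \<equiv> raag V E"

lemma raag_presented: "A = presented_group V Rel" by (simp add: raag_def)

sublocale pro_p A p
  by (intro pro_p.intro pro_p_axioms.intro prime_p) (simp add: raag_presented group_presented)

abbreviation "cls \<equiv> word_class V Rel"
abbreviation "LV \<equiv> lists (V \<times> (UNIV :: bool set))"
abbreviation gen :: "'a \<Rightarrow> 'a word set" where "gen a \<equiv> cls [(a, True)]"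

lemma A_carrier: "carrier A = cls ` LV" unfolding raag_presented by (rule carrier_presented)
lemma A_mult: "v \<in> LV \<Longrightarrow> w \<in> LV \<Longrightarrow> cls v \<otimes>\<^bsub>A\<^esub> cls w = cls (v @ w)" unfolding raag_presented by (rule mult_presented)
lemma A_one: "\<one>\<^bsub>A\<^esub> = cls []" unfolding raag_presented by (rule one_presented)
lemma A_generate: "carrier A = generate A (gen ` V)" unfolding raag_presented by (rule presented_generate)
lemma gen_closed: "a \<in> V \<Longrightarrow> gen a \<in> carrier A" by (auto simp: A_carrier)

definition magnus_class :: "nat \<Rightarrow> 'a word set \<Rightarrow> 'a free_alg" where "magnus_class k c = magnus_word k (SOME w. w \<in> c)"

lemma magnus_class_cls: assumes "w \<in> LV" shows "magnus_class k (cls w) - magnus_word k w \<in> J M k"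
proof -
  have "w \<in> cls w" using assms by (simp only: in_word_class pres_eq.refl)
  then have "(SOME v. v \<in> cls w) \<in> cls w" by (rule someI)
  then have "pres_eq V Rel w (SOME v. v \<in> cls w)" by (simp only: in_word_class)
  then show ?thesis unfolding magnus_class_def by (rule J_sym[OF magnus_word_pres_eq])
qed

lemma magnus_class_unit: "k \<ge> 1 \<Longrightarrow> magnus_class k c - 1 \<in> J M 1" unfolding magnus_class_def by (rule magnus_word_unit)

lemma magnus_class_one: "magnus_class k \<one>\<^bsub>A\<^esub> - 1 \<in> J M k" using magnus_class_cls[of "[]" k M] by (simp add: A_one magnus_word_Nil)

lemma magnus_class_gen: "a \<in> V \<Longrightarrow> magnus_class k (gen a) - (1 + var a) \<in> J M k"
  using magnus_class_cls[of "[(a, True)]" k M] by (simp add: magnus_word_def magnus_letter_def)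

lemma magnus_class_mult: assumes "c \<in> carrier A" "d \<in> carrier A" shows "magnus_class k (c \<otimes>\<^bsub>A\<^esub> d) - magnus_class k c * magnus_class k d \<in> J M k"
proof -
  obtain v w where v: "v \<in> LV" "c = cls v" and w: "w \<in> LV" "d = cls w" using assms by (auto simp: A_carrier)
  have vw: "v @ w \<in> LV" using v(1) w(1) by simp
  have "magnus_class k (cls (v @ w)) - magnus_word k v * magnus_word k w \<in> J M k" using magnus_class_cls[OF vw] by (simp only: magnus_word_append)
  moreover have "magnus_word k v * magnus_word k w - magnus_class k c * magnus_class k d \<in> J M k"
    unfolding v(2) w(2) by (rule J_mult_cong[OF J_sym[OF magnus_class_cls[OF v(1)]] J_sym[OF magnus_class_cls[OF w(1)]]])
  ultimately show ?thesis unfolding v(2) w(2) A_mult[OF v(1) w(1)] by (rule J_trans)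
qed

lemma magnus_class_inv: assumes "c \<in> carrier A"
  shows "magnus_class k c * magnus_class k (inv\<^bsub>A\<^esub> c) - 1 \<in> J M k" "magnus_class k (inv\<^bsub>A\<^esub> c) * magnus_class k c - 1 \<in> J M k"
  using J_trans[OF J_sym[OF magnus_class_mult[OF assms A.inv_closed[OF assms]]] _] J_trans[OF J_sym[OF magnus_class_mult[OF A.inv_closed[OF assms] assms]] _]
    A.r_inv[OF assms] A.l_inv[OF assms] magnus_class_one by metis+

lemma magnus_class_mono: "k' \<le> k \<Longrightarrow> magnus_class k c - magnus_class k' c \<in> J M k'" unfolding magnus_class_def by (rule magnus_word_mono)

lemma magnus_class_quot: assumes c: "c \<in> carrier A" and d: "d \<in> carrier A"
  shows "magnus_class k (c \<otimes>\<^bsub>A\<^esub> inv\<^bsub>A\<^esub> d) - 1 \<in> J M k \<longleftrightarrow> magnus_class k c - magnus_class k d \<in> J M k"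
proof
  assume "magnus_class k c - magnus_class k d \<in> J M k"
  then have "magnus_class k c * magnus_class k (inv\<^bsub>A\<^esub> d) - magnus_class k d * magnus_class k (inv\<^bsub>A\<^esub> d) \<in> J M k" by (rule J_mult_cong[OF _ J_refl])
  then show "magnus_class k (c \<otimes>\<^bsub>A\<^esub> inv\<^bsub>A\<^esub> d) - 1 \<in> J M k"
    using J_trans[OF J_trans[OF magnus_class_mult[OF c A.inv_closed[OF d]]] magnus_class_inv(1)[OF d]] by blast
next
  assume a: "magnus_class k (c \<otimes>\<^bsub>A\<^esub> inv\<^bsub>A\<^esub> d) - 1 \<in> J M k"
  have "c = c \<otimes>\<^bsub>A\<^esub> inv\<^bsub>A\<^esub> d \<otimes>\<^bsub>A\<^esub> d" using c d by (simp add: A.m_assoc)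
  then have "magnus_class k c - magnus_class k (c \<otimes>\<^bsub>A\<^esub> inv\<^bsub>A\<^esub> d) * magnus_class k d \<in> J M k"
    using magnus_class_mult[of "c \<otimes>\<^bsub>A\<^esub> inv\<^bsub>A\<^esub> d" d k M] c d by simp
  moreover have "magnus_class k (c \<otimes>\<^bsub>A\<^esub> inv\<^bsub>A\<^esub> d) * magnus_class k d - 1 * magnus_class k d \<in> J M k" by (rule J_mult_cong[OF a J_refl])
  ultimately show "magnus_class k c - magnus_class k d \<in> J M k" by (simp only: mult_1_left) (rule J_trans)
qed

text \<open>The kernel of the Magnus map to the units of the algebra over \<open>\<int>/p\<^sup>n\<close>, truncated at degree \<open>k\<close>.\<close>

definition K :: "nat \<Rightarrow> nat \<Rightarrow> 'a word set set" where
  "K n k = {c \<in> carrier A. magnus_class k c - 1 \<in> J (int p ^ n) k}"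

lemma K_subgroup: "subgroup (K n k) A"
proof (rule A.subgroupI)
  show "K n k \<subseteq> carrier A" by (auto simp: K_def)
  have "\<one>\<^bsub>A\<^esub> \<in> K n k" using magnus_class_one A.one_closed unfolding K_def by blast
  then show "K n k \<noteq> {}" by blast
  fix c assume "c \<in> K n k"
  then have c: "c \<in> carrier A" "magnus_class k c - 1 \<in> J (int p ^ n) k" by (auto simp: K_def)
  have "magnus_class k (inv\<^bsub>A\<^esub> c) * 1 - magnus_class k (inv\<^bsub>A\<^esub> c) * magnus_class k c \<in> J (int p ^ n) k"
    by (rule J_mult_cong[OF J_refl J_sym[OF c(2)]])
  then have "magnus_class k (inv\<^bsub>A\<^esub> c) - 1 \<in> J (int p ^ n) k" using J_trans[OF _ magnus_class_inv(2)[OF c(1)]] by simp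
  then show "inv\<^bsub>A\<^esub> c \<in> K n k" using c(1) by (simp add: K_def)
  fix d assume "d \<in> K n k"
  then have d: "d \<in> carrier A" "magnus_class k d - 1 \<in> J (int p ^ n) k" by (auto simp: K_def)
  have "magnus_class k (c \<otimes>\<^bsub>A\<^esub> d) - 1 \<in> J (int p ^ n) k"
    by (rule J_trans[OF magnus_class_mult[OF c(1) d(1)] unit_mult[OF c(2) d(2)]])
  then show "c \<otimes>\<^bsub>A\<^esub> d \<in> K n k" using c(1) d(1) by (simp add: K_def)
qed

lemma K_normal: "K n k \<lhd> A"
  unfolding A.normal_inv_iff
proof (intro conjI ballI K_subgroup)
  fix d c assume d: "d \<in> carrier A" and "c \<in> K n k"
  then have c: "c \<in> carrier A" "magnus_class k c - 1 \<in> J (int p ^ n) k" by (auto simp: K_def)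
  have "magnus_class k (d \<otimes>\<^bsub>A\<^esub> c) - magnus_class k d * 1 \<in> J (int p ^ n) k"
    by (rule J_trans[OF magnus_class_mult[OF d c(1)] J_mult_cong[OF J_refl c(2)]])
  then have "magnus_class k (d \<otimes>\<^bsub>A\<^esub> c \<otimes>\<^bsub>A\<^esub> inv\<^bsub>A\<^esub> d) - 1 \<in> J (int p ^ n) k"
    using magnus_class_quot[OF A.m_closed[OF d c(1)] d] by simp
  then show "d \<otimes>\<^bsub>A\<^esub> c \<otimes>\<^bsub>A\<^esub> inv\<^bsub>A\<^esub> d \<in> K n k" using c(1) d by (simp add: K_def)
qed

lemma K_coset_eq: assumes "c \<in> carrier A" "d \<in> carrier A"
  shows "K n k #>\<^bsub>A\<^esub> c = K n k #>\<^bsub>A\<^esub> d \<longleftrightarrow> magnus_class k c - magnus_class k d \<in> J (int p ^ n) k"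
  unfolding A.coset_eq_iff[OF K_subgroup assms] using magnus_class_quot[OF assms] assms by (simp add: K_def)

lemma magnus_class_pow: "c \<in> carrier A \<Longrightarrow> magnus_class k (c [^]\<^bsub>A\<^esub> (r::nat)) - magnus_class k c ^ r \<in> J M k"
proof (induction r)
  case 0 show ?case using magnus_class_one by simp
next
  case (Suc r)
  have "magnus_class k (c [^]\<^bsub>A\<^esub> r \<otimes>\<^bsub>A\<^esub> c) - magnus_class k (c [^]\<^bsub>A\<^esub> r) * magnus_class k c \<in> J M k" by (rule magnus_class_mult) (use Suc.prems in simp_all)
  moreover have "magnus_class k (c [^]\<^bsub>A\<^esub> r) * magnus_class k c - magnus_class k c ^ r * magnus_class k c \<in> J M k"
    by (rule J_mult_cong[OF Suc.IH[OF Suc.prems] J_refl])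
  ultimately show ?case unfolding A.nat_pow_Suc power_Suc2 by (rule J_trans)
qed

text \<open>The algebra is finite, hence so is the index, and units with constant term one have \<open>p\<close>-power order.\<close>

lemma K_in_P: "K n k \<in> P"
proof (rule P_I[OF K_normal, where r = "n * k"])
  fix c assume c: "c \<in> carrier A"
  have "magnus_class k c ^ (p ^ (n * k)) - 1 \<in> J (int p ^ n) k"
  proof (cases "k \<ge> 1")
    case True
    have "magnus_class k c - 1 \<in> J (int (p ^ n)) 1" by (rule magnus_class_unit[OF True])
    from power_modulus[OF this, of k] have "magnus_class k c ^ ((p ^ n) ^ k) - 1 \<in> J (int p ^ n) (Suc k)" by simp
    then show ?thesis using J_mono[OF _ dvd_refl, of _ _ "Suc k" k] by (simp add: power_mult)
  next
    case False
    then have "k = 0" by simp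
    then show ?thesis by (simp only: J_0)
  qed
  from J_trans[OF magnus_class_pow[OF c] this] show "c [^]\<^bsub>A\<^esub> (p ^ (n * k) :: nat) \<in> K n k"
    using c by (simp add: K_def)
next
  let ?S = "{w. set w \<subseteq> V \<and> length w \<le> k}"
  \<comment> \<open>finitely many coefficients modulo \<open>p\<^sup>n\<close> determine a coset\<close>
  let ?F = "\<lambda>c. \<lambda>w\<in>?S. Poly_Mapping.lookup (magnus_class k c) (Word w) mod int p ^ n"
  have "finite ((\<lambda>c. K n k #>\<^bsub>A\<^esub> c) ` carrier A)"
  proof (rule finite_image_via[where F = ?F])
    have "?F ` carrier A \<subseteq> (\<Pi>\<^sub>E w\<in>?S. {0..<int p ^ n})"
      using prime_gt_0_nat[OF prime_p] by (intro image_subsetI restrict_PiE_iff[THEN iffD2] ballI) simp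
    then show "finite (?F ` carrier A)"
      by (rule finite_subset) (intro finite_PiE finite_lists_length_le finV finite_atLeastLessThan_int)
    fix c d assume c: "c \<in> carrier A" and d: "d \<in> carrier A" and eq: "?F c = ?F d"
    have "magnus_class k c - magnus_class k d \<in> J (int p ^ n) k"
    proof (rule J_coeffI)
      fix w assume "set w \<subseteq> V" "length w < k"
      then have "Poly_Mapping.lookup (magnus_class k c) (Word w) mod int p ^ n = Poly_Mapping.lookup (magnus_class k d) (Word w) mod int p ^ n"
        using fun_cong[OF eq, of w] by simp
      then show "int p ^ n dvd Poly_Mapping.lookup (magnus_class k c - magnus_class k d) (Word w)"
        by (simp add: lookup_minus mod_eq_dvd_iff)
    qed
    then show "K n k #>\<^bsub>A\<^esub> c = K n k #>\<^bsub>A\<^esub> d" using K_coset_eq[OF c d] by blast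
  qed
  then show "finite (carrier (A Mod K n k))" by (simp add: carrier_FactGroup)
qed

text \<open>An element of the completion has a coordinate at \<open>K n k\<close>, and the Magnus map is constant on this coset up to
  \<open>J\<close>.\<close>

definition magnus_rep :: "nat \<Rightarrow> nat \<Rightarrow> ('a word set set \<Rightarrow> 'a word set set) \<Rightarrow> 'a free_alg" where
  "magnus_rep n k g = magnus_class k (SOME c. c \<in> carrier A \<and> g (K n k) = K n k #>\<^bsub>A\<^esub> c)"

lemma magnus_rep_coset: assumes "c \<in> carrier A" "g (K n k) = K n k #>\<^bsub>A\<^esub> c"
  shows "magnus_rep n k g - magnus_class k c \<in> J (int p ^ n) k"
proof -
  let ?d = "SOME c. c \<in> carrier A \<and> g (K n k) = K n k #>\<^bsub>A\<^esub> c"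
  have d: "?d \<in> carrier A \<and> g (K n k) = K n k #>\<^bsub>A\<^esub> ?d"
    by (rule someI[of "\<lambda>c. c \<in> carrier A \<and> g (K n k) = K n k #>\<^bsub>A\<^esub> c" c]) (use assms in simp)
  then have "K n k #>\<^bsub>A\<^esub> ?d = K n k #>\<^bsub>A\<^esub> c" using assms(2) by simp
  then show ?thesis unfolding magnus_rep_def using K_coset_eq d assms(1) by blast
qed

lemma magnus_rep_cong: "g (K n k) = h (K n k) \<Longrightarrow> magnus_rep n k g = magnus_rep n k h" by (simp add: magnus_rep_def)

lemma K_mono: assumes "n' \<le> n" "k' \<le> k" shows "K n k \<subseteq> K n' k'"
proof
  fix c assume "c \<in> K n k"
  then have c: "c \<in> carrier A" "magnus_class k c - 1 \<in> J (int p ^ n) k" by (auto simp: K_def)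
  have "magnus_class k' c - magnus_class k c \<in> J (int p ^ n') k'" by (rule J_sym[OF magnus_class_mono[OF assms(2)]])
  moreover have "magnus_class k c - 1 \<in> J (int p ^ n') k'" by (rule J_mono[OF c(2) _ assms(2)]) (rule le_imp_power_dvd[OF assms(1)])
  ultimately show "c \<in> K n' k'" using J_trans c(1) unfolding K_def by blast
qed

abbreviation top_gen :: "'a \<Rightarrow> 'a word set set \<Rightarrow> 'a word set set" where "top_gen a \<equiv> emb (gen a)"

lemma magnus: "magnus_group V E PG p magnus_rep top_gen"
proof (intro magnus_group.intro magnus_group_axioms.intro)
  show "commutation_graph V E" by (rule commutation_graph_axioms)
  show "group PG" by (rule group_PG)
  show "prime p" by (rule prime_p)
  show "top_gen a \<in> carrier PG" if "a \<in> V" for a using emb_closed[OF gen_closed[OF that]] .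
  interpret e: group_hom A PG emb by (rule emb_hom)
  show "top_gen a \<otimes>\<^bsub>PG\<^esub> top_gen b = top_gen b \<otimes>\<^bsub>PG\<^esub> top_gen a" if ab: "{a, b} \<in> E" for a b
  proof -
    have V: "a \<in> V" "b \<in> V" using E2[OF ab] by auto
    have w: "[(a, True)] \<in> LV" "[(b, True)] \<in> LV" using V by auto
    have r: "[(a, True), (b, True), (a, False), (b, False)] \<in> LV" using V by auto
    have "pres_eq V Rel ([] @ [(a, True), (b, True), (a, False), (b, False)] @ [(b, True), (a, True)]) ([] @ [(b, True), (a, True)])"
      by (rule pres_eq.relator) (use ab V in auto)
    then have 1: "pres_eq V Rel [(a, True), (b, True), (a, False), (b, False), (b, True), (a, True)] [(b, True), (a, True)]" by simp
    have "pres_eq V Rel ([(a, True), (b, True), (a, False)] @ [(b, False), (b, \<not> False)] @ [(a, True)]) ([(a, True), (b, True), (a, False)] @ [(a, True)])"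
      by (rule pres_eq.cancel) (use V in auto)
    then have 2: "pres_eq V Rel [(a, True), (b, True), (a, False), (b, False), (b, True), (a, True)] [(a, True), (b, True), (a, False), (a, True)]" by simp
    have "pres_eq V Rel ([(a, True), (b, True)] @ [(a, False), (a, \<not> False)] @ []) ([(a, True), (b, True)] @ [])"
      by (rule pres_eq.cancel) (use V in auto)
    then have 3: "pres_eq V Rel [(a, True), (b, True), (a, False), (a, True)] [(a, True), (b, True)]" by simp
    have "cls ([(a, True)] @ [(b, True)]) = cls ([(b, True)] @ [(a, True)])"
      using pres_eq.trans[OF pres_eq.sym[OF pres_eq.trans[OF 2 3]] 1] word_class_eq by simp
    then have "gen a \<otimes>\<^bsub>A\<^esub> gen b = gen b \<otimes>\<^bsub>A\<^esub> gen a" by (simp only: A_mult[OF w] A_mult[OF w(2,1)])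
    then show ?thesis using e.hom_mult[OF gen_closed[OF V(1)] gen_closed[OF V(2)]] e.hom_mult[OF gen_closed[OF V(2)] gen_closed[OF V(1)]] by simp
  qed
  show "magnus_rep n k (g \<otimes>\<^bsub>PG\<^esub> h) - magnus_rep n k g * magnus_rep n k h \<in> J (int p ^ n) k" if g: "g \<in> carrier PG" and h: "h \<in> carrier PG" for g h n k
  proof -
    obtain c where c: "c \<in> carrier A" "g (K n k) = K n k #>\<^bsub>A\<^esub> c" using PG_at_coset[OF g K_in_P] by blast
    obtain d where d: "d \<in> carrier A" "h (K n k) = K n k #>\<^bsub>A\<^esub> d" using PG_at_coset[OF h K_in_P] by blast
    have "(g \<otimes>\<^bsub>PG\<^esub> h) (K n k) = K n k #>\<^bsub>A\<^esub> (c \<otimes>\<^bsub>A\<^esub> d)"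
      by (simp add: PG_mult_at[OF K_in_P] c(2) d(2) normal.rcos_sum[OF K_normal c(1) d(1)])
    then have "magnus_rep n k (g \<otimes>\<^bsub>PG\<^esub> h) - magnus_class k (c \<otimes>\<^bsub>A\<^esub> d) \<in> J (int p ^ n) k"
      by (rule magnus_rep_coset[of _ "g \<otimes>\<^bsub>PG\<^esub> h" n k, OF A.m_closed[OF c(1) d(1)]])
    moreover have "magnus_class k (c \<otimes>\<^bsub>A\<^esub> d) - magnus_class k c * magnus_class k d \<in> J (int p ^ n) k" by (rule magnus_class_mult[OF c(1) d(1)])
    moreover have "magnus_class k c * magnus_class k d - magnus_rep n k g * magnus_rep n k h \<in> J (int p ^ n) k"
      by (rule J_mult_cong[OF J_sym[OF magnus_rep_coset[of c g n k, OF c]] J_sym[OF magnus_rep_coset[of d h n k, OF d]]])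
    ultimately show ?thesis by (blast intro: J_trans)
  qed
  show "magnus_rep n k g - 1 \<in> J (int p ^ n) 1" if "g \<in> carrier PG" "k \<ge> 1" for g n k
    unfolding magnus_rep_def by (rule magnus_class_unit[OF that(2)])
  show "magnus_rep n k (top_gen a) - (1 + var a) \<in> J (int p ^ n) k" if a: "a \<in> V" for a n k
    by (rule J_trans[OF magnus_rep_coset[of _ "top_gen a" n k, OF gen_closed[OF a] emb_at[OF K_in_P]] magnus_class_gen[OF a]])
  show "magnus_rep n k g - magnus_rep n' k' g \<in> J (int p ^ n') k'" if g: "g \<in> carrier PG" and nk: "n' \<le> n" "k' \<le> k" for g n k n' k'
  proof -
    obtain c where c: "c \<in> carrier A" "g (K n k) = K n k #>\<^bsub>A\<^esub> c" using PG_at_coset[OF g K_in_P] by blast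
    have "g (K n' k') = K n' k' #>\<^bsub>A\<^esub> c" by (rule PG_compat_coset[OF g K_in_P K_in_P K_mono[OF nk] c])
    then have "magnus_class k' c - magnus_rep n' k' g \<in> J (int p ^ n') k'" by (intro J_sym[OF magnus_rep_coset[of c g n' k', OF c(1)]])
    moreover have "magnus_class k c - magnus_class k' c \<in> J (int p ^ n') k'" by (rule magnus_class_mono[OF nk(2)])
    moreover have "magnus_rep n k g - magnus_class k c \<in> J (int p ^ n') k'"
      by (rule J_mono[OF magnus_rep_coset[of c g n k, OF c] le_imp_power_dvd[OF nk(1)] nk(2)])
    ultimately show ?thesis by (blast intro: J_trans)
  qed
qed

sublocale M: magnus_group V E PG p magnus_rep top_gen by (rule magnus)

sublocale C: compact_group PG PT
  by (intro compact_group.intro compact_group_axioms.intro group_PG topspace_PT compact_PT Hausdorff_PT conj_continuous)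

lemma emb_generate: assumes "c \<in> carrier A" shows "emb c \<in> generate PG (top_gen ` V)"
proof -
  interpret e: group_hom A PG emb by (rule emb_hom)
  have "gen ` V \<subseteq> carrier A" using gen_closed by blast
  then have "emb ` generate A (gen ` V) = generate PG (emb ` gen ` V)" by (rule e.generate_img[symmetric])
  then have "generate PG (top_gen ` V) = emb ` carrier A" unfolding A_generate image_image by (rule HOL.sym)
  then show ?thesis using assms by (simp only: imageI)
qed

lemma approximable_CA: assumes "\<phi> \<in> carrier C.CA" shows "M.approximable \<phi>"
  unfolding M.approximable_def
proof (intro conjI allI ballI)
  show "\<phi> \<in> hom PG PG" by (rule C.CA_auto(1)[OF assms])
  fix n k g assume g: "g \<in> carrier PG"
  obtain c where c: "c \<in> carrier A" "emb c (K n k) = g (K n k)" "\<phi> (emb c) (K n k) = \<phi> g (K n k)"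
    using emb_approx[OF C.CA_auto(5)[OF assms] C.CA_auto(1)[OF assms] K_in_P K_in_P g] by blast
  show "\<exists>h\<in>generate PG (top_gen ` V). magnus_rep n k g = magnus_rep n k h \<and> magnus_rep n k (\<phi> g) = magnus_rep n k (\<phi> h)"
    by (rule bexI[OF _ emb_generate[OF c(1)]], rule conjI[OF magnus_rep_cong[of g n k "emb c", OF c(2)[symmetric]] magnus_rep_cong[of "\<phi> g" n k "\<phi> (emb c)", OF c(3)[symmetric]]])
qed

end

section \<open>Automorphisms that are inner at every level\<close>

context raag_pro_p
begin

text \<open>Coleman's argument.  A unit \<open>u\<close> conjugating modulo \<open>p\<close> and modulo a degree that kills the
  group ring of \<open>Q = A / N\<close> is pushed to this group ring: \<open>U q\<close> is the coefficient of \<open>q\<close> in its image,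
  and \<open>h q\<close> is the corresponding functional.  The relation between \<open>u\<close> and \<open>\<phi>\<close> makes \<open>U\<close> constant along the
  orbits of \<open>q \<mapsto> \<alpha> c q (\<beta> c)\<^sup>-\<^sup>1\<close>, where \<open>\<alpha> c\<close> and \<open>\<beta> c\<close> are the images in \<open>Q\<close> of \<open>c\<close> with and without \<open>\<phi>\<close>.\<close>

lemma conjugating_coset:
  assumes \<phi>: "\<phi> \<in> carrier C.CA" and inner_mod: "\<And>k. k \<ge> 2 \<Longrightarrow> M.inner_mod k \<phi>" and N: "N \<in> P"
  shows "\<exists>q\<in>carrier (A Mod N). \<forall>g\<in>carrier PG. \<phi> g N <#>\<^bsub>A\<^esub> q = q <#>\<^bsub>A\<^esub> g N"
proof -
  let ?Q = "A Mod N"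
  interpret Q: group ?Q by (rule P_group[OF N])
  interpret pr: group_hom A ?Q "\<lambda>c. N #>\<^bsub>A\<^esub> c"
    using normal.r_coset_hom_Mod[OF P_normal[OF N]] by (simp add: group_hom_def group_hom_axioms_def A.is_group P_group[OF N])
  interpret \<phi>: group_hom PG PG \<phi> by (rule C.CA_group_hom[OF \<phi>])
  interpret e: group_hom A PG emb by (rule emb_hom)
  interpret at: group_hom PG ?Q "\<lambda>g. g N" by (rule PG_proj_hom[OF N])
  obtain r where r: "order ?Q = p ^ r" using P_order[OF N] by blast
  define \<beta> where "\<beta> c = N #>\<^bsub>A\<^esub> c" for c
  define \<alpha> where "\<alpha> c = \<phi> (emb c) N" for c
  have \<beta>c: "c \<in> carrier A \<Longrightarrow> \<beta> c \<in> carrier ?Q" for c unfolding \<beta>_def by (rule pr.hom_closed)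
  have \<alpha>c: "c \<in> carrier A \<Longrightarrow> \<alpha> c \<in> carrier ?Q" for c
    unfolding \<alpha>_def by (rule at.hom_closed[OF \<phi>.hom_closed[OF e.hom_closed]])
  have \<beta>m: "c \<in> carrier A \<Longrightarrow> d \<in> carrier A \<Longrightarrow> \<beta> (c \<otimes>\<^bsub>A\<^esub> d) = \<beta> c \<otimes>\<^bsub>?Q\<^esub> \<beta> d" for c d
    unfolding \<beta>_def by (rule pr.hom_mult)
  have \<alpha>m: "c \<in> carrier A \<Longrightarrow> d \<in> carrier A \<Longrightarrow> \<alpha> (c \<otimes>\<^bsub>A\<^esub> d) = \<alpha> c \<otimes>\<^bsub>?Q\<^esub> \<alpha> d" for c d
    unfolding \<alpha>_def by (simp only: e.hom_mult \<phi>.hom_mult at.hom_mult e.hom_closed \<phi>.hom_closed)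
  have \<beta>1: "\<beta> \<one>\<^bsub>A\<^esub> = \<one>\<^bsub>?Q\<^esub>" unfolding \<beta>_def by (rule pr.hom_one)
  have \<alpha>1: "\<alpha> \<one>\<^bsub>A\<^esub> = \<one>\<^bsub>?Q\<^esub>" unfolding \<alpha>_def by (simp only: e.hom_one \<phi>.hom_one at.hom_one)
  have \<beta>i: "c \<in> carrier A \<Longrightarrow> \<beta> (inv\<^bsub>A\<^esub> c) = inv\<^bsub>?Q\<^esub> (\<beta> c)" for c unfolding \<beta>_def by (rule pr.hom_inv)
  have \<alpha>i: "c \<in> carrier A \<Longrightarrow> \<alpha> (inv\<^bsub>A\<^esub> c) = inv\<^bsub>?Q\<^esub> (\<alpha> c)" for c
    unfolding \<alpha>_def by (simp only: e.hom_inv \<phi>.hom_inv at.hom_inv e.hom_closed \<phi>.hom_closed)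
  let ?x = "\<lambda>a. \<beta> (gen a)"
  have xQ: "a \<in> V \<Longrightarrow> ?x a \<in> carrier ?Q" for a by (rule \<beta>c[OF gen_closed])
  define \<delta> where "\<delta> q = (if q = \<one>\<^bsub>?Q\<^esub> then 1 else 0 :: int)" for q
  obtain k0 where k0: "\<And>ws q. set ws \<subseteq> carrier ?Q \<Longrightarrow> k0 \<le> length ws \<Longrightarrow> q \<in> carrier ?Q \<Longrightarrow> int p dvd aug_op ?Q ws \<delta> q"
    using augmentation_nilpotent[OF P_group[OF N] r prime_p, of \<delta>] by blast
  define k where "k = max k0 2"
  have k: "k \<ge> 2" "k \<ge> 1" "k \<ge> k0" by (simp_all add: k_def)
  define h where "h q w = (if set w \<subseteq> V then aug_op ?Q (map ?x w) \<delta> q else 0)" for q w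
  have mapQ: "set w \<subseteq> V \<Longrightarrow> set (map ?x w) \<subseteq> carrier ?Q" for w using xQ by auto
  have hinv: "trace_fun (int p) k (h q)" if q: "q \<in> carrier ?Q" for q
    unfolding trace_fun_def
  proof (intro conjI allI impI)
    fix u a b v assume ab: "{a, b} \<in> E"
    have V: "a \<in> V" "b \<in> V" using E2[OF ab] by auto
    have "top_gen a \<otimes>\<^bsub>PG\<^esub> top_gen b = top_gen b \<otimes>\<^bsub>PG\<^esub> top_gen a" by (rule M.s_comm[OF ab])
    then have "(top_gen a \<otimes>\<^bsub>PG\<^esub> top_gen b) N = (top_gen b \<otimes>\<^bsub>PG\<^esub> top_gen a) N" by simp
    then have xy: "?x a \<otimes>\<^bsub>?Q\<^esub> ?x b = ?x b \<otimes>\<^bsub>?Q\<^esub> ?x a" by (simp add: PG_mult_at[OF N] emb_at[OF N] \<beta>_def)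
    show "int p dvd h q (u @ [a, b] @ v) - h q (u @ [b, a] @ v)"
    proof (cases "set u \<subseteq> V \<and> set v \<subseteq> V")
      case True
      have "aug_op ?Q (map ?x u @ [?x a, ?x b] @ map ?x v) \<delta> q = aug_op ?Q (map ?x u @ [?x b, ?x a] @ map ?x v) \<delta> q"
        by (rule aug_op_commute[OF P_group[OF N] mapQ xQ xQ xy q]) (use True V in auto)
      then show ?thesis using True V by (simp add: h_def)
    qed (auto simp: h_def)
  next
    fix w assume w: "k \<le> length w \<or> \<not> set w \<subseteq> V"
    show "int p dvd h q w"
    proof (cases "set w \<subseteq> V")
      case True
      then have "int p dvd aug_op ?Q (map ?x w) \<delta> q" using k0[OF mapQ[OF True] _ q] w k(3) by simp
      then show ?thesis using True by (simp add: h_def)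
    qed (simp add: h_def)
  qed
  have hD: "int p dvd pair y (h q)" if "y \<in> J (int p) k" "q \<in> carrier ?Q" for y q
    by (rule J_D[OF that(1) hinv[OF that(2)]])
  have hE: "int p dvd pair y (h q) - pair z (h q)" if "y - z \<in> J (int p) k" "q \<in> carrier ?Q" for y z q
    using hD[OF that] by (simp add: pair_diff)
  \<comment> \<open>left multiplication by the Magnus image of \<open>c\<close> becomes left translation by \<open>\<beta> c\<close>\<close>
  have left_gen: "int p dvd pair (magnus_class k (gen a) * y) (h q) - pair y (h (inv\<^bsub>?Q\<^esub> (?x a) \<otimes>\<^bsub>?Q\<^esub> q))"
    if a: "a \<in> V" and q: "q \<in> carrier ?Q" for a y q
  proof -
    have 1: "int p dvd pair (magnus_class k (gen a) * y) (h q) - pair ((1 + var a) * y) (h q)"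
      by (rule hE[OF J_mult_cong[OF magnus_class_gen[OF a] J_refl] q])
    have hs: "h (inv\<^bsub>?Q\<^esub> (?x a) \<otimes>\<^bsub>?Q\<^esub> q) b = h q b + h q (a # b)" for b
      using a by (simp add: h_def aug_op_Cons left_translate_def)
    have "pair ((1 + var a) * y) (h q) = pair y (h q) + pair y (\<lambda>b. h q (a # b))"
      by (simp add: distrib_right pair_add pair_mult[of "var a"] pair_var)
    also have "\<dots> = pair y (\<lambda>b. h q b + h q (a # b))" unfolding pair_def by (simp add: distrib_left sum.distrib)
    also have "\<dots> = pair y (h (inv\<^bsub>?Q\<^esub> (?x a) \<otimes>\<^bsub>?Q\<^esub> q))" unfolding hs[symmetric] by (rule HOL.refl)
    finally show ?thesis using 1 by simp
  qed
  have left: "\<forall>y. \<forall>q\<in>carrier ?Q. int p dvd pair (magnus_class k c * y) (h q) - pair y (h (inv\<^bsub>?Q\<^esub> (\<beta> c) \<otimes>\<^bsub>?Q\<^esub> q))"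
    if "c \<in> carrier A" for c
  proof -
    have "c \<in> generate A (gen ` V)" using that A_generate by simp
    then show ?thesis
    proof (induction c rule: generate.induct)
      case one
      show ?case
      proof (intro allI ballI)
        fix y q assume q: "q \<in> carrier ?Q"
        have "magnus_class k \<one>\<^bsub>A\<^esub> * y - 1 * y \<in> J (int p) k" by (rule J_mult_cong[OF magnus_class_one J_refl])
        then show "int p dvd pair (magnus_class k \<one>\<^bsub>A\<^esub> * y) (h q) - pair y (h (inv\<^bsub>?Q\<^esub> (\<beta> \<one>\<^bsub>A\<^esub>) \<otimes>\<^bsub>?Q\<^esub> q))"
          using hE[of "magnus_class k \<one>\<^bsub>A\<^esub> * y" y q] q Q.l_one[OF q] by (simp only: \<beta>1 Q.inv_one mult_1_left)
      qed
    next
      case (incl c)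
      then show ?case using left_gen by blast
    next
      case (inv c)
      then obtain a where a: "a \<in> V" "c = gen a" by blast
      have cA: "c \<in> carrier A" using a gen_closed by blast
      have gen1: "int p dvd pair (magnus_class k c * y) (h q) - pair y (h (inv\<^bsub>?Q\<^esub> (\<beta> c) \<otimes>\<^bsub>?Q\<^esub> q))" if "q \<in> carrier ?Q" for y q
        unfolding a(2) by (rule left_gen[OF a(1) that])
      show ?case
      proof (intro allI ballI)
        fix y q assume q: "q \<in> carrier ?Q"
        let ?y = "magnus_class k (inv\<^bsub>A\<^esub> c) * y"
        have cq: "\<beta> c \<otimes>\<^bsub>?Q\<^esub> q \<in> carrier ?Q" using \<beta>c[OF cA] q by (rule Q.m_closed)
        have "magnus_class k c * magnus_class k (inv\<^bsub>A\<^esub> c) * y - 1 * y \<in> J (int p) k" by (rule J_mult_cong[OF magnus_class_inv(1)[OF cA] J_refl])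
        then have 1: "int p dvd pair (magnus_class k c * ?y) (h (\<beta> c \<otimes>\<^bsub>?Q\<^esub> q)) - pair y (h (\<beta> c \<otimes>\<^bsub>?Q\<^esub> q))"
          using hE[OF _ cq] by (simp add: mult.assoc)
        have "inv\<^bsub>?Q\<^esub> (\<beta> c) \<otimes>\<^bsub>?Q\<^esub> (\<beta> c \<otimes>\<^bsub>?Q\<^esub> q) = q"
          using \<beta>c[OF cA] q by (simp only: Q.m_assoc[symmetric] Q.inv_closed Q.l_inv Q.l_one)
        then have 2: "int p dvd pair (magnus_class k c * ?y) (h (\<beta> c \<otimes>\<^bsub>?Q\<^esub> q)) - pair ?y (h q)"
          using gen1[OF cq, of ?y] by simp
        have "inv\<^bsub>?Q\<^esub> (\<beta> (inv\<^bsub>A\<^esub> c)) = \<beta> c" using \<beta>i[OF cA] \<beta>c[OF cA] Q.inv_inv by simp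
        then show "int p dvd pair ?y (h q) - pair y (h (inv\<^bsub>?Q\<^esub> (\<beta> (inv\<^bsub>A\<^esub> c)) \<otimes>\<^bsub>?Q\<^esub> q))"
          using dvd_diff[OF 1 2] by simp
      qed
    next
      case (eng c d)
      have cd: "c \<in> carrier A" "d \<in> carrier A" using eng(1,2) A_generate by auto
      show ?case
      proof (intro allI ballI)
        fix y q assume q: "q \<in> carrier ?Q"
        let ?q = "inv\<^bsub>?Q\<^esub> (\<beta> c) \<otimes>\<^bsub>?Q\<^esub> q"
        have q': "?q \<in> carrier ?Q" using \<beta>c[OF cd(1)] q by (intro Q.m_closed Q.inv_closed)
        have "magnus_class k (c \<otimes>\<^bsub>A\<^esub> d) * y - magnus_class k c * magnus_class k d * y \<in> J (int p) k" by (rule J_mult_cong[OF magnus_class_mult[OF cd] J_refl])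
        then have 1: "int p dvd pair (magnus_class k (c \<otimes>\<^bsub>A\<^esub> d) * y) (h q) - pair (magnus_class k c * (magnus_class k d * y)) (h q)"
          using hE[OF _ q] by (simp add: mult.assoc)
        have 2: "int p dvd pair (magnus_class k c * (magnus_class k d * y)) (h q) - pair (magnus_class k d * y) (h ?q)" using eng.IH(1) q by blast
        have 3: "int p dvd pair (magnus_class k d * y) (h ?q) - pair y (h (inv\<^bsub>?Q\<^esub> (\<beta> d) \<otimes>\<^bsub>?Q\<^esub> ?q))" using eng.IH(2) q' by blast
        have "inv\<^bsub>?Q\<^esub> (\<beta> (c \<otimes>\<^bsub>A\<^esub> d)) \<otimes>\<^bsub>?Q\<^esub> q = inv\<^bsub>?Q\<^esub> (\<beta> d) \<otimes>\<^bsub>?Q\<^esub> ?q"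
          using \<beta>c[OF cd(1)] \<beta>c[OF cd(2)] q
          by (simp only: \<beta>m[OF cd] Q.inv_mult_group Q.m_assoc Q.inv_closed)
        then show "int p dvd pair (magnus_class k (c \<otimes>\<^bsub>A\<^esub> d) * y) (h q) - pair y (h (inv\<^bsub>?Q\<^esub> (\<beta> (c \<otimes>\<^bsub>A\<^esub> d)) \<otimes>\<^bsub>?Q\<^esub> q))"
          using dvd_add[OF dvd_add[OF 1 2] 3] by simp
      qed
    qed
  qed
  \<comment> \<open>right multiplication by a generator becomes right translation\<close>
  have right: "pair (y * (1 + var a)) (h q) = pair y (h (q \<otimes>\<^bsub>?Q\<^esub> inv\<^bsub>?Q\<^esub> (?x a)))" if a: "a \<in> V" and q: "q \<in> carrier ?Q" for y a q
  proof -
    note x = xQ[OF a] and ix = Q.inv_closed[OF xQ[OF a]]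
    have \<delta>t: "left_translate ?Q (?x a) \<delta> s = \<delta> (s \<otimes>\<^bsub>?Q\<^esub> inv\<^bsub>?Q\<^esub> (?x a))" if s: "s \<in> carrier ?Q" for s
    proof -
      have "inv\<^bsub>?Q\<^esub> (?x a) \<otimes>\<^bsub>?Q\<^esub> s = \<one>\<^bsub>?Q\<^esub> \<longleftrightarrow> s = ?x a"
        by (rule Q.quotient_eq_one(1)[OF x s])
      moreover have "s \<otimes>\<^bsub>?Q\<^esub> inv\<^bsub>?Q\<^esub> (?x a) = \<one>\<^bsub>?Q\<^esub> \<longleftrightarrow> s = ?x a"
        by (rule Q.quotient_eq_one(2)[OF x s])
      ultimately show ?thesis by (simp only: left_translate_def \<delta>_def)
    qed
    have hs: "h q w + h q (w @ [a]) = h (q \<otimes>\<^bsub>?Q\<^esub> inv\<^bsub>?Q\<^esub> (?x a)) w" for w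
    proof (cases "set w \<subseteq> V")
      case True
      note mw = mapQ[OF True]
      have "aug_op ?Q (map ?x w) (left_translate ?Q (?x a) \<delta>) q = aug_op ?Q (map ?x w) (\<lambda>s. \<delta> (s \<otimes>\<^bsub>?Q\<^esub> inv\<^bsub>?Q\<^esub> (?x a))) q"
        by (rule aug_op_cong_eq[OF P_group[OF N] mw \<delta>t q])
      also have "\<dots> = aug_op ?Q (map ?x w) \<delta> (q \<otimes>\<^bsub>?Q\<^esub> inv\<^bsub>?Q\<^esub> (?x a))"
        by (rule aug_op_right_translate[OF P_group[OF N] mw ix q])
      finally show ?thesis using True a by (simp add: h_def aug_op_snoc aug_op_diff)
    qed (simp add: h_def)
    have "pair (y * (1 + var a)) (h q) = pair y (h q) + pair y (\<lambda>w. h q (w @ [a]))"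
      by (simp add: distrib_left pair_add pair_mult[of y] pair_var)
    also have "\<dots> = pair y (\<lambda>w. h q w + h q (w @ [a]))" unfolding pair_def by (simp add: distrib_left sum.distrib)
    also have "\<dots> = pair y (h (q \<otimes>\<^bsub>?Q\<^esub> inv\<^bsub>?Q\<^esub> (?x a)))" unfolding hs by (rule HOL.refl)
    finally show ?thesis .
  qed
  obtain \<Phi> u where \<Phi>: "M.induces 1 k \<phi> \<Phi>" and u1: "u - 1 \<in> J (int p ^ 1) 1"
      and u: "\<And>x. \<Phi> x * u - u * x \<in> J (int p ^ 1) k"
    using inner_mod[OF k(1)] unfolding M.inner_mod_def by blast
  define U where "U q = pair u (h q)" for q
  have Ugen: "int p dvd U (\<alpha> (gen a) \<otimes>\<^bsub>?Q\<^esub> q \<otimes>\<^bsub>?Q\<^esub> inv\<^bsub>?Q\<^esub> (\<beta> (gen a))) - U q" if a: "a \<in> V" and q: "q \<in> carrier ?Q" for a q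
  proof -
    \<comment> \<open>one \<open>c\<close> that represents \<open>\<phi> s\<^sub>a\<close> both in the Magnus algebra and in \<open>Q\<close>\<close>
    let ?L = "K 1 k \<inter> N"
    have L: "?L \<in> P" by (rule P_Int[OF K_in_P N])
    have ga: "\<phi> (top_gen a) \<in> carrier PG" by (rule \<phi>.hom_closed[OF emb_closed[OF gen_closed[OF a]]])
    obtain c where c: "c \<in> carrier A" "\<phi> (top_gen a) ?L = ?L #>\<^bsub>A\<^esub> c" using PG_at_coset[OF ga L] by blast
    have cK: "\<phi> (top_gen a) (K 1 k) = K 1 k #>\<^bsub>A\<^esub> c" by (rule PG_compat_coset[OF ga L K_in_P _ c]) simp
    have cN: "\<alpha> (gen a) = \<beta> c" unfolding \<alpha>_def \<beta>_def by (rule PG_compat_coset[OF ga L N _ c]) simp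
    let ?q = "\<beta> c \<otimes>\<^bsub>?Q\<^esub> q"
    have q': "?q \<in> carrier ?Q" by (rule Q.m_closed[OF \<beta>c[OF c(1)] q])
    note re = endo_simps[OF J_endoD(1)[OF M.inducesD(1)[OF \<Phi>]]]
    have "\<Phi> (1 + var a) - magnus_rep 1 k (\<phi> (top_gen a)) \<in> J (int p ^ 1) k"
      using M.induces_var[OF \<Phi> a] by (simp add: re algebra_simps)
    moreover have "magnus_rep 1 k (\<phi> (top_gen a)) - magnus_class k c \<in> J (int p ^ 1) k"
      by (rule magnus_rep_coset[of c "\<phi> (top_gen a)" 1 k, OF c(1) cK])
    ultimately have "\<Phi> (1 + var a) - magnus_class k c \<in> J (int p ^ 1) k" by (rule J_trans)
    then have "magnus_class k c * u - \<Phi> (1 + var a) * u \<in> J (int p ^ 1) k" by (intro J_mult_cong[OF J_sym J_refl])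
    from J_trans[OF this u] have "magnus_class k c * u - u * (1 + var a) \<in> J (int p) k" by simp
    then have 1: "int p dvd pair (magnus_class k c * u) (h ?q) - pair (u * (1 + var a)) (h ?q)" by (rule hE[OF _ q'])
    have 2: "int p dvd pair (magnus_class k c * u) (h ?q) - U (inv\<^bsub>?Q\<^esub> (\<beta> c) \<otimes>\<^bsub>?Q\<^esub> ?q)"
      using left[OF c(1)] q' unfolding U_def by blast
    have "inv\<^bsub>?Q\<^esub> (\<beta> c) \<otimes>\<^bsub>?Q\<^esub> ?q = q"
      using \<beta>c[OF c(1)] q by (simp only: Q.m_assoc[symmetric] Q.inv_closed Q.l_inv Q.l_one)
    then have "int p dvd pair (magnus_class k c * u) (h ?q) - U q" using 2 by simp
    from dvd_diff[OF this 1] show ?thesis using right[OF a q', of u] by (simp add: U_def cN)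
  qed
  have Uall: "\<forall>q\<in>carrier ?Q. int p dvd U (\<alpha> c \<otimes>\<^bsub>?Q\<^esub> q \<otimes>\<^bsub>?Q\<^esub> inv\<^bsub>?Q\<^esub> (\<beta> c)) - U q" if "c \<in> carrier A" for c
  proof -
    have "c \<in> generate A (gen ` V)" using that A_generate by simp
    then show ?thesis
    proof (induction c rule: generate.induct)
      case one
      show ?case unfolding \<alpha>1 \<beta>1 using Q.l_one Q.r_one Q.inv_one by (simp del: one_FactGroup mult_FactGroup)
    next
      case (incl c) then show ?case using Ugen by blast
    next
      case (inv c)
      then obtain a where a: "a \<in> V" "c = gen a" by blast
      have cA: "c \<in> carrier A" using a gen_closed by blast
      note ac = \<alpha>c[OF cA] and bc = \<beta>c[OF cA]
      show ?case
      proof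
        fix q assume q: "q \<in> carrier ?Q"
        let ?q = "inv\<^bsub>?Q\<^esub> (\<alpha> c) \<otimes>\<^bsub>?Q\<^esub> q \<otimes>\<^bsub>?Q\<^esub> \<beta> c"
        have q': "?q \<in> carrier ?Q" by (intro Q.m_closed Q.inv_closed ac bc q)
        have "\<alpha> c \<otimes>\<^bsub>?Q\<^esub> ?q \<otimes>\<^bsub>?Q\<^esub> inv\<^bsub>?Q\<^esub> (\<beta> c) = (\<alpha> c \<otimes>\<^bsub>?Q\<^esub> inv\<^bsub>?Q\<^esub> (\<alpha> c)) \<otimes>\<^bsub>?Q\<^esub> q \<otimes>\<^bsub>?Q\<^esub> (\<beta> c \<otimes>\<^bsub>?Q\<^esub> inv\<^bsub>?Q\<^esub> (\<beta> c))"
          using ac bc q by (simp only: Q.m_assoc Q.m_closed Q.inv_closed)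
        also have "\<dots> = q" using ac bc q by (simp only: Q.r_inv Q.l_one Q.r_one)
        finally have "int p dvd U q - U ?q" using Ugen[OF a(1) q'] unfolding a(2) by simp
        then have "int p dvd U ?q - U q" by (simp add: dvd_diff_commute)
        then show "int p dvd U (\<alpha> (inv\<^bsub>A\<^esub> c) \<otimes>\<^bsub>?Q\<^esub> q \<otimes>\<^bsub>?Q\<^esub> inv\<^bsub>?Q\<^esub> (\<beta> (inv\<^bsub>A\<^esub> c))) - U q"
          by (simp only: \<alpha>i[OF cA] \<beta>i[OF cA] Q.inv_inv[OF bc])
      qed
    next
      case (eng c d)
      have cd: "c \<in> carrier A" "d \<in> carrier A" using eng(1,2) A_generate by auto
      note cl = \<alpha>c[OF cd(1)] \<alpha>c[OF cd(2)] \<beta>c[OF cd(1)] \<beta>c[OF cd(2)]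
      show ?case
      proof
        fix q assume q: "q \<in> carrier ?Q"
        let ?q = "\<alpha> d \<otimes>\<^bsub>?Q\<^esub> q \<otimes>\<^bsub>?Q\<^esub> inv\<^bsub>?Q\<^esub> (\<beta> d)"
        have q': "?q \<in> carrier ?Q" by (intro Q.m_closed Q.inv_closed cl q)
        have "\<alpha> (c \<otimes>\<^bsub>A\<^esub> d) \<otimes>\<^bsub>?Q\<^esub> q \<otimes>\<^bsub>?Q\<^esub> inv\<^bsub>?Q\<^esub> (\<beta> (c \<otimes>\<^bsub>A\<^esub> d)) = \<alpha> c \<otimes>\<^bsub>?Q\<^esub> ?q \<otimes>\<^bsub>?Q\<^esub> inv\<^bsub>?Q\<^esub> (\<beta> c)"
          using cl q by (simp only: \<alpha>m[OF cd] \<beta>m[OF cd] Q.inv_mult_group Q.m_assoc Q.m_closed Q.inv_closed)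
        moreover have 1: "int p dvd U (\<alpha> c \<otimes>\<^bsub>?Q\<^esub> ?q \<otimes>\<^bsub>?Q\<^esub> inv\<^bsub>?Q\<^esub> (\<beta> c)) - U ?q" using eng.IH(1) q' by blast
        moreover have 2: "int p dvd U ?q - U q" using eng.IH(2) q by blast
        ultimately show "int p dvd U (\<alpha> (c \<otimes>\<^bsub>A\<^esub> d) \<otimes>\<^bsub>?Q\<^esub> q \<otimes>\<^bsub>?Q\<^esub> inv\<^bsub>?Q\<^esub> (\<beta> (c \<otimes>\<^bsub>A\<^esub> d))) - U q"
          using dvd_add[OF 1 2] by simp
      qed
    qed
  qed
  \<comment> \<open>the constant term of \<open>u\<close> is one, and \<open>a - 1\<close> has coefficient sum zero\<close>
  have Usum: "int p dvd (\<Sum>q\<in>carrier ?Q. U q) - 1"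
  proof -
    have hsum: "(\<Sum>q\<in>carrier ?Q. h q w) = (if w = [] then 1 else 0)" for w
    proof (cases w)
      case Nil
      have "(\<Sum>q\<in>carrier ?Q. \<delta> q) = (\<Sum>q\<in>{\<one>\<^bsub>?Q\<^esub>}. \<delta> q)"
        by (rule sum.mono_neutral_right) (use P_finite[OF N] Q.one_closed in \<open>auto simp: \<delta>_def\<close>)
      then show ?thesis using Nil by (simp add: h_def aug_op_Nil \<delta>_def)
    next
      case (Cons a v)
      show ?thesis
      proof (cases "set w \<subseteq> V")
        case True
        have "(\<Sum>q\<in>carrier ?Q. aug_op ?Q (?x a # map ?x v) \<delta> q) = 0"
          by (rule sum_aug_op[OF P_group[OF N]]) (use mapQ[OF True] Cons in simp)
        then show ?thesis using True Cons by (simp add: h_def)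
      next
        case False
        then have "h q w = 0" for q by (simp only: h_def if_False)
        then show ?thesis using Cons by simp
      qed
    qed
    have "(\<Sum>q\<in>carrier ?Q. U q) = pair u (\<lambda>w. if w = [] then 1 else 0)"
      unfolding U_def pair_fun_sum[symmetric] hsum by (rule HOL.refl)
    moreover have i: "trace_fun (int p) 1 (\<lambda>w. if w = [] then 1 else 0)" by (auto simp: trace_fun_def)
    have "u - 1 \<in> J (int p) 1" using u1 by simp
    from J_D[OF this i] have "int p dvd pair u (\<lambda>w. if w = [] then 1 else 0) - 1"
      by (simp add: pair_diff pair_1)
    ultimately show ?thesis by simp
  qed
  \<comment> \<open>the acting group is the image of \<open>A\<close> in \<open>Q \<times> Q\<close>, a \<open>p\<close>-group\<close>
  let ?D = "?Q \<times>\<times> ?Q"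
  have D: "group ?D" by (rule DirProd_group[OF P_group[OF N] P_group[OF N]])
  let ?H = "(\<lambda>c. (\<alpha> c, \<beta> c)) ` carrier A"
  have "group_hom A ?D (\<lambda>c. (\<alpha> c, \<beta> c))"
    unfolding group_hom_def group_hom_axioms_def
    using A.is_group D \<alpha>c \<beta>c \<alpha>m \<beta>m by (auto intro!: homI simp del: mult_FactGroup)
  then have H: "subgroup ?H ?D" using group_hom.subgroup_img_is_subgroup A.subgroup_self by blast
  have Hg: "group (?D\<lparr>carrier := ?H\<rparr>)" by (rule subgroup.subgroup_is_group[OF H D])
  have "card ?H dvd order ?D" 
    unfolding group.lagrange[OF D H, symmetric] by (rule dvd_triv_right)
  also have "order ?D = p ^ (r + r)" using r by (simp add: order_def DirProd_def card_cartesian_product power_add)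
  finally obtain s where s: "card ?H = p ^ s" using divides_primepow_nat[OF prime_p] by blast
  define act where "act g q = fst g \<otimes>\<^bsub>?Q\<^esub> q \<otimes>\<^bsub>?Q\<^esub> inv\<^bsub>?Q\<^esub> (snd g)" for g q
  let ?F = "{q. q \<in> carrier ?Q \<and> (\<forall>g\<in>carrier (?D\<lparr>carrier := ?H\<rparr>). act g q = q)}"
  have dvF: "int p dvd (\<Sum>q\<in>carrier ?Q. U q) - (\<Sum>q\<in>?F. U q)"
  proof (rule fixed_points_mod_p[OF Hg _ prime_p P_finite[OF N], where r = s])
    show "order (?D\<lparr>carrier := ?H\<rparr>) = p ^ s" using s by (simp add: order_def)
    fix g q assume "g \<in> carrier (?D\<lparr>carrier := ?H\<rparr>)" and q: "q \<in> carrier ?Q"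
    then obtain c where c: "c \<in> carrier A" "g = (\<alpha> c, \<beta> c)" by auto
    show "act g q \<in> carrier ?Q" unfolding act_def c(2) fst_conv snd_conv
      by (intro Q.m_closed Q.inv_closed \<alpha>c[OF c(1)] \<beta>c[OF c(1)] q)
    show "int p dvd U (act g q) - U q" using Uall[OF c(1)] q unfolding act_def c(2) fst_conv snd_conv by blast
    fix g' assume "g' \<in> carrier (?D\<lparr>carrier := ?H\<rparr>)"
    then obtain d where d: "d \<in> carrier A" "g' = (\<alpha> d, \<beta> d)" by auto
    note cl = \<alpha>c[OF c(1)] \<alpha>c[OF d(1)] \<beta>c[OF c(1)] \<beta>c[OF d(1)]
    have "g \<otimes>\<^bsub>?D\<lparr>carrier := ?H\<rparr>\<^esub> g' = (\<alpha> c \<otimes>\<^bsub>?Q\<^esub> \<alpha> d, \<beta> c \<otimes>\<^bsub>?Q\<^esub> \<beta> d)"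
      by (simp add: c(2) d(2) DirProd_def)
    then show "act (g \<otimes>\<^bsub>?D\<lparr>carrier := ?H\<rparr>\<^esub> g') q = act g (act g' q)"
      using cl q by (simp only: act_def c(2) d(2) fst_conv snd_conv Q.inv_mult_group Q.m_assoc Q.m_closed Q.inv_closed)
  next
    fix q assume q: "q \<in> carrier ?Q"
    have "\<one>\<^bsub>?D\<lparr>carrier := ?H\<rparr>\<^esub> = (\<one>\<^bsub>?Q\<^esub>, \<one>\<^bsub>?Q\<^esub>)" by (simp add: DirProd_def)
    then show "act \<one>\<^bsub>?D\<lparr>carrier := ?H\<rparr>\<^esub> q = q"
      using q by (simp only: act_def fst_conv snd_conv Q.inv_one Q.l_one Q.r_one)
  qed
  have "?F \<noteq> {}"
  proof
    assume "?F = {}"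
    then have "(\<Sum>q\<in>?F. U q) = 0" by (simp only: sum.empty)
    then have "int p dvd (\<Sum>q\<in>carrier ?Q. U q)" using dvF by simp
    from dvd_diff[OF this Usum] have "int p dvd 1" by simp
    then show False using prime_gt_1_nat[OF prime_p] by simp
  qed
  then obtain q where q: "q \<in> carrier ?Q" and fix_q: "\<And>c. c \<in> carrier A \<Longrightarrow> act (\<alpha> c, \<beta> c) q = q" by auto
  have qc: "\<alpha> c \<otimes>\<^bsub>?Q\<^esub> q = q \<otimes>\<^bsub>?Q\<^esub> \<beta> c" if c: "c \<in> carrier A" for c
  proof -
    have "\<alpha> c \<otimes>\<^bsub>?Q\<^esub> q \<otimes>\<^bsub>?Q\<^esub> inv\<^bsub>?Q\<^esub> (\<beta> c) \<otimes>\<^bsub>?Q\<^esub> \<beta> c = q \<otimes>\<^bsub>?Q\<^esub> \<beta> c"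
      using fix_q[OF c] by (simp only: act_def fst_conv snd_conv)
    then show ?thesis using \<alpha>c[OF c] \<beta>c[OF c] q by (simp only: Q.m_assoc Q.m_closed Q.inv_closed Q.l_inv Q.r_one)
  qed
  have "\<phi> g N <#>\<^bsub>A\<^esub> q = q <#>\<^bsub>A\<^esub> g N" if g: "g \<in> carrier PG" for g
  proof -
    obtain c where c: "c \<in> carrier A" "emb c N = g N" "\<phi> (emb c) N = \<phi> g N"
      using emb_approx[OF C.CA_auto(5)[OF \<phi>] C.CA_auto(1)[OF \<phi>] N N g] by blast
    show ?thesis using qc[OF c(1)] c(2,3) by (simp add: \<alpha>_def \<beta>_def emb_at[OF N])
  qed
  then show ?thesis using q by blast
qed

text \<open>The sets of elements that conjugate correctly modulo \<open>N\<close> are closed, non-empty and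
  decrease with \<open>N\<close>, so by compactness they have a common element.\<close>

lemma inner_mod_all_imp_Inn:
  assumes \<phi>: "\<phi> \<in> carrier C.CA" and inner_mod: "\<And>k. k \<ge> 2 \<Longrightarrow> M.inner_mod k \<phi>"
  shows "\<phi> \<in> Inn PG"
proof -
  define D where "D N = {q \<in> carrier (A Mod N). \<forall>g\<in>carrier PG. \<phi> g N <#>\<^bsub>A\<^esub> q = q <#>\<^bsub>A\<^esub> g N}" for N
  define S where "S N = {g \<in> carrier PG. g N \<in> D N}" for N
  have ne: "S N \<noteq> {}" if N: "N \<in> P" for N
  proof -
    obtain q where q: "q \<in> D N" using conjugating_coset[OF \<phi> inner_mod N] unfolding D_def by blast
    then obtain c where c: "c \<in> carrier A" "q = N #>\<^bsub>A\<^esub> c" by (auto simp: D_def carrier_FactGroup)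
    then have "emb c \<in> S N" using q emb_closed emb_at[OF N] by (simp add: S_def)
    then show ?thesis by blast
  qed
  have anti: "S M \<subseteq> S N" if M: "M \<in> P" and N: "N \<in> P" and MN: "M \<subseteq> N" for M N
  proof
    fix g assume g: "g \<in> S M"
    then have top_gen: "g \<in> carrier PG" by (simp add: S_def)
    obtain d where d: "d \<in> carrier A" "g M = M #>\<^bsub>A\<^esub> d" using PG_at_coset[OF top_gen M] by blast
    have "\<phi> x N <#>\<^bsub>A\<^esub> g N = g N <#>\<^bsub>A\<^esub> x N" if x: "x \<in> carrier PG" for x
    proof -
      have fx: "\<phi> x \<in> carrier PG" by (rule C.CA_closed[OF \<phi> x])
      obtain b where b: "b \<in> carrier A" "x M = M #>\<^bsub>A\<^esub> b" using PG_at_coset[OF x M] by blast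
      obtain c where c: "c \<in> carrier A" "\<phi> x M = M #>\<^bsub>A\<^esub> c" using PG_at_coset[OF fx M] by blast
      have "\<phi> x M <#>\<^bsub>A\<^esub> g M = g M <#>\<^bsub>A\<^esub> x M" using g x by (simp add: S_def D_def)
      then have e: "M #>\<^bsub>A\<^esub> (c \<otimes>\<^bsub>A\<^esub> d) = M #>\<^bsub>A\<^esub> (d \<otimes>\<^bsub>A\<^esub> b)"
        unfolding b(2) c(2) d(2) using normal.rcos_sum[OF P_normal[OF M]] b(1) c(1) d(1) by simp
      have "N #>\<^bsub>A\<^esub> (c \<otimes>\<^bsub>A\<^esub> d) = N <#>\<^bsub>A\<^esub> (M #>\<^bsub>A\<^esub> (c \<otimes>\<^bsub>A\<^esub> d))"
        using coset_coarsen[OF M N MN] c(1) d(1) by simp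
      also have "\<dots> = N #>\<^bsub>A\<^esub> (d \<otimes>\<^bsub>A\<^esub> b)" unfolding e using coset_coarsen[OF M N MN] b(1) d(1) by simp
      finally have "N #>\<^bsub>A\<^esub> (c \<otimes>\<^bsub>A\<^esub> d) = N #>\<^bsub>A\<^esub> (d \<otimes>\<^bsub>A\<^esub> b)" .
      then show ?thesis
        using PG_compat_coset[OF top_gen M N MN d] PG_compat_coset[OF x M N MN b] PG_compat_coset[OF fx M N MN c]
          normal.rcos_sum[OF P_normal[OF N]] b(1) c(1) d(1) by simp
    qed
    then show "g \<in> S N" using top_gen PG_at[OF top_gen N] by (simp add: S_def D_def)
  qed
  have "\<Inter>(S ` P) \<noteq> {}"
  proof (rule compact_PT[unfolded compact_space_fip, rule_format], intro conjI ballI allI impI)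
    fix Y assume "Y \<in> S ` P"
    then show "closedin PT Y" unfolding S_def using closedin_proj by blast
  next
    fix F assume F: "finite F \<and> F \<subseteq> S ` P"
    then obtain F' where F': "finite F'" "F' \<subseteq> P" "F = S ` F'" by (meson finite_subset_image)
    obtain M where M: "M \<in> P" "\<And>N. N \<in> F' \<Longrightarrow> M \<subseteq> N" using P_finite_lower[OF F'(1,2)] by blast
    have "S M \<subseteq> \<Inter>F" unfolding F'(3) using anti[OF M(1)] M(2) F'(2) by blast
    then show "\<Inter>F \<noteq> {}" using ne[OF M(1)] by blast
  qed
  then obtain g where g: "\<And>N. N \<in> P \<Longrightarrow> g \<in> S N" by blast
  have top_gen: "g \<in> carrier PG" using g[OF P_carrier] by (simp add: S_def)
  have comm: "\<phi> x \<otimes>\<^bsub>PG\<^esub> g = g \<otimes>\<^bsub>PG\<^esub> x" if x: "x \<in> carrier PG" for x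
  proof (rule PG_eqI)
    show "\<phi> x \<otimes>\<^bsub>PG\<^esub> g \<in> carrier PG" by (rule PG.m_closed[OF C.CA_closed[OF \<phi> x] top_gen])
    show "g \<otimes>\<^bsub>PG\<^esub> x \<in> carrier PG" by (rule PG.m_closed[OF top_gen x])
    fix N assume N: "N \<in> P"
    show "(\<phi> x \<otimes>\<^bsub>PG\<^esub> g) N = (g \<otimes>\<^bsub>PG\<^esub> x) N" using g[OF N] x by (simp add: PG_mult_at[OF N] S_def D_def)
  qed
  have "\<phi> = C.inn g"
  proof (rule C.CA_eqI[OF \<phi> C.inn_CA[OF top_gen]])
    fix x assume x: "x \<in> carrier PG"
    have fx: "\<phi> x \<in> carrier PG" by (rule C.CA_closed[OF \<phi> x])
    have "\<phi> x = \<phi> x \<otimes>\<^bsub>PG\<^esub> g \<otimes>\<^bsub>PG\<^esub> inv\<^bsub>PG\<^esub> g" using fx top_gen by (simp add: PG.m_assoc)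
    then show "\<phi> x = C.inn g x" using comm[OF x] x by simp
  qed
  then show ?thesis using top_gen C.Inn_conv by blast
qed

text \<open>The filtration starts at \<open>N\<^sub>2\<close>, which is everything.\<close>

lemma Torelli_residually_torsion_free_nilpotent:
  "residually_torsion_free_nilpotent (Torelli PG PT)"
proof -
  let ?B = "C.CA\<lparr>carrier := C.IA\<rparr>"
  define F where "F k = {\<phi> \<in> C.IA. M.inner_mod (k + 2) \<phi>}" for k
  note IA = C.IA_subgroup
  have IA_CA: "\<phi> \<in> C.IA \<Longrightarrow> \<phi> \<in> carrier C.CA" for \<phi> using subgroup.subset[OF IA] by blast
  have approximable: "M.approximable \<phi>" if "\<phi> \<in> C.IA" for \<phi> by (rule approximable_CA[OF IA_CA[OF that]])
  have IA_like: "M.IA_like \<phi>" if "\<phi> \<in> C.IA" for \<phi>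
    by (rule M.IA_like_I[OF approximable[OF that]]) (use that in \<open>simp add: C.IA_def\<close>)
  have cl: "\<phi> g \<in> carrier PG" if "\<phi> \<in> C.IA" "g \<in> carrier PG" for \<phi> g
    by (rule C.CA_closed[OF IA_CA[OF that(1)] that(2)])
  have iI: "inv\<^bsub>C.CA\<^esub> \<phi> \<in> C.IA" if "\<phi> \<in> C.IA" for \<phi> by (rule subgroup.m_inv_closed[OF IA that])
  have mI: "\<phi> \<otimes>\<^bsub>C.CA\<^esub> \<psi> \<in> C.IA" if "\<phi> \<in> C.IA" "\<psi> \<in> C.IA" for \<phi> \<psi> by (rule subgroup.m_closed[OF IA that])
  have B: "group ?B" by (rule subgroup.subgroup_is_group[OF IA C.group_CA])
  have inv_B: "inv\<^bsub>?B\<^esub> \<phi> = inv\<^bsub>C.CA\<^esub> \<phi>" if "\<phi> \<in> C.IA" for \<phi> by (rule C.CA.m_inv_consistent[OF IA that])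
  have I: "Inn PG \<lhd> ?B" by (rule C.CA.normal_restrict_supergroup[OF IA C.Inn_normal C.Inn_IA])
  have pow: "(\<phi> [^]\<^bsub>?B\<^esub> (q::nat)) g = (\<phi> ^^ q) g" if \<phi>: "\<phi> \<in> C.IA" and g: "g \<in> carrier PG" for \<phi> q g
  proof -
    interpret B: group ?B by (rule B)
    show ?thesis using g
    proof (induction q arbitrary: g)
      case 0 then show ?case by (simp add: C.CA_one)
    next
      case (Suc q)
      have "\<phi> [^]\<^bsub>?B\<^esub> q \<in> carrier ?B" using \<phi> by (intro B.nat_pow_closed) simp
      then have "(\<phi> [^]\<^bsub>?B\<^esub> Suc q) g = (\<phi> [^]\<^bsub>?B\<^esub> q) (\<phi> g)"
        using C.CA_mult_at[of "\<phi> [^]\<^bsub>?B\<^esub> q" \<phi> g] IA_CA \<phi> Suc.prems by simp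
      also have "\<dots> = (\<phi> ^^ Suc q) g" using Suc.IH[OF cl[OF \<phi> Suc.prems]] by (simp add: funpow_swap1)
      finally show ?case .
    qed
  qed
  have "residually_torsion_free_nilpotent (?B Mod Inn PG)" (is "residually_torsion_free_nilpotent ?T")
  proof (rule residually_torsion_free_nilpotent_FactGroupI[OF B I, where N = F])
    fix k
    show "subgroup (F k) ?B"
    proof (rule group.subgroupI[OF B])
      show "F k \<subseteq> carrier ?B" by (auto simp: F_def)
      have "\<one>\<^bsub>C.CA\<^esub> \<in> Inn PG" using subgroup.one_closed[OF normal_imp_subgroup[OF C.Inn_normal]] .
      show "F k \<noteq> {}"
      proof -
        have 1: "\<one>\<^bsub>C.CA\<^esub> \<in> C.IA" using subgroup.one_closed[OF IA] .
        have "M.inner_mod (k + 2) \<one>\<^bsub>C.CA\<^esub>"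
          by (rule M.inner_mod_inner[OF PG.one_closed approximable[OF 1]]) (simp_all add: C.CA_one)
        then show ?thesis using 1 unfolding F_def by blast
      qed
      fix \<phi> assume "\<phi> \<in> F k"
      then have \<phi>: "\<phi> \<in> C.IA" "M.inner_mod (k + 2) \<phi>" by (auto simp: F_def)
      have "M.inner_mod (k + 2) (inv\<^bsub>C.CA\<^esub> \<phi>)"
        by (rule M.inner_mod_inv[OF \<phi>(2) approximable[OF iI[OF \<phi>(1)]]]) (simp_all add: C.CA_inv_at[OF IA_CA[OF \<phi>(1)]])
      then show "inv\<^bsub>?B\<^esub> \<phi> \<in> F k" unfolding inv_B[OF \<phi>(1)] F_def using iI[OF \<phi>(1)] by blast
      fix \<psi> assume "\<psi> \<in> F k"
      then have \<psi>: "\<psi> \<in> C.IA" "M.inner_mod (k + 2) \<psi>" by (auto simp: F_def)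
      have "M.inner_mod (k + 2) (\<lambda>g. \<phi> (\<psi> g))" by (rule M.inner_mod_comp[OF \<phi>(2) \<psi>(2) _ cl[OF \<psi>(1)]]) simp
      then have "M.inner_mod (k + 2) (\<phi> \<otimes>\<^bsub>C.CA\<^esub> \<psi>)"
        by (rule M.inner_mod_cong) (simp add: C.CA_mult_at[OF IA_CA[OF \<phi>(1)] IA_CA[OF \<psi>(1)]])
      then show "\<phi> \<otimes>\<^bsub>?B\<^esub> \<psi> \<in> F k" using mI[OF \<phi>(1) \<psi>(1)] by (simp add: F_def)
    qed
    show "Inn PG \<subseteq> F k"
    proof
      fix \<phi> assume i: "\<phi> \<in> Inn PG"
      then obtain g where g: "g \<in> carrier PG" "\<phi> = C.inn g" using C.Inn_conv by blast
      have \<phi>: "\<phi> \<in> C.IA" using i C.Inn_IA by blast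
      have "M.inner_mod (k + 2) \<phi>" by (rule M.inner_mod_inner[OF g(1) approximable[OF \<phi>]]) (simp_all add: g(2))
      then show "\<phi> \<in> F k" using \<phi> by (simp add: F_def)
    qed
    show "F (Suc k) \<subseteq> F k"
    proof
      fix \<phi> assume "\<phi> \<in> F (Suc k)"
      then have \<phi>: "\<phi> \<in> C.IA" "M.inner_mod (Suc k + 2) \<phi>" by (auto simp: F_def)
      have "M.inner_mod (k + 2) \<phi>" by (rule M.inner_mod_mono[OF \<phi>(2) _ cl[OF \<phi>(1)]]) simp
      then show "\<phi> \<in> F k" using \<phi>(1) by (simp add: F_def)
    qed
  next
    have "M.inner_mod (0 + 2) \<phi>" if "\<phi> \<in> C.IA" for \<phi> using M.inner_mod_2[OF IA_like[OF that]] by (simp only: add_0)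
    then have "F 0 = C.IA" unfolding F_def by blast
    then show "F 0 = carrier ?B" by simp
  next
    fix k \<phi> \<psi> assume "\<phi> \<in> F k" and "\<psi> \<in> carrier ?B"
    then have \<phi>: "\<phi> \<in> C.IA" "M.inner_mod (k + 2) \<phi>" and \<psi>: "\<psi> \<in> C.IA" by (auto simp: F_def)
    note c\<phi> = IA_CA[OF \<phi>(1)] and c\<psi> = IA_CA[OF \<psi>]
    let ?\<theta> = "\<phi> \<otimes>\<^bsub>C.CA\<^esub> \<psi> \<otimes>\<^bsub>C.CA\<^esub> inv\<^bsub>C.CA\<^esub> \<phi> \<otimes>\<^bsub>C.CA\<^esub> inv\<^bsub>C.CA\<^esub> \<psi>"
    have \<theta>: "?\<theta> \<in> C.IA" by (intro mI iI \<phi>(1) \<psi>)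
    have "?\<theta> \<otimes>\<^bsub>C.CA\<^esub> (\<psi> \<otimes>\<^bsub>C.CA\<^esub> \<phi>) = \<phi> \<otimes>\<^bsub>C.CA\<^esub> \<psi>"
      using c\<phi> c\<psi> by (simp add: C.CA.m_assoc) (simp add: C.CA.m_assoc[symmetric])
    then have eq: "?\<theta> (\<psi> (\<phi> g)) = \<phi> (\<psi> g)" if "g \<in> carrier PG" for g
      using that C.CA_mult_at[OF IA_CA[OF \<theta>] C.CA.m_closed[OF c\<psi> c\<phi>] that] C.CA_mult_at[OF c\<psi> c\<phi> that] C.CA_mult_at[OF c\<phi> c\<psi> that] by simp
    have "M.inner_mod (Suc (k + 2)) ?\<theta>"
      by (rule M.inner_mod_commutator[where \<phi> = \<phi> and \<psi> = \<psi> and \<phi>' = "inv\<^bsub>C.CA\<^esub> \<phi>" and \<psi>' = "inv\<^bsub>C.CA\<^esub> \<psi>",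
            OF approximable[OF \<phi>(1)] \<phi>(2) IA_like[OF \<psi>] approximable[OF \<theta>] approximable[OF iI[OF \<phi>(1)]] C.CA_inv_at(1)[OF c\<phi>]
              approximable[OF iI[OF \<psi>]] C.CA_inv_at(1)[OF c\<psi>] eq])
        simp_all
    then show "\<phi> \<otimes>\<^bsub>?B\<^esub> \<psi> \<otimes>\<^bsub>?B\<^esub> inv\<^bsub>?B\<^esub> \<phi> \<otimes>\<^bsub>?B\<^esub> inv\<^bsub>?B\<^esub> \<psi> \<in> F (Suc k)"
      using \<theta> unfolding inv_B[OF \<phi>(1)] inv_B[OF \<psi>] by (simp add: F_def)
  next
    fix k \<phi> and q :: nat assume "\<phi> \<in> F k" and q: "prime q" and "\<phi> [^]\<^bsub>?B\<^esub> q \<in> F (Suc k)"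
    then have \<phi>: "\<phi> \<in> C.IA" "M.inner_mod (k + 2) \<phi>" and pw: "M.inner_mod (Suc (k + 2)) (\<phi> [^]\<^bsub>?B\<^esub> q)" by (auto simp: F_def)
    have "M.inner_mod (Suc (k + 2)) (\<phi> ^^ q)" by (rule M.inner_mod_cong[OF pw pow[OF \<phi>(1)]])
    then have "M.inner_mod (Suc (k + 2)) \<phi>" by (intro M.inner_mod_torsion[OF approximable[OF \<phi>(1)] \<phi>(2) _ q]) simp_all
    then show "\<phi> \<in> F (Suc k)" using \<phi>(1) by (simp add: F_def)
  next
    fix \<phi> assume "\<phi> \<in> carrier ?B" and all: "\<And>k. \<phi> \<in> F k"
    then have \<phi>: "\<phi> \<in> C.IA" by simp
    show "\<phi> \<in> Inn PG"
    proof (rule inner_mod_all_imp_Inn[OF IA_CA[OF \<phi>]])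
      fix k :: nat assume "k \<ge> 2"
      then have "k - 2 + 2 = k" by simp
      moreover have "M.inner_mod (k - 2 + 2) \<phi>" using all[of "k - 2"] unfolding F_def by blast
      ultimately show "M.inner_mod k \<phi>" by (simp only:)
    qed
  qed
  moreover have "Torelli PG PT = ?T" by (rule C.Torelli_eq)
  ultimately show ?thesis by (simp only:)
qed

end

theorem theorem1p7:
  fixes p :: nat and V :: "'a set" and E :: "'a set set"
  assumes "prime p"
    and "finite V"
    and "\<And>e. e \<in> E \<Longrightarrow> e \<subseteq> V \<and> card e = 2"
  shows "residually_torsion_free_nilpotent
           (Torelli (pro_p_completion p (raag V E)) (pro_p_topology p (raag V E)))"
proof -
  interpret raag_pro_p V E p
    using assms by (intro raag_pro_p.intro commutation_graph.intro raag_pro_p_axioms.intro)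
  show ?thesis by (rule Torelli_residually_torsion_free_nilpotent)
qed

end
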